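(* Suppose the following holds: there exists an absolute constant $C\ge 1$ such that for every constant $\epsilon>0$, it is NP-hard to approximate UMPS instances containing $n$ jobs within a $(\log n)^{1-\epsilon}$ factor, even when the number of machines $m$ is at most $(\log n)^C$ and all jobs have unit length. Suppose also that $\textsf{NP}\nsubseteq \textsf{DTIME}\left(n^{(\log n)^{O(1)}}\right)$. Then there exists an absolute constant $\gamma>0$ such that the problem of scheduling related machines with precedences ($\mathsf{Q}\mid\mathsf{prec}\mid C_{\max}$) has no polynomial time $\Omega\left((\log m)^{\gamma}\right)$-factor approximation algorithm, where $m$ is the number of machines.
   Context: In the Unique Machine Precedence constraint Scheduling (UMPS) problem, the input is a set of $m$ machines and $n$ jobs $j_1,\dots,j_n$ with precedence relations among them (a partial order). Each job $j_l$ can be scheduled only on a fixed machine $M(l)\in[m]$ and takes $p(l)$ time to complete (unit length means $p(l)=1$). Jobs are scheduled non-preemptively on their machines, each machine processing at most one job at a time, respecting precedences; the objective is to minimize the makespan. In the problem of scheduling related machines with precedences ($\mathsf{Q}\mid\mathsf{prec}\mid C_{\max}$), the input is a set of $m$ machines, machine $i$ having speed $s_i\in\mathbb{Z}^+$, and a set of $n$ jobs with precedence constraints, job $j$ having processing time $p_j\in\mathbb{Z}^+$; processing job $j$ on machine $i$ takes $p_j/s_i$ time. Jobs are scheduled non-preemptively, each on one machine, each machine processing at most one job at a time, respecting precedences, to minimize makespan. *)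

theory Defs
  imports Complex_Main "HOL-Library.Landau_Symbols"
begin

section \<open>Deterministic multi-tape Turing machines\<close>

text \<open>
  States and tape symbols are initial segments of the natural numbers. State 0 is the start state and
  state 1 the halting state; symbol 0 is the blank, symbols 1 and 2 represent the bits 0 and 1.
  Given the current state and the list of scanned symbols, the transition function yields the next
  state and, for each tape, the symbol to write and the head movement. All tapes are two-way infinite.
\<close>

record tm =
  tapes :: nat
  states :: nat
  symbols :: nat
  delta :: "nat \<Rightarrow> nat list \<Rightarrow> nat \<times> (nat \<times> int) list"

definition turing_machine :: "tm \<Rightarrow> bool" where
  "turing_machine M \<longleftrightarrow> tapes M \<ge> 2 \<and> states M \<ge> 2 \<and> symbols M \<ge> 3 \<and>
     (\<forall>q ss. q < states M \<longrightarrow> length ss = tapes M \<longrightarrow> set ss \<subseteq> {..<symbols M} \<longrightarrow>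
        (case delta M q ss of (q', as) \<Rightarrow>
           q' < states M \<and> length as = tapes M \<and> set as \<subseteq> {..<symbols M} \<times> {-1, 0, 1}))"

type_synonym tape = "(int \<Rightarrow> nat) \<times> int"
type_synonym tm_config = "nat \<times> tape list"

definition scan :: "tape \<Rightarrow> nat" where
  "scan tp = fst tp (snd tp)"

definition act :: "tape \<Rightarrow> nat \<times> int \<Rightarrow> tape" where
  "act tp a = ((fst tp)(snd tp := fst a), snd tp + snd a)"

definition tm_step :: "tm \<Rightarrow> tm_config \<Rightarrow> tm_config" where
  "tm_step M c = (case c of (q, ts) \<Rightarrow>
     if q = 1 then c
     else (case delta M q (map scan ts) of (q', as) \<Rightarrow> (q', map2 act ts as)))"

definition bit_symbol :: "bool \<Rightarrow> nat" where
  "bit_symbol b = (if b then 2 else 1)"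

definition input_tape :: "bool list \<Rightarrow> tape" where
  "input_tape x =
     (\<lambda>i. if 0 \<le> i \<and> i < int (length x) then bit_symbol (x ! nat i) else 0, 0)"

definition tm_init :: "tm \<Rightarrow> bool list \<Rightarrow> tm_config" where
  "tm_init M x = (0, input_tape x # replicate (tapes M - 1) (\<lambda>_. 0, 0))"

text \<open>The output is the word that starts in cell 0 of the last tape and ends before the next blank.\<close>

definition tape_output :: "tape \<Rightarrow> bool list \<Rightarrow> bool" where
  "tape_output tp y \<longleftrightarrow>
     (\<forall>i<length y. fst tp (int i) = bit_symbol (y ! i)) \<and> fst tp (int (length y)) = 0"

text \<open>As halting configurations are fixed points of \<^const>\<open>tm_step\<close>, the following says
  that \<open>M\<close> halts on \<open>x\<close> after at most \<open>t\<close> steps, with output \<open>y\<close>.\<close>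

definition computes_in :: "tm \<Rightarrow> bool list \<Rightarrow> bool list \<Rightarrow> nat \<Rightarrow> bool" where
  "computes_in M x y t \<longleftrightarrow>
     (case (tm_step M ^^ t) (tm_init M x) of (q, ts) \<Rightarrow> q = 1 \<and> tape_output (last ts) y)"


section \<open>Complexity classes\<close>

definition DTIME :: "(nat \<Rightarrow> real) \<Rightarrow> bool list set set" where
  "DTIME T = {L. \<exists>M t. turing_machine M \<and> (\<lambda>n. real (t n)) \<in> O(T) \<and>
                   (\<forall>x. computes_in M x [x \<in> L] (t (length x)))}"

definition class_P :: "bool list set set" where
  "class_P = (\<Union>k::nat. DTIME (\<lambda>n. real n ^ k))"

definition enc_bits :: "bool list \<Rightarrow> bool list" where
  "enc_bits bs = concat (map (\<lambda>b. [True, b]) bs) @ [False]"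

definition pair_bits :: "bool list \<Rightarrow> bool list \<Rightarrow> bool list" where
  "pair_bits x w = enc_bits x @ w"

definition class_NP :: "bool list set set" where
  "class_NP = {L. \<exists>V\<in>class_P. \<exists>k::nat. \<forall>x.
     x \<in> L \<longleftrightarrow> (\<exists>w. length w \<le> length x ^ k + k \<and> pair_bits x w \<in> V)}"

definition quasi_poly_time :: "bool list set set" where
  "quasi_poly_time = (\<Union>c::nat. DTIME (\<lambda>n. real n powr (log 2 (real n) ^ c)))"

definition poly_time_computable :: "(bool list \<Rightarrow> bool list) \<Rightarrow> bool" where
  "poly_time_computable f \<longleftrightarrow>
     (\<exists>M k. turing_machine M \<and> (\<forall>x. computes_in M x (f x) (length x ^ k + k)))"

text \<open>NP-hardness, under polynomial-time many-one reductions, of the promise problem with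
  yes-instances \<open>Y\<close> and no-instances \<open>N\<close>.\<close>

definition NP_hard_promise :: "bool list set \<Rightarrow> bool list set \<Rightarrow> bool" where
  "NP_hard_promise Y N \<longleftrightarrow>
     (\<forall>L\<in>class_NP. \<exists>f. poly_time_computable f \<and>
        (\<forall>x. (x \<in> L \<longrightarrow> f x \<in> Y) \<and> (x \<notin> L \<longrightarrow> f x \<in> N)))"


section \<open>Binary encodings\<close>

text \<open>Least significant bit first.\<close>

fun binary :: "nat \<Rightarrow> bool list" where
  "binary n = (if n = 0 then [] else odd n # binary (n div 2))"

declare binary.simps [simp del]

definition enc_nat :: "nat \<Rightarrow> bool list" where
  "enc_nat n = enc_bits (binary n)"

definition enc_nats :: "nat list \<Rightarrow> bool list" where
  "enc_nats ns = enc_nat (length ns) @ concat (map enc_nat ns)"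

definition enc_pairs :: "(nat \<times> nat) list \<Rightarrow> bool list" where
  "enc_pairs ps = enc_nats (concat (map (\<lambda>(i, j). [i, j]) ps))"


section \<open>Non-preemptive schedules\<close>

text \<open>Jobs are \<open>0, \<dots>, n - 1\<close>; \<open>(i, j) \<in> R\<close> means that job \<open>i\<close> must be completed before
  job \<open>j\<close> starts. Job \<open>j\<close> occupies machine \<open>mach j\<close> from time \<open>start j\<close> to \<open>start j + dur j\<close>.\<close>

definition strict_order_on :: "nat \<Rightarrow> (nat \<times> nat) set \<Rightarrow> bool" where
  "strict_order_on n R \<longleftrightarrow> R \<subseteq> {..<n} \<times> {..<n} \<and> irrefl R \<and> trans R"

definition feasible ::
  "nat \<Rightarrow> (nat \<times> nat) set \<Rightarrow> (nat \<Rightarrow> nat) \<Rightarrow> (nat \<Rightarrow> real) \<Rightarrow> (nat \<Rightarrow> real) \<Rightarrow> bool" where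
  "feasible n R mach dur start \<longleftrightarrow>
     (\<forall>j<n. 0 \<le> start j) \<and>
     (\<forall>(i, j)\<in>R. start i + dur i \<le> start j) \<and>
     (\<forall>i<n. \<forall>j<n. i \<noteq> j \<and> mach i = mach j \<longrightarrow>
        start i + dur i \<le> start j \<or> start j + dur j \<le> start i)"

definition makespan :: "nat \<Rightarrow> (nat \<Rightarrow> real) \<Rightarrow> (nat \<Rightarrow> real) \<Rightarrow> real" where
  "makespan n dur start = Max (insert 0 ((\<lambda>j. start j + dur j) ` {..<n}))"


section \<open>Unique machine precedence constrained scheduling\<close>

record umps =
  umps_machines :: nat
  umps_machine_of :: "nat list"
  umps_length :: "nat list"
  umps_prec :: "(nat \<times> nat) list"

definition umps_jobs :: "umps \<Rightarrow> nat" where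
  "umps_jobs I = length (umps_machine_of I)"

definition umps_instance :: "umps \<Rightarrow> bool" where
  "umps_instance I \<longleftrightarrow>
     length (umps_length I) = umps_jobs I \<and>
     (\<forall>i\<in>set (umps_machine_of I). i < umps_machines I) \<and>
     (\<forall>p\<in>set (umps_length I). 0 < p) \<and>
     strict_order_on (umps_jobs I) (set (umps_prec I))"

definition umps_unit :: "umps \<Rightarrow> bool" where
  "umps_unit I \<longleftrightarrow> (\<forall>p\<in>set (umps_length I). p = 1)"

definition umps_dur :: "umps \<Rightarrow> nat \<Rightarrow> real" where
  "umps_dur I j = real (umps_length I ! j)"

definition umps_opt :: "umps \<Rightarrow> real" where
  "umps_opt I = Inf {makespan (umps_jobs I) (umps_dur I) start | start.
     feasible (umps_jobs I) (set (umps_prec I)) (\<lambda>j. umps_machine_of I ! j) (umps_dur I) start}"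

definition enc_umps_threshold :: "umps \<Rightarrow> nat \<Rightarrow> bool list" where
  "enc_umps_threshold I T =
     enc_nat (umps_machines I) @ enc_nats (umps_machine_of I) @ enc_nats (umps_length I) @
     enc_pairs (umps_prec I) @ enc_nat T"

text \<open>NP-hardness of approximating the instances in \<open>K\<close> within a factor \<open>\<alpha> n\<close>, where \<open>n\<close> is the
  number of jobs: it is NP-hard to tell whether the optimum is at most \<open>T\<close> or exceeds \<open>\<alpha> n * T\<close>.\<close>

definition umps_NP_hard_to_approximate :: "(umps \<Rightarrow> bool) \<Rightarrow> (nat \<Rightarrow> real) \<Rightarrow> bool" where
  "umps_NP_hard_to_approximate K \<alpha> \<longleftrightarrow> NP_hard_promise
     {enc_umps_threshold I T | I T. umps_instance I \<and> K I \<and> umps_opt I \<le> real T}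
     {enc_umps_threshold I T | I T. umps_instance I \<and> K I \<and> umps_opt I > \<alpha> (umps_jobs I) * real T}"


section \<open>Related machines with precedence constraints\<close>

record qprec =
  q_speeds :: "nat list"
  q_procs :: "nat list"
  q_prec :: "(nat \<times> nat) list"

definition q_machines :: "qprec \<Rightarrow> nat" where
  "q_machines I = length (q_speeds I)"

definition q_jobs :: "qprec \<Rightarrow> nat" where
  "q_jobs I = length (q_procs I)"

definition q_instance :: "qprec \<Rightarrow> bool" where
  "q_instance I \<longleftrightarrow>
     0 < q_machines I \<and>
     (\<forall>s\<in>set (q_speeds I). 0 < s) \<and>
     (\<forall>p\<in>set (q_procs I). 0 < p) \<and>
     strict_order_on (q_jobs I) (set (q_prec I))"

definition q_dur :: "qprec \<Rightarrow> (nat \<Rightarrow> nat) \<Rightarrow> nat \<Rightarrow> real" where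
  "q_dur I mach j = real (q_procs I ! j) / real (q_speeds I ! mach j)"

definition q_feasible :: "qprec \<Rightarrow> (nat \<Rightarrow> nat) \<Rightarrow> (nat \<Rightarrow> real) \<Rightarrow> bool" where
  "q_feasible I mach start \<longleftrightarrow>
     (\<forall>j<q_jobs I. mach j < q_machines I) \<and>
     feasible (q_jobs I) (set (q_prec I)) mach (q_dur I mach) start"

definition q_makespan :: "qprec \<Rightarrow> (nat \<Rightarrow> nat) \<Rightarrow> (nat \<Rightarrow> real) \<Rightarrow> real" where
  "q_makespan I mach start = makespan (q_jobs I) (q_dur I mach) start"

definition q_opt :: "qprec \<Rightarrow> real" where
  "q_opt I = Inf {q_makespan I mach start | mach start. q_feasible I mach start}"

definition enc_q :: "qprec \<Rightarrow> bool list" where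
  "enc_q I = enc_nats (q_speeds I) @ enc_nats (q_procs I) @ enc_pairs (q_prec I)"

text \<open>Algorithms return explicit schedules, with one triple \<open>(i, a, b)\<close> per job: the job runs on
  machine \<open>i\<close> and starts at the rational time \<open>a / b\<close>.\<close>

type_synonym schedule = "(nat \<times> nat \<times> nat) list"

definition sched_mach :: "schedule \<Rightarrow> nat \<Rightarrow> nat" where
  "sched_mach S j = fst (S ! j)"

definition sched_start :: "schedule \<Rightarrow> nat \<Rightarrow> real" where
  "sched_start S j = real (fst (snd (S ! j))) / real (snd (snd (S ! j)))"

definition q_schedule :: "qprec \<Rightarrow> schedule \<Rightarrow> bool" where
  "q_schedule I S \<longleftrightarrow> length S = q_jobs I \<and> (\<forall>(i, a, b)\<in>set S. 0 < b) \<and>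
     q_feasible I (sched_mach S) (sched_start S)"

definition enc_schedule :: "schedule \<Rightarrow> bool list" where
  "enc_schedule S = enc_nats (concat (map (\<lambda>(i, a, b). [i, a, b]) S))"

definition q_poly_time_approximation :: "(nat \<Rightarrow> real) \<Rightarrow> bool" where
  "q_poly_time_approximation g \<longleftrightarrow>
     (\<exists>M k. turing_machine M \<and>
        (\<forall>I. q_instance I \<longrightarrow>
           (\<exists>S. computes_in M (enc_q I) (enc_schedule S) (length (enc_q I) ^ k + k) \<and>
                q_schedule I S \<and>
                q_makespan I (sched_mach S) (sched_start S) \<le> g (q_machines I) * q_opt I)))"

end

theory Submission
  imports Defs "HOL-Real_Asymp.Real_Asymp"
begin

text \<open>
  Let \<open>K\<close> be a power of two above \<open>n ^ 3\<close>. A unit UMPS instance with \<open>n\<close> jobs and \<open>m\<close> machines is turned into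
  related machines by replacing machine \<open>i\<close> by \<open>K ^ (2 * (m - i))\<close> machines of speed \<open>K ^ i\<close> and each of its
  jobs by a bundle of as many jobs of size \<open>K ^ i\<close>. On a slower group a single such job takes time \<open>K\<close>, and
  the faster groups have room for a negligible part of a bundle only, so both instances have the same
  optimum. There are \<open>n ^ polylog n\<close> machines, hence \<open>(log M) powr \<gamma>\<close> is below \<open>sqrt (log n)\<close> for small \<open>\<gamma>\<close>, and a
  polynomial-time approximation algorithm for related machines closes the gap of UMPS in
  quasi-polynomial time. Instances of bounded size are decided by a finite table.

  Turing machines are not programmed directly. Programs on binary trees, which are stored as words on
  stacks, are compiled to Turing machines; the functions they compute in polynomial time are closed under
  composition and bounded iteration and include the simulation of any Turing machine.
\<close>

section \<open>Structured programs for multi-tape Turing machines\<close>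

text \<open>The factor 2 in the exponent of \<open>K ^ (2 * (m - i))\<close> is what makes faster
  groups useless: one level up a machine gets through \<open>K\<close> times as many jobs of a
  bundle, but there are \<open>K ^ 2\<close> times fewer machines. Within a makespan below
  \<open>n\<close>, the faster groups together absorb less than a fraction \<open>m * n / K\<close>
  of a bundle. If \<open>m * n * n \<le> K\<close>, this is at most \<open>1 / n\<close>, so
  \<open>n\<close> bundles lose less than one bundle in total, and integrality makes the optima
  equal and not merely close. The bound on the number of UMPS machines gives \<open>log M\<close> at
  most \<open>18 * (log n) powr (C + 1)\<close>. With \<open>\<gamma> = 1 / (4 * (C + 1))\<close>
  the ratio is of order \<open>(log n) powr (1/4)\<close>, while \<open>\<epsilon> = 1/4\<close>
  yields a gap of \<open>(log n) powr (3/4)\<close>; a threshold near \<open>sqrt (log n)\<close>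
  leaves room for constant factors. The obstacle is the machine model: hypotheses and conclusion
  speak of Turing machines on binary words, whereas numbers in the tree programs are unary. Values
  that may be exponentially large (thresholds, start times) are therefore capped or compared by bit
  length, and \<open>K\<close> is a power of two so that its powers arise by halving.\<close>

datatype cmd =
    Act nat "nat \<Rightarrow> nat" int
  | Seq cmd cmd
  | Cond nat "nat \<Rightarrow> bool" cmd cmd
  | While nat "nat \<Rightarrow> bool" cmd

fun next_cmds :: "nat list \<Rightarrow> cmd list \<Rightarrow> cmd list" where
  "next_cmds ss [] = []"
| "next_cmds ss (Act i w d # K) = K"
| "next_cmds ss (Seq c d # K) = c # d # K"
| "next_cmds ss (Cond i b c d # K) = (if b (ss ! i) then c else d) # K"
| "next_cmds ss (While i b c # K) = (if b (ss ! i) then c # While i b c # K else K)"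

text \<open>Only an \<open>Act\<close> on top of the stack touches a tape. Every other tape rewrites
  its scanned symbol without moving, so each visit to a \<open>Seq\<close>, \<open>Cond\<close> or
  \<open>While\<close> costs one idle step.\<close>

fun cmd_action :: "cmd list \<Rightarrow> nat \<Rightarrow> nat \<Rightarrow> nat \<times> int" where
  "cmd_action (Act i w d # K) j a = (if j = i then (w a, d) else (a, 0))"
| "cmd_action K j a = (a, 0)"

definition cmd_step :: "cmd list \<times> tape list \<Rightarrow> cmd list \<times> tape list" where
  "cmd_step = (\<lambda>(K, ts). (next_cmds (map scan ts) K,
     map2 act ts (map (\<lambda>j. cmd_action K j (scan (ts ! j))) [0..<length ts])))"

lemma map2_act_idle: "map2 act ts (map (\<lambda>j. (scan (ts ! j), 0)) [0..<length ts]) = ts"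
  by (rule nth_equalityI) (auto simp: act_def scan_def)

fun well_formed :: "nat \<Rightarrow> nat \<Rightarrow> cmd \<Rightarrow> bool" where
  "well_formed k S (Act i w d) \<longleftrightarrow> i < k \<and> (\<forall>a<S. w a < S) \<and> d \<in> {-1, 0, 1}"
| "well_formed k S (Seq c d) \<longleftrightarrow> well_formed k S c \<and> well_formed k S d"
| "well_formed k S (Cond i b c d) \<longleftrightarrow> i < k \<and> well_formed k S c \<and> well_formed k S d"
| "well_formed k S (While i b c) \<longleftrightarrow> i < k \<and> well_formed k S c"

text \<open>A program is executed with a stack of pending commands. Only finitely many such stacks arise, and
  they serve as the states of the Turing machine.\<close>

fun reach :: "cmd \<Rightarrow> cmd list \<Rightarrow> cmd list set" where
  "reach (Act i w d) K = {Act i w d # K}"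
| "reach (Seq c d) K = insert (Seq c d # K) (reach c (d # K) \<union> reach d K)"
| "reach (Cond i b c d) K = insert (Cond i b c d # K) (reach c K \<union> reach d K)"
| "reach (While i b c) K = insert (While i b c # K) (reach c (While i b c # K))"

lemma finite_reach: "finite (reach c K)"
  by (induction c arbitrary: K) auto

lemma reach_start: "c # K \<in> reach c K"
  by (cases c) auto

lemma reach_closed: "X \<in> reach c K \<Longrightarrow> next_cmds ss X \<in> insert K (reach c K)"
proof (induction c arbitrary: K X)
  case (Act i w d)
  then show ?case by auto
next
  case (Seq c d)
  then consider "X = Seq c d # K" | "X \<in> reach c (d # K)" | "X \<in> reach d K" by auto
  then show ?case
    using Seq.IH(1)[of X "d # K"] Seq.IH(2)[of X K] reach_start[of c "d # K"] reach_start[of d K]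
    by cases auto
next
  case (Cond i b c d)
  then consider "X = Cond i b c d # K" | "X \<in> reach c K" | "X \<in> reach d K" by auto
  then show ?case
    using Cond.IH(1)[of X K] Cond.IH(2)[of X K] reach_start[of c K] reach_start[of d K]
    by cases auto
next
  case (While i b c)
  then consider "X = While i b c # K" | "X \<in> reach c (While i b c # K)" by auto
  then show ?case
    using While.IH[of X "While i b c # K"] reach_start[of c "While i b c # K"]
    by cases auto
qed

lemma reach_well_formed:
  "well_formed k S c \<Longrightarrow> list_all (well_formed k S) K \<Longrightarrow> X \<in> reach c K \<Longrightarrow>
   list_all (well_formed k S) X"
proof (induction c arbitrary: K)
  case (Seq c d)
  show ?case
    using Seq.IH(1)[of "d # K"] Seq.IH(2)[of K] Seq.prems by auto
next
  case (Cond i b c d)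
  show ?case
    using Cond.IH(1)[of K] Cond.IH(2)[of K] Cond.prems by auto
next
  case (While i b c)
  show ?case
    using While.IH[of "While i b c # K"] While.prems by auto
qed auto

lemma cmd_action_ok:
  "list_all (well_formed k S) K \<Longrightarrow> a < S \<Longrightarrow> cmd_action K j a \<in> {..<S} \<times> {-1, 0, 1}"
  by (cases "(K, j, a)" rule: cmd_action.cases) auto

text \<open>States 0 and 1 of a \<open>tm\<close> are reserved for starting and halting, so the
  stacks \<open>[c]\<close> and \<open>[]\<close> must receive these numbers; all others are shifted
  by 2.\<close>

lemma exists_numbering:
  assumes "finite X" "p \<noteq> q"
  shows "\<exists>h :: 'a \<Rightarrow> nat. inj_on h X \<and> h p = 0 \<and> h q = 1 \<and> (\<forall>x\<in>X. h x < card X + 2)"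
proof -
  obtain h0 :: "'a \<Rightarrow> nat" where h0: "bij_betw h0 X {0..<card X}"
    using ex_bij_betw_finite_nat[OF assms(1)] by blast
  define h where "h x = (if x = p then 0 else if x = q then 1 else h0 x + 2)" for x
  have "inj_on h X"
    using h0 by (auto simp: inj_on_def h_def bij_betw_def)
  moreover have "h x < card X + 2" if "x \<in> X" for x
    using h0 that by (auto simp: h_def bij_betw_def)
  ultimately show ?thesis using assms(2) by (intro exI[of _ h]) (auto simp: h_def)
qed

text \<open>Program and machine run in lockstep, one step each, so time bounds carry over without
  loss.\<close>

theorem cmd_turing_machine:
  assumes wf: "well_formed k S c" and k: "k \<ge> 2" and S: "S \<ge> 3"
  shows "\<exists>M. turing_machine M \<and> tapes M = k \<and>
    (\<forall>ts t ts'. length ts = k \<longrightarrow> (cmd_step ^^ t) ([c], ts) = ([], ts') \<longrightarrow>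
       (tm_step M ^^ t) (0, ts) = (1, ts'))"
proof -
  define X where "X = insert [] (reach c [])"
  have finX: "finite X" by (simp add: X_def finite_reach)
  obtain h :: "cmd list \<Rightarrow> nat"
    where h: "inj_on h X" "h [c] = 0" "h [] = 1" "\<forall>x\<in>X. h x < card X + 2"
    using exists_numbering[OF finX, of "[c]" "[]"] by auto
  define g where "g q = inv_into X h q" for q
  have gh: "g (h K) = K" if "K \<in> X" for K
    using h(1) that by (simp add: g_def)
  \<comment> \<open>State numbers that code no stack halt at once, which keeps \<open>delta\<close>
    within the ranges that \<open>turing_machine\<close> demands.\<close>
  define D where "D q ss = (if q \<in> h ` X
      then (h (next_cmds ss (g q)), map (\<lambda>j. cmd_action (g q) j (ss ! j)) [0..<k])
      else (1, map (\<lambda>j. (ss ! j, 0)) [0..<k]))" for q :: nat and ss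
  define M where "M = \<lparr>tapes = k, states = card X + 2, symbols = S, delta = D\<rparr>"
  have closed: "next_cmds ss K \<in> X" if "K \<in> X" for K ss
    using that reach_closed[of K c "[]" ss] by (auto simp: X_def)
  have wfX: "list_all (well_formed k S) K" if "K \<in> X" for K
    using that reach_well_formed[OF wf, of "[]"] by (auto simp: X_def)
  have "turing_machine M"
    unfolding turing_machine_def
  proof (intro conjI allI impI)
    fix q and ss :: "nat list"
    assume q: "q < states M" and l: "length ss = tapes M" and ss: "set ss \<subseteq> {..<symbols M}"
    have nth: "ss ! j < S" if "j < k" for j
      using ss l that nth_mem[of j ss] unfolding M_def by (auto simp del: nth_mem)
    show "case delta M q ss of (q', as) \<Rightarrow> q' < states M \<and> length as = tapes M \<and>
        set as \<subseteq> {..<symbols M} \<times> {-1, 0, 1}"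
    proof (cases "q \<in> h ` X")
      case True
      then obtain K where K: "K \<in> X" "q = h K" by auto
      have "set (map (\<lambda>j. cmd_action K j (ss ! j)) [0..<k]) \<subseteq> {..<S} \<times> {-1, 0, 1}"
        using cmd_action_ok[OF wfX[OF K(1)]] nth by (simp add: image_subset_iff)
      then show ?thesis
        using True K h(4) closed[OF K(1)] by (simp add: M_def D_def gh)
    next
      case False
      then show ?thesis using nth by (auto simp: M_def D_def)
    qed
  qed (use k S in \<open>auto simp: M_def\<close>)
  moreover have step: "tm_step M (h K, ts) = (h K', ts') \<and> K' \<in> X \<and> length ts' = k"
    if "K \<in> X" "length ts = k" "cmd_step (K, ts) = (K', ts')" for K ts K' ts'
  proof (cases "K = []")
    case True
    then have "ts' = ts" "K' = []"
      using that by (auto simp: cmd_step_def map2_act_idle)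
    then show ?thesis using that True h(3) by (auto simp: tm_step_def)
  next
    case False
    then have "h K \<noteq> 1"
      using h that(1) by (metis X_def inj_onD insertI1)
    moreover have "D (h K) (map scan ts) = (h (next_cmds (map scan ts) K),
        map (\<lambda>j. cmd_action K j (scan (ts ! j))) [0..<length ts])"
      using that by (simp add: D_def gh)
    ultimately show ?thesis
      using that closed[OF that(1)] by (auto simp: tm_step_def M_def cmd_step_def)
  qed
  have steps: "(tm_step M ^^ t) (h K, ts) = (h K', ts') \<and> K' \<in> X \<and> length ts' = k"
    if "K \<in> X" "length ts = k" "(cmd_step ^^ t) (K, ts) = (K', ts')" for K ts t K' ts'
    using that(3)
  proof (induction t arbitrary: K' ts')
    case 0
    then show ?case using that by simp
  next
    case (Suc t)
    obtain K1 ts1 where 1: "(cmd_step ^^ t) (K, ts) = (K1, ts1)" by (cases "(cmd_step ^^ t) (K, ts)")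
    show ?case using Suc.IH[OF 1] step[of K1 ts1 K' ts'] Suc.prems 1 by simp
  qed
  have "[c] \<in> X" using reach_start[of c "[]"] by (simp add: X_def)
  then have "\<forall>ts t ts'. length ts = k \<longrightarrow> (cmd_step ^^ t) ([c], ts) = ([], ts') \<longrightarrow>
       (tm_step M ^^ t) (0, ts) = (1, ts')"
    using steps[of "[c]"] h by (metis One_nat_def)
  moreover have "tapes M = k" by (simp add: M_def)
  ultimately show ?thesis by blast
qed

text \<open>Quantifying over the pending commands \<open>K\<close> is what makes executions
  composable: \<open>c\<close> neither inspects nor disturbs what follows it.\<close>

definition exec :: "cmd \<Rightarrow> tape list \<Rightarrow> nat \<Rightarrow> tape list \<Rightarrow> bool" where
  "exec c ts n ts' \<longleftrightarrow> (\<exists>t\<le>n. \<forall>K. (cmd_step ^^ t) (c # K, ts) = (K, ts'))"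

lemma exec_mono: "exec c ts n ts' \<Longrightarrow> n \<le> n' \<Longrightarrow> exec c ts n' ts'"
  unfolding exec_def using le_trans by blast

lemma exec_Act:
  assumes "i < length ts"
  shows "exec (Act i w d) ts 1 (ts[i := act (ts ! i) (w (scan (ts ! i)), d)])"
proof -
  have "map2 act ts (map (\<lambda>j. cmd_action (Act i w d # K) j (scan (ts ! j))) [0..<length ts]) =
      ts[i := act (ts ! i) (w (scan (ts ! i)), d)]" for K
    using assms by (intro nth_equalityI) (auto simp: nth_list_update act_def scan_def)
  then show ?thesis
    unfolding exec_def by (intro exI[of _ 1]) (simp add: cmd_step_def)
qed

lemma exec_Seq:
  assumes "exec c ts n ts'" "exec d ts' n' ts''"
  shows "exec (Seq c d) ts (Suc (n + n')) ts''"
proof -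
  obtain t t' where t: "t \<le> n" "\<And>K. (cmd_step ^^ t) (c # K, ts) = (K, ts')"
    and t': "t' \<le> n'" "\<And>K. (cmd_step ^^ t') (d # K, ts') = (K, ts'')"
    using assms unfolding exec_def by blast
  have "(cmd_step ^^ (t' + t + 1)) (Seq c d # K, ts) = (K, ts'')" for K
    using t t' by (simp only: funpow_add o_apply)
      (simp add: cmd_step_def[of ] map2_act_idle)
  moreover have "t' + t + 1 \<le> Suc (n + n')" using t(1) t'(1) by simp
  ultimately show ?thesis unfolding exec_def by blast
qed

text \<open>A test changes no tape and replaces the command on top by the list \<open>L\<close> of
  what it leads to: a branch, the loop body followed by the loop, or nothing.\<close>

lemma exec_first_step:
  assumes "\<And>K. cmd_step (c # K, ts) = (L @ K, ts)" "\<exists>t\<le>n. \<forall>K. (cmd_step ^^ t) (L @ K, ts) = (K, ts')"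
  shows "exec c ts (Suc n) ts'"
proof -
  obtain t where t: "t \<le> n" "\<And>K. (cmd_step ^^ t) (L @ K, ts) = (K, ts')"
    using assms(2) by blast
  have "(cmd_step ^^ Suc t) (c # K, ts) = (K, ts')" for K
    using assms(1) t(2) by (simp only: funpow_Suc_right o_apply)
  then show ?thesis unfolding exec_def using t(1) by (meson Suc_le_mono)
qed

lemma exec_Cond:
  assumes "i < length ts" "b (scan (ts ! i)) \<Longrightarrow> exec c ts n ts'" "\<not> b (scan (ts ! i)) \<Longrightarrow> exec d ts n ts'"
  shows "exec (Cond i b c d) ts (Suc n) ts'"
  by (rule exec_first_step[of _ _ "[if b (scan (ts ! i)) then c else d]"])
    (use assms in \<open>auto simp: cmd_step_def map2_act_idle exec_def\<close>)

lemma exec_While_False: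
  assumes "i < length ts" "\<not> b (scan (ts ! i))"
  shows "exec (While i b c) ts 1 ts"
  unfolding One_nat_def
  by (rule exec_first_step[of _ _ "[]"])
    (use assms in \<open>auto simp: cmd_step_def map2_act_idle intro: exI[of _ 0]\<close>)

lemma exec_While_True:
  assumes "i < length ts" "b (scan (ts ! i))" "exec c ts n ts'" "exec (While i b c) ts' n' ts''"
  shows "exec (While i b c) ts (Suc (n + n')) ts''"
proof (rule exec_first_step[of _ _ "[c, While i b c]"])
  obtain t t' where t: "t \<le> n" "\<And>K. (cmd_step ^^ t) (c # K, ts) = (K, ts')"
    and t': "t' \<le> n'" "\<And>K. (cmd_step ^^ t') (While i b c # K, ts') = (K, ts'')"
    using assms(3,4) unfolding exec_def by blast
  have "(cmd_step ^^ (t' + t)) ([c, While i b c] @ K, ts) = (K, ts'')" for K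
    using t t' by (simp only: funpow_add o_apply append_Cons append_Nil)
  moreover have "t' + t \<le> n + n'" using t t' by simp
  ultimately show "\<exists>t\<le>n + n'. \<forall>K. (cmd_step ^^ t) ([c, While i b c] @ K, ts) = (K, ts'')" by blast
qed (use assms in \<open>auto simp: cmd_step_def map2_act_idle\<close>)

section \<open>Programs on four stacks\<close>

fun peek :: "nat list \<Rightarrow> nat" where
  "peek [] = 0"
| "peek (x # xs) = x"

text \<open>The head stands on the top of the stack, and cell 0 stays blank. As the stacks hold only
  the symbols 1 and 2, scanning 0 signals an empty stack.\<close>

definition stack_tape :: "nat list \<Rightarrow> tape" where
  "stack_tape s = (\<lambda>i. if 1 \<le> i \<and> i \<le> int (length s) then rev s ! (nat i - 1) else 0, int (length s))"

lemma scan_stack_tape [simp]: "scan (stack_tape s) = peek s"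
  by (cases s) (auto simp: scan_def stack_tape_def nth_append)

text \<open>An action writes before it moves, so pushing takes two: the old top is rewritten while
  the head moves right, then the new symbol is written on the spot.\<close>

lemma stack_tape_push:
  "act (act (stack_tape s) (peek s, 1)) (x, 0) = stack_tape (x # s)"
  unfolding scan_stack_tape[symmetric]
  by (auto simp: act_def scan_def stack_tape_def fun_eq_iff nth_append)

lemma stack_tape_pop: "s \<noteq> [] \<Longrightarrow> act (stack_tape s) (0, -1) = stack_tape (tl s)"
  by (cases s) (auto simp: act_def stack_tape_def fun_eq_iff nth_append)

lemma stack_tape_Nil: "stack_tape [] = (\<lambda>_. 0, 0)"
  by (auto simp: stack_tape_def)

type_synonym stacks = "nat list \<times> nat list \<times> nat list \<times> nat list"

fun stack_get :: "nat \<Rightarrow> stacks \<Rightarrow> nat list" where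
  "stack_get i (a, b, c, d) = (if i = 1 then a else if i = 2 then b else if i = 3 then c else d)"

fun stack_set :: "nat \<Rightarrow> nat list \<Rightarrow> stacks \<Rightarrow> stacks" where
  "stack_set i x (a, b, c, d) =
    (if i = 1 then (x, b, c, d) else if i = 2 then (a, x, c, d)
     else if i = 3 then (a, b, x, d) else (a, b, c, x))"

text \<open>Tape 0 is the input tape and tape 5 the output tape.\<close>

fun stack_conf :: "tape \<Rightarrow> stacks \<Rightarrow> tape list" where
  "stack_conf tp (a, b, c, d) =
    [tp, stack_tape a, stack_tape b, stack_tape c, stack_tape d, stack_tape []]"

abbreviation stack_index :: "nat \<Rightarrow> bool" where
  "stack_index i \<equiv> i \<in> {1, 2, 3, 4}"

lemma length_stack_conf [simp]: "length (stack_conf tp s) = 6"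
  by (cases s) auto

lemma stack_conf_nth: "stack_index i \<Longrightarrow> stack_conf tp s ! i = stack_tape (stack_get i s)"
  by (cases s) (auto simp: numeral_eq_Suc)

lemma stack_conf_update:
  "stack_index i \<Longrightarrow> (stack_conf tp s)[i := stack_tape x] = stack_conf tp (stack_set i x s)"
  by (cases s) (auto simp: numeral_eq_Suc)

text \<open>The input tape \<open>tp\<close> is arbitrary and stays fixed, so stack programs can run
  wherever the reading of the input has left its head.\<close>

definition runs :: "cmd \<Rightarrow> stacks \<Rightarrow> nat \<Rightarrow> stacks \<Rightarrow> bool" where
  "runs c s n s' \<longleftrightarrow> (\<forall>tp. exec c (stack_conf tp s) n (stack_conf tp s'))"

lemma runs_exec: "runs c s n s' \<Longrightarrow> exec c (stack_conf tp s) n (stack_conf tp s')"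
  unfolding runs_def by blast

definition push :: "nat \<Rightarrow> nat \<Rightarrow> cmd" where
  "push i x = Seq (Act i (\<lambda>a. a) 1) (Act i (\<lambda>_. x) 0)"

definition pop :: "nat \<Rightarrow> cmd" where
  "pop i = Act i (\<lambda>_. 0) (-1)"

lemma runs_mono: "runs c s n s' \<Longrightarrow> n \<le> n' \<Longrightarrow> runs c s n' s'"
  unfolding runs_def using exec_mono by blast

lemma runs_push:
  assumes "stack_index i"
  shows "runs (push i x) s 3 (stack_set i (x # stack_get i s) s)"
  unfolding runs_def
proof
  fix tp
  let ?ts = "stack_conf tp s"
  have i: "i < length ?ts" using assms by auto
  have "exec (push i x) ?ts (Suc (1 + 1)) (?ts[i := act (act (?ts ! i) (scan (?ts ! i), 1)) (x, 0)])"
    unfolding push_def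
    using exec_Seq[OF exec_Act[OF i] exec_Act, of i "\<lambda>a. a" 1 "\<lambda>_. x" 0] i by simp
  then show "exec (push i x) ?ts 3 (stack_conf tp (stack_set i (x # stack_get i s) s))"
    unfolding stack_conf_nth[OF assms] scan_stack_tape stack_tape_push stack_conf_update[OF assms]
    by (simp add: numeral_3_eq_3)
qed

lemma runs_pop:
  assumes "stack_index i" "stack_get i s \<noteq> []"
  shows "runs (pop i) s 1 (stack_set i (tl (stack_get i s)) s)"
  unfolding runs_def
proof
  fix tp
  let ?ts = "stack_conf tp s"
  have i: "i < length ?ts" using assms by auto
  show "exec (pop i) ?ts 1 (stack_conf tp (stack_set i (tl (stack_get i s)) s))"
    using exec_Act[OF i, of "\<lambda>_. 0" "-1"]
    unfolding pop_def stack_conf_nth[OF assms(1)] stack_tape_pop[OF assms(2)] stack_conf_update[OF assms(1)] .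
qed

lemma runs_skip: "runs (Act 1 (\<lambda>a. a) 0) s 1 s"
  unfolding runs_def
proof
  fix tp
  have "(stack_conf tp s)[1 := act (stack_conf tp s ! 1) (scan (stack_conf tp s ! 1), 0)] = stack_conf tp s"
    by (simp add: act_def scan_def)
  then show "exec (Act 1 (\<lambda>a. a) 0) (stack_conf tp s) 1 (stack_conf tp s)"
    using exec_Act[of 1 "stack_conf tp s" "\<lambda>a. a" 0] by simp
qed

lemma runs_Seq: "runs c s n s' \<Longrightarrow> runs d s' n' s'' \<Longrightarrow> runs (Seq c d) s (Suc (n + n')) s''"
  unfolding runs_def using exec_Seq by blast

lemma runs_Seq_push:
  "stack_index i \<Longrightarrow> runs c (stack_set i (x # stack_get i s) s) n s' \<Longrightarrow> runs (Seq (push i x) c) s (n + 4) s'"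
  by (rule runs_mono[OF runs_Seq[OF runs_push]]) auto

lemma runs_Seq_pop:
  "stack_index i \<Longrightarrow> stack_get i s \<noteq> [] \<Longrightarrow> runs c (stack_set i (tl (stack_get i s)) s) n s' \<Longrightarrow>
   runs (Seq (pop i) c) s (n + 2) s'"
  by (rule runs_mono[OF runs_Seq[OF runs_pop]]) auto

lemma runs_Cond:
  assumes "stack_index i" "b (peek (stack_get i s)) \<Longrightarrow> runs c s n s'"
    "\<not> b (peek (stack_get i s)) \<Longrightarrow> runs d s n s'"
  shows "runs (Cond i b c d) s (Suc n) s'"
  unfolding runs_def
proof
  fix tp
  show "exec (Cond i b c d) (stack_conf tp s) (Suc n) (stack_conf tp s')"
    by (rule exec_Cond) (use assms in \<open>auto simp: stack_conf_nth runs_exec\<close>)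
qed

lemma runs_While_False:
  assumes "stack_index i" "\<not> b (peek (stack_get i s))"
  shows "runs (While i b c) s 1 s"
  unfolding runs_def
proof
  fix tp
  show "exec (While i b c) (stack_conf tp s) 1 (stack_conf tp s)"
    by (rule exec_While_False) (use assms in \<open>auto simp: stack_conf_nth\<close>)
qed

lemma runs_While_True:
  assumes "stack_index i" "b (peek (stack_get i s))" "runs c s n s'" "runs (While i b c) s' n' s''"
  shows "runs (While i b c) s (Suc (n + n')) s''"
  unfolding runs_def
proof
  fix tp
  show "exec (While i b c) (stack_conf tp s) (Suc (n + n')) (stack_conf tp s'')"
    by (rule exec_While_True[where ts' = "stack_conf tp s'"])
      (use assms in \<open>auto simp: stack_conf_nth runs_exec\<close>)
qed

text \<open>Pouring reverses the order, so pouring twice preserves it. An \<open>Act\<close> sees a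
  single tape, hence a symbol can travel between stacks only through a branch for each of its
  values.\<close>

definition pour :: "nat \<Rightarrow> nat \<Rightarrow> cmd" where
  "pour i j = While i (\<lambda>x. x \<noteq> 0)
     (Cond i (\<lambda>x. x = 2) (Seq (pop i) (push j 2)) (Seq (pop i) (push j 1)))"

definition erase :: "nat \<Rightarrow> cmd" where
  "erase i = While i (\<lambda>x. x \<noteq> 0) (pop i)"

definition pour_both :: cmd where
  "pour_both = While 2 (\<lambda>x. x \<noteq> 0)
     (Cond 2 (\<lambda>x. x = 2) (Seq (pop 2) (Seq (push 1 2) (push 4 2)))
        (Seq (pop 2) (Seq (push 1 1) (push 4 1))))"

lemma runs_pop_push:
  assumes "stack_index i" "stack_index j" "i \<noteq> j" "stack_get i s = y # ys"
  shows "runs (Seq (pop i) (push j x)) s (3 + 2) (stack_set j (x # stack_get j s) (stack_set i ys s))"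
proof -
  have "stack_get j (stack_set i ys s) = stack_get j s" using assms(1-3) by (cases s) auto
  then show ?thesis
    using runs_Seq_pop[OF assms(1) _ runs_push[OF assms(2)], of s x] assms(4) by simp
qed

lemma runs_pour:
  assumes "stack_index i" "stack_index j" "i \<noteq> j" "set (stack_get i s) \<subseteq> {1, 2}"
  shows "runs (pour i j) s (10 * length (stack_get i s) + 1)
     (stack_set i [] (stack_set j (rev (stack_get i s) @ stack_get j s) s))"
  using assms(4)
proof (induction "stack_get i s" arbitrary: s)
  case Nil
  note eq = Nil.hyps[symmetric]
  have same: "stack_set i [] (stack_set j (stack_get j s) s) = s"
    using assms(1-3) eq by (cases s) auto
  show ?case
    unfolding eq pour_def rev.simps append_Nil same
    by (rule runs_mono[OF runs_While_False[OF assms(1)]]) (simp_all add: eq)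
next
  case (Cons x xs)
  let ?s = "stack_set j (x # stack_get j s) (stack_set i xs s)"
  note eq = Cons.hyps(2)[symmetric]
  have s: "stack_get i ?s = xs"
    "stack_set i [] (stack_set j (rev xs @ stack_get j ?s) ?s) =
     stack_set i [] (stack_set j (rev (x # xs) @ stack_get j s) s)"
    using assms(1-3) by (cases s, force)+
  have x: "x = 1 \<or> x = 2" "set xs \<subseteq> {1, 2}" using Cons.prems eq by auto
  have "runs (Cond i (\<lambda>x. x = 2) (Seq (pop i) (push j 2)) (Seq (pop i) (push j 1))) s (Suc (3 + 2)) ?s"
  proof (rule runs_Cond[OF assms(1)])
    assume "peek (stack_get i s) = 2"
    then have "x = 2" by (simp add: eq)
    then show "runs (Seq (pop i) (push j 2)) s (3 + 2) ?s" using runs_pop_push[OF assms(1-3) eq, of 2] by simp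
  next
    assume "peek (stack_get i s) \<noteq> 2"
    then have "x = 1" using x(1) by (simp add: eq)
    then show "runs (Seq (pop i) (push j 1)) s (3 + 2) ?s" using runs_pop_push[OF assms(1-3) eq, of 1] by simp
  qed
  moreover have "runs (pour i j) ?s (10 * length xs + 1)
      (stack_set i [] (stack_set j (rev (x # xs) @ stack_get j s) s))"
    using Cons.hyps(1)[of ?s] s x(2) by simp
  moreover have "peek (stack_get i s) \<noteq> 0" using x(1) eq by auto
  ultimately have "runs (pour i j) s (Suc (Suc (3 + 2) + (10 * length xs + 1)))
      (stack_set i [] (stack_set j (rev (x # xs) @ stack_get j s) s))"
    unfolding pour_def by (intro runs_While_True[OF assms(1)])
  then show ?case unfolding eq by (rule runs_mono) simp
qed

lemma runs_erase_2:
  "set xs \<subseteq> {1, 2} \<Longrightarrow> runs (erase 2) (a, xs, c, d) (10 * length xs + 1) (a, [], c, d)"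
proof (induction xs)
  case Nil
  then show ?case using runs_While_False[of 2 "\<lambda>x. x \<noteq> 0" "(a, [], c, d)"] by (simp add: erase_def)
next
  case (Cons x xs)
  have 1: "runs (pop 2) (a, x # xs, c, d) 1 (a, xs, c, d)"
    using runs_pop[of 2 "(a, x # xs, c, d)"] by simp
  have "runs (erase 2) (a, xs, c, d) (10 * length xs + 1) (a, [], c, d)"
    using Cons by simp
  from runs_While_True[OF _ _ 1 this[unfolded erase_def]] show ?case
    unfolding erase_def by (rule runs_mono) (use Cons.prems in auto)
qed

lemma runs_pour_both:
  "set xs \<subseteq> {1, 2} \<Longrightarrow> runs pour_both (a, xs, c, d) (20 * length xs + 1) (rev xs @ a, [], c, rev xs @ d)"
proof (induction xs arbitrary: a d)
  case Nil
  then show ?case using runs_While_False[of 2 "\<lambda>x. x \<noteq> 0" "(a, [], c, d)"] by (simp add: pour_both_def)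
next
  case (Cons x xs)
  have "runs (Seq (push 1 x) (push 4 x)) (a, xs, c, d) (3 + 4) (x # a, xs, c, x # d)"
    using runs_Seq_push[of 1 "push 4 x" x "(a, xs, c, d)" 3] runs_push[of 4 x "(x # a, xs, c, d)"] by simp
  then have 1: "runs (Seq (pop 2) (Seq (push 1 x) (push 4 x))) (a, x # xs, c, d) (3 + 4 + 2) (x # a, xs, c, x # d)"
    using runs_Seq_pop[of 2 "(a, x # xs, c, d)" "Seq (push 1 x) (push 4 x)" "3 + 4"] by simp
  have 2: "runs (Cond 2 (\<lambda>x. x = 2) (Seq (pop 2) (Seq (push 1 2) (push 4 2)))
        (Seq (pop 2) (Seq (push 1 1) (push 4 1))))
      (a, x # xs, c, d) (Suc (3 + 4 + 2)) (x # a, xs, c, x # d)"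
    by (rule runs_Cond) (use 1 Cons.prems in auto)
  have "runs pour_both (x # a, xs, c, x # d) (20 * length xs + 1) (rev (x # xs) @ a, [], c, rev (x # xs) @ d)"
    using Cons by simp
  from runs_While_True[OF _ _ 2 this[unfolded pour_both_def]] show ?case
    unfolding pour_both_def by (rule runs_mono) (use Cons.prems in auto)
qed

section \<open>Tree programs\<close>

datatype tree = Lf | Nd tree tree

text \<open>Preorder, with 2 for a node and 1 for a leaf. The code is self-delimiting: trees are
  stacked without separators, and the topmost symbol tells a node from a leaf.\<close>

fun word :: "tree \<Rightarrow> nat list" where
  "word Lf = [1]"
| "word (Nd l r) = 2 # word l @ word r"

fun tsize :: "tree \<Rightarrow> nat" where
  "tsize Lf = 1"
| "tsize (Nd l r) = 1 + tsize l + tsize r"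

lemma length_word [simp]: "length (word v) = tsize v"
  by (induction v) auto

lemma set_word: "set (word v) \<subseteq> {1, 2}"
  by (induction v) auto

lemma tsize_pos [simp]: "0 < tsize v"
  by (cases v) auto

lemma tsize_ge_1: "1 \<le> tsize v"
  using tsize_pos[of v] by linarith

text \<open>Stack 3 counts the subtrees that remain to be moved.\<close>

definition take_loop :: "nat \<Rightarrow> cmd" where
  "take_loop j = While 3 (\<lambda>x. x = 1) (Seq (pop 3) (Cond 1 (\<lambda>x. x = 2)
     (Seq (pop 1) (Seq (push j 2) (Seq (push 3 1) (push 3 1)))) (Seq (pop 1) (push j 1))))"

definition take_word :: "nat \<Rightarrow> cmd" where
  "take_word j = Seq (push 3 1) (take_loop j)"

text \<open>Lets one proof serve both target stacks 2 and 4: \<open>b\<close> is the content of the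
  target and \<open>d\<close> that of the other one.\<close>

definition take_state :: "nat \<Rightarrow> nat list \<Rightarrow> nat list \<Rightarrow> nat list \<Rightarrow> nat list \<Rightarrow> stacks" where
  "take_state j a b c d = (if j = 2 then (a, b, c, d) else (a, d, c, b))"

lemma take_state_simps:
  assumes "j = 2 \<or> j = 4"
  shows "stack_get (Suc 0) (take_state j a b c d) = a" "stack_get j (take_state j a b c d) = b"
    "stack_get 3 (take_state j a b c d) = c" "stack_set (Suc 0) x (take_state j a b c d) = take_state j x b c d"
    "stack_set j x (take_state j a b c d) = take_state j a x c d"
    "stack_set 3 x (take_state j a b c d) = take_state j a b x d" "stack_index j"
  using assms by (auto simp: take_state_def)

lemma runs_take_loop_step:
  assumes j: "j = 2 \<or> j = 4"
  shows "runs (take_loop j) (take_state j a (2 # b) (1 # 1 # c) d) n s \<Longrightarrow> runs (take_loop j) (take_state j (2 # a) b (1 # c) d) (n + 30) s"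
    "runs (take_loop j) (take_state j a (1 # b) c d) n s \<Longrightarrow> runs (take_loop j) (take_state j (1 # a) b (1 # c) d) (n + 30) s"
proof -
  note [simp] = take_state_simps[OF j] take_state_simps(7)[OF j, simplified]
  let ?L = "Seq (pop 1) (Seq (push j 2) (Seq (push 3 1) (push 3 1)))"
  let ?R = "Seq (pop 1) (push j 1)"
  have "runs (Seq (push 3 1) (push 3 1)) (take_state j a (2 # b) c d) (3 + 4) (take_state j a (2 # b) (1 # 1 # c) d)"
    using runs_Seq_push[of 3 "push 3 1" 1 "(take_state j a (2 # b) c d)" 3] runs_push[of 3 1 "(take_state j a (2 # b) (1 # c) d)"] by simp
  then have "runs (Seq (push j 2) (Seq (push 3 1) (push 3 1))) (take_state j a b c d) (3 + 4 + 4) (take_state j a (2 # b) (1 # 1 # c) d)"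
    using runs_Seq_push[of j "Seq (push 3 1) (push 3 1)" 2 "(take_state j a b c d)" "3 + 4"] by simp
  then have "runs ?L (take_state j (2 # a) b c d) (3 + 4 + 4 + 2) (take_state j a (2 # b) (1 # 1 # c) d)"
    using runs_Seq_pop[of 1 "(take_state j (2 # a) b c d)" "Seq (push j 2) (Seq (push 3 1) (push 3 1))" "3 + 4 + 4"] by simp
  then have "runs (Cond 1 (\<lambda>x. x = 2) ?L ?R) (take_state j (2 # a) b c d) (Suc (3 + 4 + 4 + 2)) (take_state j a (2 # b) (1 # 1 # c) d)"
    by (intro runs_Cond) auto
  then have 1: "runs (Seq (pop 3) (Cond 1 (\<lambda>x. x = 2) ?L ?R)) (take_state j (2 # a) b (1 # c) d) (Suc (3 + 4 + 4 + 2) + 2) (take_state j a (2 # b) (1 # 1 # c) d)"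
    using runs_Seq_pop[of 3 "(take_state j (2 # a) b (1 # c) d)" "Cond 1 (\<lambda>x. x = 2) ?L ?R" "Suc (3 + 4 + 4 + 2)"] by simp
  have "runs ?R (take_state j (1 # a) b c d) (3 + 2) (take_state j a (1 # b) c d)"
    using runs_Seq_pop[of 1 "(take_state j (1 # a) b c d)" "push j 1" 3] runs_push[of j 1 "(take_state j a b c d)"] by simp
  then have "runs (Cond 1 (\<lambda>x. x = 2) ?L ?R) (take_state j (1 # a) b c d) (Suc (3 + 2)) (take_state j a (1 # b) c d)"
    by (intro runs_Cond) auto
  then have 2: "runs (Seq (pop 3) (Cond 1 (\<lambda>x. x = 2) ?L ?R)) (take_state j (1 # a) b (1 # c) d) (Suc (3 + 2) + 2) (take_state j a (1 # b) c d)"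
    using runs_Seq_pop[of 3 "(take_state j (1 # a) b (1 # c) d)" "Cond 1 (\<lambda>x. x = 2) ?L ?R" "Suc (3 + 2)"] by simp
  show "runs (take_loop j) (take_state j (2 # a) b (1 # c) d) (n + 30) s" if "runs (take_loop j) (take_state j a (2 # b) (1 # 1 # c) d) n s"
    unfolding take_loop_def by (rule runs_mono[OF runs_While_True[OF _ _ 1 that[unfolded take_loop_def]]]) auto
  show "runs (take_loop j) (take_state j (1 # a) b (1 # c) d) (n + 30) s" if "runs (take_loop j) (take_state j a (1 # b) c d) n s"
    unfolding take_loop_def by (rule runs_mono[OF runs_While_True[OF _ _ 2 that[unfolded take_loop_def]]]) auto
qed

text \<open>Stated as a continuation, since the loop does not stop between subtrees: one counter
  symbol pays for one whole word, and a node trades its counter symbol for two. The right subtree is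
  put in front of the given run, then the left one, then the root.\<close>

lemma runs_take_loop:
  assumes j: "j = 2 \<or> j = 4"
  shows "runs (take_loop j) (take_state j a (rev (word v) @ b) c d) n s \<Longrightarrow>
   runs (take_loop j) (take_state j (word v @ a) b (1 # c) d) (n + 30 * tsize v) s"
proof (induction v arbitrary: a b c n)
  case Lf
  then show ?case using runs_take_loop_step(2)[OF j, of a b c d n s] by simp
next
  case (Nd l r)
  from Nd.IH(2)[where a = a and b = "rev (word l) @ 2 # b" and c = c and n = n] Nd.prems
  have "runs (take_loop j) (take_state j (word r @ a) (rev (word l) @ 2 # b) (1 # c) d) (n + 30 * tsize r) s" by simp
  from runs_take_loop_step(1)[OF j Nd.IH(1)[OF this]] show ?case by (simp add: algebra_simps)
qed

lemma runs_take_word: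
  assumes j: "j = 2 \<or> j = 4"
  shows "runs (take_word j) (take_state j (word v @ a) b [] d) (40 * tsize v) (take_state j a (rev (word v) @ b) [] d)"
proof -
  note [simp] = take_state_simps[OF j]
  have "runs (take_loop j) (take_state j a (rev (word v) @ b) [] d) 1 (take_state j a (rev (word v) @ b) [] d)"
    unfolding take_loop_def by (rule runs_While_False) auto
  from runs_take_loop[OF j this]
  have "runs (take_word j) (take_state j (word v @ a) b [] d) (1 + 30 * tsize v + 4) (take_state j a (rev (word v) @ b) [] d)"
    unfolding take_word_def
    using runs_Seq_push[of 3 "take_loop j" 1 "(take_state j (word v @ a) b [] d)" "1 + 30 * tsize v"] by simp
  then show ?thesis by (rule runs_mono) (use tsize_ge_1[of v] in linarith)
qed

section \<open>Dropping, duplicating and swapping the topmost trees\<close>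

abbreviation main :: "nat list \<Rightarrow> stacks" where
  "main a \<equiv> (a, [], [], [])"

definition drop_word :: cmd where
  "drop_word = Seq (take_word 2) (erase 2)"

text \<open>\<open>take_word\<close> leaves the word reversed on stack 2; \<open>pour_both\<close>
  puts a copy in the right order on stacks 1 and 4. The copy on stack 4 reaches stack 1 through
  stack 2, reversed twice.\<close>

definition dup_word :: cmd where
  "dup_word = Seq (take_word 2) (Seq pour_both (Seq (pour 4 2) (pour 2 1)))"

text \<open>The word that was on top is poured back first and so ends up below.\<close>

definition swap_words :: cmd where
  "swap_words = Seq (take_word 2) (Seq (take_word 4) (Seq (pour 2 1) (pour 4 1)))"

lemma set_rev_word: "set (rev (word v)) \<subseteq> {1, 2}"
  using set_word by simp

lemma runs_drop_word: "runs drop_word (main (word v @ a)) (100 * tsize v) (main a)"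
  unfolding drop_word_def
  by (rule runs_mono[OF runs_Seq[OF runs_take_word[of 2 v a "[]" "[]", unfolded take_state_def, simplified] runs_erase_2]])
    (use set_word tsize_ge_1[of v] in auto)

lemma runs_dup_word: "runs dup_word (main (word v @ a)) (100 * tsize v) (main (word v @ word v @ a))"
proof -
  note 1 = runs_take_word[of 2 v a "[]" "[]"]
  note 2 = runs_pour_both[OF set_rev_word[of v], of a "[]" "[]"]
  note 3 = runs_pour[of 4 2 "(word v @ a, [], [], word v)"]
  note 4 = runs_pour[of 2 1 "(word v @ a, rev (word v), [], [])"]
  have "runs dup_word (main (word v @ a))
     (Suc (40 * tsize v + Suc (20 * tsize v + 1 + Suc (10 * tsize v + 1 + (10 * tsize v + 1)))))
     (main (word v @ word v @ a))"
    unfolding dup_word_def by (intro runs_Seq) (use 1 2 3 4 set_word in \<open>simp_all add: take_state_def\<close>)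
  then show ?thesis by (rule runs_mono) (use tsize_ge_1[of v] in linarith)
qed

lemma runs_swap_words:
  "runs swap_words (main (word v @ word w @ a)) (100 * (tsize v + tsize w)) (main (word w @ word v @ a))"
proof -
  note 1 = runs_take_word[of 2 v "word w @ a" "[]" "[]"]
  note 2 = runs_take_word[of 4 w a "[]" "rev (word v)"]
  note 3 = runs_pour[of 2 1 "(a, rev (word v), [], rev (word w))"]
  note 4 = runs_pour[of 4 1 "(word v @ a, [], [], rev (word w))"]
  have "runs swap_words (main (word v @ word w @ a))
     (Suc (40 * tsize v + Suc (40 * tsize w + Suc (10 * tsize v + 1 + (10 * tsize w + 1)))))
     (main (word w @ word v @ a))"
    unfolding swap_words_def by (intro runs_Seq) (use 1 2 3 4 set_word in \<open>simp_all add: take_state_def\<close>)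
  then show ?thesis by (rule runs_mono) (use tsize_ge_1[of v] tsize_ge_1[of w] in \<open>simp add: algebra_simps\<close>)
qed

section \<open>A language of functions on trees and its compiler\<close>

datatype prog = PId | PLf | PFst | PSnd | PComp prog prog | PPair prog prog | PIf prog prog prog | PIter prog

text \<open>The number of rounds is the length of the right spine of the counter; left subtrees are
  discarded. Hence a unary number or any list can serve as a counter as it stands.\<close>

primrec iter_eval :: "(tree \<Rightarrow> tree) \<Rightarrow> tree \<Rightarrow> tree \<Rightarrow> tree" where
  "iter_eval f Lf w = w"
| "iter_eval f (Nd l r) w = iter_eval f r (f w)"

primrec iter_cost :: "(tree \<Rightarrow> tree) \<Rightarrow> (tree \<Rightarrow> nat) \<Rightarrow> tree \<Rightarrow> tree \<Rightarrow> nat" where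
  "iter_cost f g Lf w = 1"
| "iter_cost f g (Nd l r) w =
     tsize l + tsize r + tsize w + g w + tsize (f w) + iter_cost f g r (f w)"

primrec peval :: "prog \<Rightarrow> tree \<Rightarrow> tree" where
  "peval PId v = v"
| "peval PLf v = Lf"
| "peval PFst v = (case v of Lf \<Rightarrow> Lf | Nd l r \<Rightarrow> l)"
| "peval PSnd v = (case v of Lf \<Rightarrow> Lf | Nd l r \<Rightarrow> r)"
| "peval (PComp p q) v = peval p (peval q v)"
| "peval (PPair p q) v = Nd (peval p v) (peval q v)"
| "peval (PIf b p q) v = (if peval b v \<noteq> Lf then peval p v else peval q v)"
| "peval (PIter p) v = (case v of Lf \<Rightarrow> Lf | Nd c w \<Rightarrow> iter_eval (peval p) c w)"

text \<open>An upper estimate of the running time, up to a factor depending on the program: it adds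
  up the sizes of the trees that the compiled code copies, swaps or drops.\<close>

primrec cost :: "prog \<Rightarrow> tree \<Rightarrow> nat" where
  "cost PId v = 1"
| "cost PLf v = tsize v"
| "cost PFst v = tsize v"
| "cost PSnd v = tsize v"
| "cost (PComp p q) v = cost q v + cost p (peval q v)"
| "cost (PPair p q) v = tsize v + cost p v + cost q v + tsize (peval p v) + tsize (peval q v)"
| "cost (PIf b p q) v = tsize v + cost b v + tsize (peval b v) +
     (if peval b v \<noteq> Lf then cost p v else cost q v)"
| "cost (PIter p) v = (case v of Lf \<Rightarrow> 1 | Nd c w \<Rightarrow> tsize v + iter_cost (peval p) (cost p) c w)"

primrec compile :: "prog \<Rightarrow> cmd" where
  "compile PId = Act 1 (\<lambda>a. a) 0"
| "compile PLf = Seq drop_word (push 1 1)"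
| "compile PFst = Cond 1 (\<lambda>x. x = 2) (Seq (pop 1) (Seq swap_words drop_word)) (Act 1 (\<lambda>a. a) 0)"
| "compile PSnd = Cond 1 (\<lambda>x. x = 2) (Seq (pop 1) drop_word) (Act 1 (\<lambda>a. a) 0)"
| "compile (PComp p q) = Seq (compile q) (compile p)"
| "compile (PPair p q) = Seq dup_word (Seq (compile p) (Seq swap_words (Seq (compile q)
     (Seq swap_words (push 1 2)))))"
| "compile (PIf b p q) = Seq dup_word (Seq (compile b) (Cond 1 (\<lambda>x. x = 2)
     (Seq drop_word (compile p)) (Seq drop_word (compile q))))"
| "compile (PIter p) = Cond 1 (\<lambda>x. x = 2)
     (Seq (pop 1) (Seq (While 1 (\<lambda>x. x = 2)
        (Seq (pop 1) (Seq drop_word (Seq swap_words (Seq (compile p) swap_words))))) (pop 1)))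
     (Act 1 (\<lambda>a. a) 0)"

lemma well_formed_compile: "well_formed 6 3 (compile p)"
  by (induction p) (simp_all add: push_def pop_def drop_word_def swap_words_def dup_word_def
      take_word_def take_loop_def pour_def pour_both_def erase_def)

lemma cost_pos: "1 \<le> cost p v"
  by (induction p arbitrary: v) (auto split: tree.splits simp: Suc_le_eq)

definition implements :: "prog \<Rightarrow> nat \<Rightarrow> bool" where
  "implements p k \<longleftrightarrow> (\<forall>v a. runs (compile p) (main (word v @ a)) (k * cost p v) (main (word (peval p v) @ a)))"

lemma implementsD: "implements p k \<Longrightarrow> runs (compile p) (main (word v @ a)) (k * cost p v) (main (word (peval p v) @ a))"
  by (simp add: implements_def)

lemma peek_word: "peek (word v @ a) = (if v = Lf then 1 else 2)"
  by (cases v) auto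

text \<open>The constant absorbs the fixed overhead of each construct and grows along the structure
  of \<open>p\<close>. Since \<open>implements\<close> leaves the rest \<open>a\<close> of the stack
  alone, \<open>PPair\<close> and \<open>PIf\<close> can park a duplicate of the input below the
  tree they work on.\<close>

lemma implements_exists: "\<exists>k. implements p k"
proof (induction p)
  case PId
  have "implements PId 1" using runs_skip by (simp add: implements_def)
  then show ?case ..
next
  case PLf
  have "runs (push 1 1) (main a) 3 (main (1 # a))" for a
    using runs_push[of 1 1 "main a"] by simp
  then have "runs (compile PLf) (main (word v @ a)) (200 * tsize v) (main (1 # a))" for v a
    unfolding compile.simps
    by (rule runs_mono[OF runs_Seq[OF runs_drop_word]]) (use tsize_ge_1[of v] in linarith)
  then have "implements PLf 200" by (simp add: implements_def)
  then show ?case ..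
next
  case PFst
  have "runs (compile PFst) (main (word v @ a)) (400 * tsize v) (main (word (peval PFst v) @ a))" for v a
  proof (cases v)
    case Lf
    then show ?thesis
      unfolding compile.simps
      by (intro runs_mono[OF runs_Cond[where n = 1]]) (use runs_skip in auto)
  next
    case (Nd l r)
    have "runs (Seq swap_words drop_word) (main (word l @ word r @ a))
        (Suc (100 * (tsize l + tsize r) + 100 * tsize r)) (main (word l @ a))"
      by (rule runs_Seq[OF runs_swap_words runs_drop_word])
    then have "runs (Seq (pop 1) (Seq swap_words drop_word)) (main (word v @ a))
        (Suc (100 * (tsize l + tsize r) + 100 * tsize r) + 2) (main (word l @ a))"
      using Nd by (intro runs_Seq_pop) auto
    then have "runs (compile PFst) (main (word v @ a))
        (Suc (Suc (100 * (tsize l + tsize r) + 100 * tsize r) + 2)) (main (word l @ a))"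
      unfolding compile.simps by (intro runs_Cond) (use Nd in auto)
    then show ?thesis
      using Nd by (simp del: compile.simps) (erule runs_mono, linarith)
  qed
  then have "implements PFst 400" by (simp add: implements_def del: compile.simps peval.simps)
  then show ?case ..
next
  case PSnd
  have "runs (compile PSnd) (main (word v @ a)) (400 * tsize v) (main (word (peval PSnd v) @ a))" for v a
  proof (cases v)
    case Lf
    then show ?thesis
      unfolding compile.simps
      by (intro runs_mono[OF runs_Cond[where n = 1]]) (use runs_skip in auto)
  next
    case (Nd l r)
    have "runs (Seq (pop 1) drop_word) (main (word v @ a)) (100 * tsize l + 2) (main (word r @ a))"
      using Nd runs_drop_word[of l] by (intro runs_Seq_pop) auto
    then have "runs (compile PSnd) (main (word v @ a)) (Suc (100 * tsize l + 2)) (main (word r @ a))"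
      unfolding compile.simps by (intro runs_Cond) (use Nd in auto)
    then show ?thesis
      using Nd by (simp del: compile.simps) (erule runs_mono, linarith)
  qed
  then have "implements PSnd 400" by (simp add: implements_def del: compile.simps peval.simps)
  then show ?case ..
next
  case (PComp p q)
  then obtain k l where kl: "implements p k" "implements q l" by auto
  have "implements (PComp p q) (k + l + 1)"
    unfolding implements_def compile.simps
  proof (intro allI)
    fix v a
    have "Suc (l * cost q v + k * cost p (peval q v)) \<le> (k + l + 1) * cost (PComp p q) v"
      using cost_pos[of q v] by (simp add: algebra_simps)
    then show "runs (Seq (compile q) (compile p)) (main (word v @ a)) ((k + l + 1) * cost (PComp p q) v)
        (main (word (peval (PComp p q) v) @ a))"
      using runs_mono[OF runs_Seq[OF implementsD[OF kl(2)] implementsD[OF kl(1)]]] by simp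
  qed
  then show ?case ..
next
  case (PPair p q)
  then obtain k l where kl: "implements p k" "implements q l" by auto
  have "implements (PPair p q) (k + l + 1000)"
    unfolding implements_def compile.simps
  proof (intro allI)
    fix v a
    let ?x = "peval p v" and ?y = "peval q v"
    have "runs (push 1 2) (main (word ?x @ word ?y @ a)) 3 (main (2 # word ?x @ word ?y @ a))"
      using runs_push[of 1 2 "main (word ?x @ word ?y @ a)"] by simp
    then have "runs (Seq dup_word (Seq (compile p) (Seq swap_words (Seq (compile q) (Seq swap_words (push 1 2))))))
       (main (word v @ a)) (Suc (100 * tsize v + Suc (k * cost p v + Suc (100 * (tsize ?x + tsize v) +
         Suc (l * cost q v + Suc (100 * (tsize ?y + tsize ?x) + 3)))))) (main (2 # word ?x @ word ?y @ a))"
      by (rule runs_Seq[OF runs_dup_word runs_Seq[OF implementsD[OF kl(1)] runs_Seq[OF runs_swap_words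
            runs_Seq[OF implementsD[OF kl(2)] runs_Seq[OF runs_swap_words]]]]])
    then show "runs (Seq dup_word (Seq (compile p) (Seq swap_words (Seq (compile q) (Seq swap_words (push 1 2))))))
       (main (word v @ a)) ((k + l + 1000) * cost (PPair p q) v) (main (word (peval (PPair p q) v) @ a))"
      by (simp del: cost.simps, elim runs_mono) (use tsize_ge_1[of v] in \<open>simp add: algebra_simps\<close>)
  qed
  then show ?case ..
next
  case (PIf b p q)
  then obtain j k l where jkl: "implements b j" "implements p k" "implements q l" by auto
  have "implements (PIf b p q) (j + k + l + 1000)"
    unfolding implements_def compile.simps
  proof (intro allI)
    fix v a
    let ?x = "peval b v"
    let ?N = "k * (if ?x \<noteq> Lf then cost p v else 0) + l * (if ?x = Lf then cost q v else 0)"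
    have 1: "runs (Seq drop_word (compile p)) (main (word ?x @ word v @ a)) (Suc (100 * tsize ?x + ?N)) (main (word (peval p v) @ a))"
      if "?x \<noteq> Lf" using that runs_Seq[OF runs_drop_word implementsD[OF jkl(2)]] by simp
    have 2: "runs (Seq drop_word (compile q)) (main (word ?x @ word v @ a)) (Suc (100 * tsize ?x + ?N)) (main (word (peval q v) @ a))"
      if "?x = Lf" using that runs_Seq[OF runs_drop_word[of ?x] implementsD[OF jkl(3)]] by simp
    have 3: "runs (Cond 1 (\<lambda>x. x = 2) (Seq drop_word (compile p)) (Seq drop_word (compile q)))
      (main (word ?x @ word v @ a)) (Suc (Suc (100 * tsize ?x + ?N))) (main (word (peval (PIf b p q) v) @ a))"
      by (rule runs_Cond) (use 1 2 in \<open>auto simp: peek_word split: if_splits\<close>)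
    have "runs (Seq dup_word (Seq (compile b) (Cond 1 (\<lambda>x. x = 2) (Seq drop_word (compile p)) (Seq drop_word (compile q)))))
      (main (word v @ a)) (Suc (100 * tsize v + Suc (j * cost b v + Suc (Suc (100 * tsize ?x + ?N))))) (main (word (peval (PIf b p q) v) @ a))"
      by (rule runs_Seq[OF runs_dup_word runs_Seq[OF implementsD[OF jkl(1)] 3]])
    then show "runs (Seq dup_word (Seq (compile b) (Cond 1 (\<lambda>x. x = 2) (Seq drop_word (compile p)) (Seq drop_word (compile q)))))
      (main (word v @ a)) ((j + k + l + 1000) * cost (PIf b p q) v) (main (word (peval (PIf b p q) v) @ a))"
      by (rule runs_mono) (use tsize_ge_1[of v] in \<open>simp add: algebra_simps\<close>)
  qed
  then show ?case ..
next
  case (PIter p)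
  then obtain k where k: "implements p k" by auto
  let ?B = "Seq (pop 1) (Seq drop_word (Seq swap_words (Seq (compile p) swap_words)))"
  let ?W = "While 1 (\<lambda>x. x = 2) ?B"
  \<comment> \<open>The counter lies above the state. A round removes the node marker and the left
    subtree, runs \<open>p\<close> on the state between two swaps and finds the next counter on top.
    When the counter is a leaf, its symbol 1 is left over and popped after the loop.\<close>
  have loop: "runs ?W (main (word c @ word w @ a)) ((k + 1000) * iter_cost (peval p) (cost p) c w)
      (main (1 # word (iter_eval (peval p) c w) @ a))" for c w a
  proof (induction c arbitrary: w)
    case Lf
    then show ?case
      using runs_mono[OF runs_While_False[of 1 "\<lambda>x. x = 2" "main (1 # word w @ a)" ?B]] by simp
  next
    case (Nd c d)
    let ?y = "peval p w"
    have "runs (Seq drop_word (Seq swap_words (Seq (compile p) swap_words))) (main (word c @ word d @ word w @ a))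
      (Suc (100 * tsize c + Suc (100 * (tsize d + tsize w) + Suc (k * cost p w + 100 * (tsize ?y + tsize d)))))
      (main (word d @ word ?y @ a))"
      by (rule runs_Seq[OF runs_drop_word runs_Seq[OF runs_swap_words runs_Seq[OF implementsD[OF k] runs_swap_words]]])
    then have "runs ?B (main (word (Nd c d) @ word w @ a))
      (Suc (100 * tsize c + Suc (100 * (tsize d + tsize w) + Suc (k * cost p w + 100 * (tsize ?y + tsize d)))) + 2)
      (main (word d @ word ?y @ a))"
      by (intro runs_Seq_pop) auto
    from runs_While_True[OF _ _ this Nd.IH(2)[of ?y]]
    show ?case
      by (simp, elim runs_mono) (use tsize_ge_1[of w] in \<open>simp add: algebra_simps\<close>)
  qed
  have "implements (PIter p) (k + 2000)"
    unfolding implements_def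
  proof (intro allI)
    fix v a
    show "runs (compile (PIter p)) (main (word v @ a)) ((k + 2000) * cost (PIter p) v) (main (word (peval (PIter p) v) @ a))"
    proof (cases v)
      case Lf
      then show ?thesis
        unfolding compile.simps
        by (intro runs_mono[OF runs_Cond[where n = 1]]) (use runs_skip in auto)
    next
      case (Nd c w)
      let ?N = "(k + 1000) * iter_cost (peval p) (cost p) c w"
      let ?z = "iter_eval (peval p) c w"
      have "runs (Seq ?W (pop 1)) (main (word c @ word w @ a)) (Suc (?N + 1)) (main (word ?z @ a))"
        by (rule runs_Seq[OF loop]) (use runs_pop[of 1 "main (1 # word ?z @ a)"] in simp)
      then have "runs (Seq (pop 1) (Seq ?W (pop 1))) (main (word v @ a)) (Suc (?N + 1) + 2) (main (word ?z @ a))"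
        using Nd by (intro runs_Seq_pop) auto
      then have "runs (compile (PIter p)) (main (word v @ a)) (Suc (Suc (?N + 1) + 2)) (main (word ?z @ a))"
        unfolding compile.simps by (intro runs_Cond) (use Nd in auto)
      moreover have "Suc (Suc (?N + 1) + 2) \<le> (k + 2000) * cost (PIter p) v"
        using Nd tsize_ge_1[of c] by (simp add: algebra_simps)
      ultimately show ?thesis using Nd runs_mono by fastforce
    qed
  qed
  then show ?case ..
qed

section \<open>Polynomial-time functions on encoded data\<close>

class codable =
  fixes code :: "'a \<Rightarrow> tree"
  assumes code_inject: "code x = code y \<Longrightarrow> x = y"

instantiation tree :: codable
begin
definition code_tree :: "tree \<Rightarrow> tree" where "code_tree v = v"
instance by standard (simp add: code_tree_def)
end

text \<open>\<open>False\<close> is the leaf, in accordance with the test of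
  \<open>PIf\<close>.\<close>

instantiation bool :: codable
begin
definition code_bool :: "bool \<Rightarrow> tree" where "code_bool b = (if b then Nd Lf Lf else Lf)"
instance by standard (auto simp: code_bool_def split: if_splits)
end

text \<open>Unary numbers, coded like lists of leaves: a number is itself a counter for
  \<open>PIter\<close>, and polynomial time in a number means polynomial in its value.\<close>

instantiation nat :: codable
begin
primrec code_nat :: "nat \<Rightarrow> tree" where
  "code_nat 0 = Lf"
| "code_nat (Suc n) = Nd Lf (code_nat n)"
instance
proof
  fix x y :: nat
  show "code x = code y \<Longrightarrow> x = y"
    by (induction x arbitrary: y; case_tac y) auto
qed
end

instantiation prod :: (codable, codable) codable
begin
definition code_prod :: "'a \<times> 'b \<Rightarrow> tree" where "code_prod p = Nd (code (fst p)) (code (snd p))"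
instance by standard (auto simp: code_prod_def prod_eq_iff intro: code_inject)
end

instantiation list :: (codable) codable
begin
primrec code_list :: "'a list \<Rightarrow> tree" where
  "code_list [] = Lf"
| "code_list (x # xs) = Nd (code x) (code_list xs)"
instance
proof
  fix x y :: "'a list"
  show "code x = code y \<Longrightarrow> x = y"
    by (induction x arbitrary: y; case_tac y) (auto intro: code_inject)
qed
end

lemma code_eq_iff [simp]: "code x = code y \<longleftrightarrow> x = y"
  using code_inject by blast

definition sz :: "'a::codable \<Rightarrow> nat" where
  "sz x = tsize (code x)"

lemma sz_ge_1: "1 \<le> sz x"
  using tsize_ge_1 by (simp add: sz_def)

lemma sz_bool: "sz (b::bool) \<le> 3"
  by (simp add: sz_def code_bool_def)

lemma sz_nat [simp]: "sz (n::nat) = 2 * n + 1"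
  by (induction n) (auto simp: sz_def)

lemma sz_pair [simp]: "sz (x, y) = 1 + sz x + sz y"
  by (simp add: sz_def code_prod_def)

lemma sz_Nil [simp]: "sz [] = 1"
  by (simp add: sz_def)

lemma sz_Cons [simp]: "sz (x # xs) = 1 + sz x + sz xs"
  by (simp add: sz_def)

lemma sz_elem_le: "y \<in> set xs \<Longrightarrow> sz y \<le> sz xs"
  by (induction xs) auto

lemma length_le_sz: "length xs \<le> sz xs"
  by (induction xs) auto

lemma sz_append: "sz (xs @ ys) + 1 = sz xs + sz ys"
  by (induction xs) auto

lemma sz_drop_le: "sz (drop n xs) \<le> sz xs"
proof (induction xs arbitrary: n)
  case (Cons x xs)
  then show ?case by (cases n) (auto simp: le_SucI trans_le_add2)
qed simp

lemma sz_rev [simp]: "sz (rev xs) = sz xs"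
proof (induction xs)
  case (Cons x xs)
  then show ?case using sz_append[of "rev xs" "[x]"] by simp
qed simp

lemma sz_list_le: "\<forall>y\<in>set xs. sz y \<le> b \<Longrightarrow> sz xs \<le> 1 + length xs * (b + 1)"
  by (induction xs) auto

subsection \<open>Polynomial bounds\<close>

text \<open>With a base of at least 2, a larger exponent absorbs constants and sums, so a single
  exponent describes the whole bound.\<close>

definition poly_bounded :: "('a::codable \<Rightarrow> nat) \<Rightarrow> bool" where
  "poly_bounded h \<longleftrightarrow> (\<exists>k. \<forall>x. h x \<le> (sz x + 2) ^ k)"

named_theorems pb_intros

lemma poly_bounded_mono: "poly_bounded g \<Longrightarrow> (\<And>x. h x \<le> g x) \<Longrightarrow> poly_bounded h"
  unfolding poly_bounded_def using le_trans by blast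

lemma pow_two_add_mono: "j \<le> k \<Longrightarrow> (s + 2) ^ j \<le> (s + 2 :: nat) ^ k"
  by (rule power_increasing) auto

lemma poly_bounded_const [pb_intros]: "poly_bounded (\<lambda>_. c)"
proof -
  have "c \<le> (s + 2) ^ c" for s
    using less_exp[of c] power_mono[of 2 "s + 2" c] by linarith
  then show ?thesis unfolding poly_bounded_def by blast
qed

lemma poly_bounded_sz [pb_intros]: "poly_bounded sz"
  unfolding poly_bounded_def by (rule exI[of _ 1]) simp

lemma poly_bounded_tsize [pb_intros]: "poly_bounded (\<lambda>x. tsize (code x))"
  using poly_bounded_sz by (simp add: sz_def[abs_def])

lemma poly_bounded_add [pb_intros]:
  assumes "poly_bounded g" "poly_bounded h"
  shows "poly_bounded (\<lambda>x. g x + h x)"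
proof -
  obtain j k where j: "\<And>x. g x \<le> (sz x + 2) ^ j" and k: "\<And>x. h x \<le> (sz x + 2) ^ k"
    using assms unfolding poly_bounded_def by blast
  have "g x + h x \<le> (sz x + 2) ^ (j + k + 1)" for x
  proof -
    have "g x + h x \<le> 2 * (sz x + 2) ^ (j + k)"
      using j[of x] k[of x] pow_two_add_mono[of j "j + k" "sz x"] pow_two_add_mono[of k "j + k" "sz x"]
      by linarith
    also have "\<dots> \<le> (sz x + 2) ^ (j + k + 1)" by simp
    finally show ?thesis .
  qed
  then show ?thesis unfolding poly_bounded_def by blast
qed

lemma poly_bounded_mult [pb_intros]:
  assumes "poly_bounded g" "poly_bounded h"
  shows "poly_bounded (\<lambda>x. g x * h x)"
proof -
  obtain j k where j: "\<And>x. g x \<le> (sz x + 2) ^ j" and k: "\<And>x. h x \<le> (sz x + 2) ^ k"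
    using assms unfolding poly_bounded_def by blast
  have "g x * h x \<le> (sz x + 2) ^ (j + k)" for x
    unfolding power_add by (rule mult_mono) (use j k in auto)
  then show ?thesis unfolding poly_bounded_def by blast
qed

lemma poly_bounded_Suc [pb_intros]: "poly_bounded g \<Longrightarrow> poly_bounded (\<lambda>x. Suc (g x))"
  using poly_bounded_add[OF _ poly_bounded_const, of g 1] by simp

lemma poly_bounded_power [pb_intros]: "poly_bounded g \<Longrightarrow> poly_bounded (\<lambda>x. g x ^ k)"
  by (induction k) (auto intro: pb_intros)

lemma poly_bounded_comp:
  assumes "poly_bounded h" "poly_bounded (\<lambda>x. sz (f x))"
  shows "poly_bounded (\<lambda>x. h (f x))"
proof -
  obtain k where k: "\<And>x. h x \<le> (sz x + 2) ^ k"
    using assms unfolding poly_bounded_def by blast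
  have "poly_bounded (\<lambda>x. (sz (f x) + 2) ^ k)"
    by (intro pb_intros assms)
  then show ?thesis by (rule poly_bounded_mono) (rule k)
qed

subsection \<open>Closure properties\<close>

text \<open>The polynomial-time functions. The closure rules collected in \<open>fp_intros\<close>
  follow the syntax of HOL terms, so membership is mostly proved by resolving along the
  term.\<close>

definition fp :: "('a::codable \<Rightarrow> 'b::codable) \<Rightarrow> bool" where
  "fp f \<longleftrightarrow> (\<exists>p. (\<forall>x. peval p (code x) = code (f x)) \<and> poly_bounded (\<lambda>x::'a. cost p (code x)))"

named_theorems fp_intros

lemma fpI:
  fixes f :: "'a::codable \<Rightarrow> 'b::codable"
  shows "(\<And>x. peval p (code x) = code (f x)) \<Longrightarrow> poly_bounded (\<lambda>x::'a. cost p (code x)) \<Longrightarrow> fp f"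
  unfolding fp_def by blast

lemma fpE:
  fixes f :: "'a::codable \<Rightarrow> 'b::codable"
  assumes "fp f"
  obtains p where "\<And>x. peval p (code x) = code (f x)" "poly_bounded (\<lambda>x::'a. cost p (code x))"
  using assms unfolding fp_def by blast

lemma tsize_iter_eval_le: "tsize (iter_eval f c w) \<le> tsize w + iter_cost f g c w"
proof (induction c arbitrary: w)
  case (Nd l r)
  show ?case using Nd.IH(2)[of "f w"] by simp
qed simp

text \<open>A program cannot produce more than it pays for. Polynomial cost therefore bounds the
  output size, without which composition would not preserve polynomial time.\<close>

lemma tsize_peval_le: "tsize (peval p v) \<le> tsize v + cost p v"
proof (induction p arbitrary: v)
  case (PComp p q)
  show ?case using PComp.IH(1)[of "peval q v"] PComp.IH(2)[of v] by simp
next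
  case (PPair p q)
  then show ?case using tsize_ge_1[of v] by simp
next
  case (PIf b p q)
  show ?case using PIf.IH(2)[of v] PIf.IH(3)[of v] by simp
next
  case (PIter p)
  show ?case
  proof (cases v)
    case (Nd c w)
    then show ?thesis using tsize_iter_eval_le[of "peval p" c w "cost p"] by simp
  qed simp
qed (auto split: tree.splits simp: Suc_le_eq)

lemma poly_bounded_fp [pb_intros]:
  fixes f :: "'a::codable \<Rightarrow> 'b::codable"
  shows "fp f \<Longrightarrow> poly_bounded (\<lambda>x. sz (f x))"
proof (rule fpE)
  fix p
  assume p: "\<And>x. peval p (code x) = code (f x)" "poly_bounded (\<lambda>x::'a. cost p (code x))"
  have "sz (f x) \<le> sz x + cost p (code x)" for x
    using tsize_peval_le[of p "code x"] by (simp add: p(1) sz_def)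
  then show "poly_bounded (\<lambda>x. sz (f x))"
    by (rule poly_bounded_mono[OF poly_bounded_add[OF poly_bounded_sz p(2)]])
qed

lemma fp_id [fp_intros]: "fp (\<lambda>x. x)"
  by (rule fpI[of PId]) (auto intro: pb_intros)

lemma fp_code [fp_intros]: "fp f \<Longrightarrow> fp (\<lambda>x. code (f x))"
  by (auto simp: fp_def code_tree_def)

lemma fp_const [fp_intros]: "fp (\<lambda>_::'a::codable. c)"
proof -
  have "\<exists>p. (\<forall>v. peval p v = t) \<and> poly_bounded (\<lambda>x::'a. cost p (code x))" for t
  proof (induction t)
    case Lf
    show ?case by (rule exI[of _ PLf]) (auto intro: pb_intros simp flip: sz_def)
  next
    case (Nd l r)
    then obtain p q where "\<forall>v. peval p v = l" "poly_bounded (\<lambda>x::'a. cost p (code x))"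
      "\<forall>v. peval q v = r" "poly_bounded (\<lambda>x::'a. cost q (code x))" by blast
    then show ?case by (intro exI[of _ "PPair p q"]) (auto intro!: pb_intros simp flip: sz_def)
  qed
  then show ?thesis unfolding fp_def by blast
qed

lemma fp_comp:
  fixes f :: "'b::codable \<Rightarrow> 'c::codable" and g :: "'a::codable \<Rightarrow> 'b"
  assumes "fp f" "fp g"
  shows "fp (\<lambda>x. f (g x))"
proof -
  obtain p where p: "\<And>x. peval p (code x) = code (f x)" "poly_bounded (\<lambda>x::'b. cost p (code x))"
    using assms(1) by (rule fpE) blast
  obtain q where q: "\<And>x. peval q (code x) = code (g x)" "poly_bounded (\<lambda>x::'a. cost q (code x))"
    using assms(2) by (rule fpE) blast
  show ?thesis
    by (rule fpI[of "PComp p q"])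
      (use p q poly_bounded_comp[OF p(2) poly_bounded_fp[OF assms(2)]] in \<open>auto intro: pb_intros\<close>)
qed

lemma fp_pair [fp_intros]:
  fixes f :: "'a::codable \<Rightarrow> 'b::codable" and g :: "'a \<Rightarrow> 'c::codable"
  assumes "fp f" "fp g"
  shows "fp (\<lambda>x. (f x, g x))"
proof -
  obtain p where p: "\<And>x. peval p (code x) = code (f x)" "poly_bounded (\<lambda>x::'a. cost p (code x))"
    using assms(1) by (rule fpE) blast
  obtain q where q: "\<And>x. peval q (code x) = code (g x)" "poly_bounded (\<lambda>x::'a. cost q (code x))"
    using assms(2) by (rule fpE) blast
  show ?thesis
    by (rule fpI[of "PPair p q"])
      (use p q assms in \<open>auto intro!: pb_intros simp: code_prod_def simp flip: sz_def\<close>)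
qed

lemma fp_fst [fp_intros]:
  fixes f :: "'c::codable \<Rightarrow> 'a::codable \<times> 'b::codable"
  assumes "fp f"
  shows "fp (\<lambda>x. fst (f x))"
proof -
  have "fp (fst :: 'a \<times> 'b \<Rightarrow> 'a)"
    by (rule fpI[of PFst], simp add: code_prod_def, simp add: poly_bounded_tsize)
  then show ?thesis using assms by (rule fp_comp)
qed

lemma fp_snd [fp_intros]:
  fixes f :: "'c::codable \<Rightarrow> 'a::codable \<times> 'b::codable"
  assumes "fp f"
  shows "fp (\<lambda>x. snd (f x))"
proof -
  have "fp (snd :: 'a \<times> 'b \<Rightarrow> 'b)"
    by (rule fpI[of PSnd], simp add: code_prod_def, simp add: poly_bounded_tsize)
  then show ?thesis using assms by (rule fp_comp)
qed

lemma fp_if [fp_intros]: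
  fixes b :: "'a::codable \<Rightarrow> bool" and f g :: "'a \<Rightarrow> 'b::codable"
  assumes "fp b" "fp f" "fp g"
  shows "fp (\<lambda>x. if b x then f x else g x)"
proof -
  obtain r where r: "\<And>x. peval r (code x) = code (b x)" "poly_bounded (\<lambda>x::'a. cost r (code x))"
    using assms(1) by (rule fpE) blast
  obtain p where p: "\<And>x. peval p (code x) = code (f x)" "poly_bounded (\<lambda>x::'a. cost p (code x))"
    using assms(2) by (rule fpE) blast
  obtain q where q: "\<And>x. peval q (code x) = code (g x)" "poly_bounded (\<lambda>x::'a. cost q (code x))"
    using assms(3) by (rule fpE) blast
  have "poly_bounded (\<lambda>x. sz x + cost r (code x) + sz (b x) + (cost p (code x) + cost q (code x)))"
    by (intro pb_intros p q r assms)
  then have "poly_bounded (\<lambda>x::'a. cost (PIf r p q) (code x))"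
    by (rule poly_bounded_mono) (auto simp: r sz_def)
  then show ?thesis
    by (intro fpI[of "PIf r p q"]) (auto simp: p q r code_bool_def)
qed

lemma fp_Cons [fp_intros]:
  fixes f :: "'a::codable \<Rightarrow> 'b::codable" and g :: "'a \<Rightarrow> 'b list"
  assumes "fp f" "fp g"
  shows "fp (\<lambda>x. f x # g x)"
proof -
  obtain p where p: "\<And>x. peval p (code x) = code (f x, g x)" "poly_bounded (\<lambda>x::'a. cost p (code x))"
    using fp_pair[OF assms] by (rule fpE) blast
  show ?thesis by (rule fpI[of p]) (use p in \<open>auto simp: code_prod_def\<close>)
qed

lemma fp_Suc [fp_intros]:
  fixes f :: "'a::codable \<Rightarrow> nat"
  assumes "fp f"
  shows "fp (\<lambda>x. Suc (f x))"
proof -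
  obtain p where p: "\<And>x. peval p (code x) = code (0::nat, f x)" "poly_bounded (\<lambda>x::'a. cost p (code x))"
    using fp_pair[OF fp_const assms] by (rule fpE) blast
  show ?thesis by (rule fpI[of p]) (use p in \<open>auto simp: code_prod_def\<close>)
qed

text \<open>A nonempty list is encoded like the pair of its head and its tail.\<close>

lemma fp_case_list [fp_intros]:
  fixes l :: "'a::codable \<Rightarrow> 'b::codable list" and a :: "'a \<Rightarrow> 'c::codable"
  assumes "fp l" "fp a" "fp (\<lambda>p. g (fst p) (fst (snd p)) (snd (snd p)))"
  shows "fp (\<lambda>x. case l x of [] \<Rightarrow> a x | y # ys \<Rightarrow> g x y ys)"
proof -
  obtain p where p: "\<And>x. peval p (code x) = code (x, l x)" "poly_bounded (\<lambda>x::'a. cost p (code x))"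
    using fp_pair[OF fp_id assms(1)] by (rule fpE) blast
  obtain q where q: "\<And>x. peval q (code x) = code (a x)" "poly_bounded (\<lambda>x::'a. cost q (code x))"
    using assms(2) by (rule fpE) blast
  obtain r where r: "\<And>x. peval r (code x) = code (g (fst x) (fst (snd x)) (snd (snd x)))"
       "poly_bounded (\<lambda>x::'a \<times> 'b \<times> 'b list. cost r (code x))"
    using assms(3) by (rule fpE) blast
  obtain s where s: "\<And>x. peval s (code x) = code (l x)" "poly_bounded (\<lambda>x::'a. cost s (code x))"
    using assms(1) by (rule fpE) blast
  have code_l: "code (x, l x) = code (x, y, ys)" if "l x = y # ys" for x y ys
    using that by (simp add: code_prod_def)
  define h where "h x = (case l x of [] \<Rightarrow> 0 | y # ys \<Rightarrow> cost r (code (x, y, ys)))" for x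
  obtain k where k: "\<And>x. cost r (code (x :: 'a \<times> 'b \<times> 'b list)) \<le> (sz x + 2) ^ k"
    using r(2) unfolding poly_bounded_def by blast
  have "poly_bounded (\<lambda>x. (sz (x, l x) + 2) ^ k)"
    by (intro pb_intros fp_intros assms)
  then have h: "poly_bounded h"
  proof (rule poly_bounded_mono)
    fix x
    show "h x \<le> (sz (x, l x) + 2) ^ k"
    proof (cases "l x")
      case Nil
      then show ?thesis by (simp add: h_def)
    next
      case (Cons y ys)
      then have "sz (x, l x) = sz (x, y, ys)" using code_l by (simp add: sz_def)
      then show ?thesis using k[of "(x, y, ys)"] Cons by (simp add: h_def)
    qed
  qed
  have "poly_bounded (\<lambda>x. sz x + cost s (code x) + sz (l x) + (cost p (code x) + h x + cost q (code x)))"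
    by (intro pb_intros p q s assms h)
  then have "poly_bounded (\<lambda>x::'a. cost (PIf s (PComp r p) q) (code x))"
  proof (rule poly_bounded_mono)
    fix x
    show "cost (PIf s (PComp r p) q) (code x) \<le>
        sz x + cost s (code x) + sz (l x) + (cost p (code x) + h x + cost q (code x))"
      using code_l[of x] by (cases "l x") (auto simp: s p h_def sz_def)
  qed
  moreover have "peval (PIf s (PComp r p) q) (code x) =
      code (case l x of [] \<Rightarrow> a x | y # ys \<Rightarrow> g x y ys)" for x
  proof (cases "l x")
    case (Cons y ys)
    then show ?thesis using code_l[OF Cons] r(1)[of "(x, y, ys)"] by (simp add: s p)
  qed (simp add: s q)
  ultimately show ?thesis by (intro fpI)
qed

primrec spine :: "tree \<Rightarrow> nat" where
  "spine Lf = 0"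
| "spine (Nd l r) = Suc (spine r)"

lemma spine_code_nat [simp]: "spine (code (n::nat)) = n"
  by (induction n) auto

lemma spine_code_list [simp]: "spine (code (xs::'a::codable list)) = length xs"
  by (induction xs) auto

lemma spine_le_tsize: "spine v \<le> tsize v"
  by (induction v) auto

lemma iter_eval_spine:
  fixes s :: "'s::codable \<Rightarrow> 's"
  assumes "\<And>w. f (code w) = code (s w)"
  shows "iter_eval f c (code y) = code ((s ^^ spine c) y)"
  using assms by (induction c arbitrary: y) (auto simp: funpow_swap1)

text \<open>A round moves what is left of the counter, at most \<open>N\<close>, and the states
  before and after it, at most \<open>b\<close> each, and pays at most \<open>d\<close> for the step
  itself.\<close>

lemma iter_cost_le:
  fixes s :: "'s::codable \<Rightarrow> 's"
  assumes "\<And>w. f (code w) = code (s w)" "\<And>k. k \<le> spine c \<Longrightarrow> sz ((s ^^ k) y) \<le> b"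
    "\<And>k. k \<le> spine c \<Longrightarrow> g (code ((s ^^ k) y)) \<le> d" "tsize c \<le> N"
  shows "iter_cost f g c (code y) \<le> 1 + spine c * (N + 2 * b + d)"
  using assms(2-)
proof (induction c arbitrary: y)
  case (Nd l r)
  have "iter_cost f g r (code (s y)) \<le> 1 + spine r * (N + 2 * b + d)"
  proof (rule Nd.IH(2))
    show "sz ((s ^^ k) (s y)) \<le> b" if "k \<le> spine r" for k
      using Nd.prems(1)[of "Suc k"] that by (simp add: funpow_swap1)
    show "g (code ((s ^^ k) (s y))) \<le> d" if "k \<le> spine r" for k
      using Nd.prems(2)[of "Suc k"] that by (simp add: funpow_swap1)
  qed (use Nd.prems in auto)
  then show ?case
    using Nd.prems(1)[of 0] Nd.prems(1)[of 1] Nd.prems(2)[of 0] Nd.prems(3)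
    by (simp add: assms(1) sz_def)
qed simp

text \<open>Iteration preserves polynomial time only if the intermediate values stay polynomially bounded.\<close>

lemma fp_iterate_spine:
  fixes s :: "'s::codable \<Rightarrow> 's" and i :: "'a::codable \<Rightarrow> 's" and c :: "'a \<Rightarrow> 'c::codable"
  assumes "fp s" "fp i" "fp c" "poly_bounded h"
    "\<And>x k. k \<le> spine (code (c x)) \<Longrightarrow> sz ((s ^^ k) (i x)) \<le> h x"
  shows "fp (\<lambda>x. (s ^^ spine (code (c x))) (i x))"
proof -
  obtain p where p: "\<And>w. peval p (code w) = code (s w)" "poly_bounded (\<lambda>w::'s. cost p (code w))"
    using assms(1) by (rule fpE) blast
  obtain q where q: "\<And>x. peval q (code x) = code (c x, i x)" "poly_bounded (\<lambda>x::'a. cost q (code x))"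
    using fp_pair[OF assms(3,2)] by (rule fpE) blast
  obtain k where k: "\<And>w::'s. cost p (code w) \<le> (sz w + 2) ^ k"
    using p(2) unfolding poly_bounded_def by blast
  let ?B = "\<lambda>x. 1 + sz (c x) * (sz (c x) + 2 * h x + (h x + 2) ^ k)"
  have le: "iter_cost (peval p) (cost p) (code (c x)) (code (i x)) \<le> ?B x" for x
  proof -
    have "iter_cost (peval p) (cost p) (code (c x)) (code (i x))
        \<le> 1 + spine (code (c x)) * (sz (c x) + 2 * h x + (h x + 2) ^ k)"
    proof (rule iter_cost_le[where s = s])
      show "cost p (code ((s ^^ j) (i x))) \<le> (h x + 2) ^ k" if "j \<le> spine (code (c x))" for j
        using k[of "(s ^^ j) (i x)"] power_mono[of "sz ((s ^^ j) (i x)) + 2" "h x + 2" k] assms(5)[OF that]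
        by linarith
    qed (use assms(5) p(1) in \<open>auto simp: sz_def\<close>)
    also have "\<dots> \<le> ?B x"
      by (intro add_mono mult_mono) (use spine_le_tsize in \<open>auto simp: sz_def\<close>)
    finally show ?thesis .
  qed
  have "poly_bounded (\<lambda>x. cost q (code x) + (1 + sz (c x) + sz (i x) + ?B x))"
    by (intro pb_intros q(2) assms)
  then have "poly_bounded (\<lambda>x::'a. cost (PComp (PIter p) q) (code x))"
    by (rule poly_bounded_mono) (use le in \<open>auto simp: q code_prod_def sz_def\<close>)
  moreover have "iter_eval (peval p) (code (c x)) (code (i x)) = code ((s ^^ spine (code (c x))) (i x))" for x
    by (rule iter_eval_spine) (rule p(1))
  ultimately show ?thesis
    by (intro fpI[of "PComp (PIter p) q"]) (auto simp: q code_prod_def)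
qed

text \<open>The step may depend on the input \<open>x\<close>: it is carried along unchanged as part
  of the state.\<close>

lemma fp_iterate_env:
  fixes s :: "'a::codable \<Rightarrow> 's::codable \<Rightarrow> 's" and c :: "'a \<Rightarrow> 'c::codable"
  assumes "fp (\<lambda>p. s (fst p) (snd p))" "fp i" "fp c" "poly_bounded h"
    "\<And>x k. k \<le> spine (code (c x)) \<Longrightarrow> sz ((s x ^^ k) (i x)) \<le> h x"
  shows "fp (\<lambda>x. (s x ^^ spine (code (c x))) (i x))"
proof -
  define S where "S p = (fst p, s (fst p) (snd p))" for p :: "'a \<times> 's"
  have pow: "(S ^^ k) (x, y) = (x, (s x ^^ k) y)" for k x y
    by (induction k) (auto simp: S_def)
  have "fp S" unfolding S_def by (intro fp_intros assms)
  moreover have "fp (\<lambda>x. (x, i x))" by (intro fp_intros assms)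
  moreover have "poly_bounded (\<lambda>x. 1 + sz x + h x)" by (intro pb_intros assms)
  ultimately have "fp (\<lambda>x. (S ^^ spine (code (c x))) (x, i x))"
    by (rule fp_iterate_spine[OF _ _ assms(3)]) (use assms(5) in \<open>auto simp: pow\<close>)
  from fp_snd[OF this] show ?thesis by (simp add: pow)
qed

lemma fp_iterate:
  fixes s :: "'a::codable \<Rightarrow> 's::codable \<Rightarrow> 's"
  assumes "fp (\<lambda>p. s (fst p) (snd p))" "fp i" "fp n" "poly_bounded h"
    "\<And>x k. k \<le> n x \<Longrightarrow> sz ((s x ^^ k) (i x)) \<le> h x"
  shows "fp (\<lambda>x. (s x ^^ n x) (i x))"
  using fp_iterate_env[OF assms(1-4)] assms(5) by simp

lemma fp_cong: "fp g \<Longrightarrow> (\<And>x. f x = g x) \<Longrightarrow> fp f"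
  by (simp add: fp_def)

subsection \<open>Booleans, numbers and lists\<close>

lemma fp_conj [fp_intros]: "fp a \<Longrightarrow> fp b \<Longrightarrow> fp (\<lambda>x. a x \<and> b x)"
  by (rule fp_cong[OF fp_if[of a b "\<lambda>_. False"]]) (auto intro: fp_const)

lemma fp_not [fp_intros]: "fp a \<Longrightarrow> fp (\<lambda>x. \<not> a x)"
  by (rule fp_cong[OF fp_if[of a "\<lambda>_. False" "\<lambda>_. True"]]) (auto intro: fp_const)

lemma fp_tl [fp_intros]: "fp l \<Longrightarrow> fp (\<lambda>x. tl (l x))"
  unfolding tl_def by (intro fp_intros)

lemma fp_hd [fp_intros]:
  assumes "fp l"
  shows "fp (\<lambda>x. hd (l x))"
proof -
  have "fp (\<lambda>x. case l x of [] \<Rightarrow> hd [] | y # ys \<Rightarrow> y)"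
    by (intro fp_intros assms)
  then show ?thesis by (rule fp_cong) (auto split: list.splits)
qed

lemma fp_eq_Nil [fp_intros]:
  assumes "fp l"
  shows "fp (\<lambda>x. l x = [])"
proof -
  have "fp (\<lambda>x. case l x of [] \<Rightarrow> True | y # ys \<Rightarrow> False)"
    by (intro fp_intros assms)
  then show ?thesis by (rule fp_cong) (auto split: list.splits)
qed

lemma fp_length [fp_intros]:
  fixes l :: "'a::codable \<Rightarrow> 'b::codable list"
  assumes "fp l"
  shows "fp (\<lambda>x. length (l x))"
proof -
  have pow: "(Suc ^^ k) 0 = k" for k by (induction k) auto
  have "fp (\<lambda>x. (Suc ^^ spine (code (l x))) 0)"
  proof (rule fp_iterate_env[where s = "\<lambda>x. Suc"])
    show "poly_bounded (\<lambda>x. 2 * sz (l x) + 1)" by (intro pb_intros assms)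
  qed (use length_le_sz in \<open>auto intro!: fp_intros assms simp: pow intro: le_trans\<close>)
  then show ?thesis by (simp add: pow)
qed

text \<open>A fold is an iteration on pairs of the remaining list and the accumulator, with the list
  itself as counter.\<close>

lemma fp_fold_general:
  fixes f :: "'a::codable \<Rightarrow> 'b::codable \<Rightarrow> 'c::codable \<Rightarrow> 'c"
  assumes "fp (\<lambda>p. f (fst p) (fst (snd p)) (snd (snd p)))" "fp l" "fp i" "poly_bounded h"
    "\<And>x k. k \<le> length (l x) \<Longrightarrow> sz (fold (f x) (take k (l x)) (i x)) \<le> h x"
  shows "fp (\<lambda>x. fold (f x) (l x) (i x))"
proof -
  define s where "s x p = (tl (fst p), f x (hd (fst p)) (snd p))" for x p
  have fs: "fp (\<lambda>p. s (fst p) (snd p))"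
    unfolding s_def
    by (intro fp_intros fp_comp[OF assms(1), of "\<lambda>p. (fst p, hd (fst (snd p)), snd (snd p))", simplified])
  have pow: "(s x ^^ k) (ys, y) = (drop k ys, fold (f x) (take k ys) y)" if "k \<le> length ys" for x k ys y
    using that
  proof (induction k)
    case (Suc k)
    then show ?case
      by (simp add: s_def take_Suc_conv_app_nth hd_drop_conv_nth tl_drop drop_Suc)
  qed simp
  have "poly_bounded (\<lambda>x. 1 + sz (l x) + h x)" by (intro pb_intros assms)
  then have "fp (\<lambda>x. (s x ^^ spine (code (l x))) (l x, i x))"
    by (rule fp_iterate_env[OF fs fp_pair[OF assms(2,3)] assms(2)])
      (use assms(5) sz_drop_le in \<open>fastforce simp: pow intro: add_mono\<close>)
  from fp_snd[OF this] show ?thesis by (simp add: pow)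
qed

text \<open>The increment \<open>h\<close> does not depend on the accumulator, so polynomially many
  steps add up to a polynomial size.\<close>

lemma fp_fold:
  fixes f :: "'a::codable \<Rightarrow> 'b::codable \<Rightarrow> 'c::codable \<Rightarrow> 'c"
  assumes "fp (\<lambda>p. f (fst p) (fst (snd p)) (snd (snd p)))" "fp l" "fp i" "poly_bounded h"
    "\<And>x y acc. sz (f x y acc) \<le> sz acc + h (x, y)"
  shows "fp (\<lambda>x. fold (f x) (l x) (i x))"
proof -
  obtain k where k: "\<And>p. h p \<le> (sz p + 2) ^ k" using assms(4) unfolding poly_bounded_def by blast
  let ?B = "\<lambda>x. (1 + sz x + sz (l x) + 2) ^ k"
  have h: "h (x, y) \<le> ?B x" if "y \<in> set (l x)" for x y
    using k[of "(x, y)"] power_mono[of "sz (x, y) + 2" "1 + sz x + sz (l x) + 2" k] sz_elem_le[OF that]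
    by simp
  have le: "sz (fold (f x) ys acc) \<le> sz acc + length ys * ?B x" if "set ys \<subseteq> set (l x)" for x ys acc
    using that
  proof (induction ys arbitrary: acc)
    case (Cons y ys)
    have "sz (fold (f x) ys (f x y acc)) \<le> sz (f x y acc) + length ys * ?B x"
      using Cons by simp
    also have "\<dots> \<le> sz acc + ?B x + length ys * ?B x"
      using assms(5)[of x y acc] h[of y x] Cons.prems by simp
    finally show ?case by (simp add: algebra_simps)
  qed simp
  have pb: "poly_bounded (\<lambda>x. sz (i x) + sz (l x) * ?B x)" by (intro pb_intros assms)
  show ?thesis
  proof (rule fp_fold_general[OF assms(1-3) pb])
    fix x k
    have "sz (fold (f x) (take k (l x)) (i x)) \<le> sz (i x) + length (take k (l x)) * ?B x"
      by (rule le) (rule set_take_subset)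
    also have "\<dots> \<le> sz (i x) + sz (l x) * ?B x"
      using length_le_sz[of "l x"] by (intro add_mono mult_mono) auto
    finally show "sz (fold (f x) (take k (l x)) (i x)) \<le> sz (i x) + sz (l x) * ?B x" .
  qed
qed

text \<open>For accumulators that may double in a step but are cut off at a bound independent of the
  list processed so far.\<close>

lemma fp_fold_capped:
  fixes f :: "'a::codable \<Rightarrow> 'b::codable \<Rightarrow> 'c::codable \<Rightarrow> 'c"
  assumes "fp (\<lambda>p. f (fst p) (fst (snd p)) (snd (snd p)))" "fp l" "fp i" "poly_bounded h"
    "\<And>x y acc. sz (f x y acc) \<le> h x"
  shows "fp (\<lambda>x. fold (f x) (l x) (i x))"
proof (rule fp_fold_general[OF assms(1-3)])
  show "poly_bounded (\<lambda>x. sz (i x) + h x)" by (intro pb_intros assms)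
  fix x k
  show "sz (fold (f x) (take k (l x)) (i x)) \<le> sz (i x) + h x"
    by (cases "take k (l x)" rule: rev_cases) (auto intro: trans_le_add2 assms(5))
qed

lemma fp_rev [fp_intros]:
  assumes "fp l"
  shows "fp (\<lambda>x. rev (l x))"
proof -
  have "fp (\<lambda>x. fold (\<lambda>y acc. y # acc) (l x) [])"
    by (rule fp_fold[where h = "\<lambda>p. 1 + sz (snd p)"]) (auto intro!: fp_intros pb_intros assms)
  then show ?thesis by (rule fp_cong) (simp add: rev_conv_fold)
qed

lemma fp_foldr:
  fixes f :: "'a::codable \<Rightarrow> 'b::codable \<Rightarrow> 'c::codable \<Rightarrow> 'c"
  assumes "fp (\<lambda>p. f (fst p) (fst (snd p)) (snd (snd p)))" "fp l" "fp i" "poly_bounded h"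
    "\<And>x y acc. sz (f x y acc) \<le> sz acc + h (x, y)"
  shows "fp (\<lambda>x. foldr (f x) (l x) (i x))"
  using fp_fold[OF assms(1) fp_rev[OF assms(2)] assms(3-)] by (simp add: foldr_conv_fold)

lemma fp_foldr_capped:
  fixes f :: "'a::codable \<Rightarrow> 'b::codable \<Rightarrow> 'c::codable \<Rightarrow> 'c"
  assumes "fp (\<lambda>p. f (fst p) (fst (snd p)) (snd (snd p)))" "fp l" "fp i" "poly_bounded h"
    "\<And>x y acc. sz (f x y acc) \<le> h x"
  shows "fp (\<lambda>x. foldr (f x) (l x) (i x))"
  using fp_fold_capped[OF assms(1) fp_rev[OF assms(2)] assms(3-)] by (simp add: foldr_conv_fold)

lemma poly_bounded_nat:
  fixes n :: "'a::codable \<Rightarrow> nat"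
  shows "fp n \<Longrightarrow> poly_bounded n"
  by (rule poly_bounded_mono[OF poly_bounded_fp[of n]]) auto

lemma fp_map [fp_intros]:
  assumes "fp (\<lambda>p. f (fst p) (snd p))" "fp l"
  shows "fp (\<lambda>x. map (\<lambda>y. f x y) (l x))"
proof -
  have "fp (\<lambda>x. foldr (\<lambda>y acc. f x y # acc) (l x) [])"
    by (rule fp_foldr[where h = "\<lambda>p. 1 + sz (f (fst p) (snd p))"])
      (auto intro!: fp_intros pb_intros assms
        fp_comp[OF assms(1), of "\<lambda>p. (fst p, fst (snd p))", simplified])
  moreover have "map g l = foldr (\<lambda>y acc. g y # acc) l []" for g :: "'z \<Rightarrow> 'y" and l
    by (induction l) auto
  ultimately show ?thesis by (rule fp_cong)
qed

lemma fp_filter [fp_intros]: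
  assumes "fp (\<lambda>p. f (fst p) (snd p))" "fp l"
  shows "fp (\<lambda>x. filter (\<lambda>y. f x y) (l x))"
proof -
  have "fp (\<lambda>x. foldr (\<lambda>y acc. if f x y then y # acc else acc) (l x) [])"
    by (rule fp_foldr[where h = "\<lambda>p. 1 + sz (snd p)"])
      (auto intro!: fp_intros pb_intros assms
        fp_comp[OF assms(1), of "\<lambda>p. (fst p, fst (snd p))", simplified])
  moreover have "filter P l = foldr (\<lambda>y acc. if P y then y # acc else acc) l []" for P and l :: "'z list"
    by (induction l) auto
  ultimately show ?thesis by (rule fp_cong)
qed

lemma fp_takeWhile [fp_intros]:
  assumes "fp (\<lambda>p. f (fst p) (snd p))" "fp l"
  shows "fp (\<lambda>x. takeWhile (\<lambda>y. f x y) (l x))"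
proof -
  have "fp (\<lambda>x. foldr (\<lambda>y acc. if f x y then y # acc else []) (l x) [])"
    by (rule fp_foldr[where h = "\<lambda>p. 1 + sz (snd p)"])
      (auto intro!: fp_intros pb_intros assms
        fp_comp[OF assms(1), of "\<lambda>p. (fst p, fst (snd p))", simplified])
  moreover have "takeWhile P l = foldr (\<lambda>y acc. if P y then y # acc else []) l []" for P and l :: "'z list"
    by (induction l) auto
  ultimately show ?thesis by (rule fp_cong)
qed

lemma fp_list_all [fp_intros]:
  assumes "fp (\<lambda>p. f (fst p) (snd p))" "fp l"
  shows "fp (\<lambda>x. list_all (\<lambda>y. f x y) (l x))"
proof -
  have "fp (\<lambda>x. filter (\<lambda>y. \<not> f x y) (l x) = [])" by (intro fp_intros assms)
  then show ?thesis by (rule fp_cong) (simp add: list_all_iff filter_empty_conv)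
qed

lemma fp_list_ex [fp_intros]:
  assumes "fp (\<lambda>p. f (fst p) (snd p))" "fp l"
  shows "fp (\<lambda>x. list_ex (\<lambda>y. f x y) (l x))"
proof -
  have "fp (\<lambda>x. filter (\<lambda>y. f x y) (l x) \<noteq> [])" by (intro fp_intros assms)
  then show ?thesis by (rule fp_cong) (auto simp: list_ex_iff filter_empty_conv)
qed

lemma fp_append [fp_intros]:
  assumes "fp l" "fp m"
  shows "fp (\<lambda>x. l x @ m x)"
proof -
  have "fp (\<lambda>x. foldr (\<lambda>y acc. y # acc) (l x) (m x))"
    by (rule fp_foldr[where h = "\<lambda>p. 1 + sz (snd p)"]) (auto intro!: fp_intros pb_intros assms)
  moreover have "l @ m = foldr (\<lambda>y acc. y # acc) l m" for l m :: "'z list"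
    by (induction l) auto
  ultimately show ?thesis by (rule fp_cong)
qed

lemma fp_concat [fp_intros]:
  assumes "fp l"
  shows "fp (\<lambda>x. concat (l x))"
proof -
  have le: "sz (y @ acc) \<le> sz acc + sz y" for y acc :: "'b list"
    using sz_append[of y acc] by linarith
  have "fp (\<lambda>x. foldr (\<lambda>y acc. y @ acc) (l x) [])"
    by (rule fp_foldr[where h = "\<lambda>p. sz (snd p)"]) (auto intro!: fp_intros pb_intros assms le)
  then show ?thesis by (rule fp_cong) (simp add: concat_conv_foldr)
qed

lemma fp_add [fp_intros]:
  fixes m n :: "'a::codable \<Rightarrow> nat"
  assumes "fp m" "fp n"
  shows "fp (\<lambda>x. m x + n x)"
proof -
  have pow: "(Suc ^^ k) j = k + j" for k j by (induction k) auto
  have "fp (\<lambda>x. (Suc ^^ m x) (n x))"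
    by (rule fp_iterate[where h = "\<lambda>x. sz (m x) + sz (n x)"])
      (auto intro!: fp_intros pb_intros assms poly_bounded_nat[OF assms(1)] poly_bounded_nat[OF assms(2)]
        simp: pow)
  then show ?thesis by (simp add: pow)
qed

text \<open>The predecessor is the right subtree, and \<open>PSnd\<close> maps the leaf to itself,
  just as \<open>0 - 1 = 0\<close>.\<close>

lemma fp_pred:
  fixes n :: "'a::codable \<Rightarrow> nat"
  assumes "fp n"
  shows "fp (\<lambda>x. n x - 1)"
proof -
  have c: "(case code n of Lf \<Rightarrow> Lf | Nd l r \<Rightarrow> r) = code (n - 1)" for n :: nat by (cases n) auto
  have "fp (\<lambda>n::nat. n - 1)"
    by (rule fpI[of PSnd], simp add: c, simp add: poly_bounded_tsize)
  then show ?thesis using assms by (rule fp_comp)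
qed

lemma fp_diff [fp_intros]:
  fixes m n :: "'a::codable \<Rightarrow> nat"
  assumes "fp m" "fp n"
  shows "fp (\<lambda>x. m x - n x)"
proof -
  have pow: "((\<lambda>j. j - 1) ^^ k) j = j - k" for k j :: nat by (induction k) auto
  have "fp (\<lambda>x. ((\<lambda>j. j - 1) ^^ n x) (m x))"
    by (rule fp_iterate[where h = "\<lambda>x. sz (m x)"])
      (auto intro!: fp_intros fp_pred[simplified] pb_intros assms poly_bounded_nat[OF assms(1)] simp: pow[simplified])
  then show ?thesis unfolding pow .
qed

lemma fp_eq_0:
  fixes n :: "'a::codable \<Rightarrow> nat"
  assumes "fp n"
  shows "fp (\<lambda>x. n x = 0)"
proof -
  have pow: "((\<lambda>_. False) ^^ k) True = (k = 0)" for k by (cases k) auto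
  have "fp (\<lambda>x. ((\<lambda>_. False) ^^ n x) True)"
    by (rule fp_iterate[where h = "\<lambda>x. 3"])
      (auto intro!: fp_intros pb_intros assms simp: sz_bool)
  then show ?thesis unfolding pow .
qed

lemma fp_le [fp_intros]:
  fixes m n :: "'a::codable \<Rightarrow> nat"
  assumes "fp m" "fp n"
  shows "fp (\<lambda>x. m x \<le> n x)"
  using fp_eq_0[OF fp_diff[OF assms]] by simp

lemma fp_less [fp_intros]:
  fixes m n :: "'a::codable \<Rightarrow> nat"
  assumes "fp m" "fp n"
  shows "fp (\<lambda>x. m x < n x)"
  using fp_not[OF fp_le[OF assms(2,1)]] by (simp add: not_le)

lemma fp_eq_nat [fp_intros]:
  fixes m n :: "'a::codable \<Rightarrow> nat"
  assumes "fp m" "fp n"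
  shows "fp (\<lambda>x. m x = n x)"
  using fp_conj[OF fp_le[OF assms] fp_le[OF assms(2,1)]] by (simp add: eq_iff)

lemma fp_min [fp_intros]:
  fixes m n :: "'a::codable \<Rightarrow> nat"
  assumes "fp m" "fp n"
  shows "fp (\<lambda>x. min (m x) (n x))"
  unfolding min_def by (intro fp_intros assms)

lemma fp_mult [fp_intros]:
  fixes m n :: "'a::codable \<Rightarrow> nat"
  assumes "fp m" "fp n"
  shows "fp (\<lambda>x. m x * n x)"
proof -
  have pow: "((\<lambda>j. m x + j) ^^ k) 0 = k * m x" for k x by (induction k) auto
  have "fp (\<lambda>x. ((\<lambda>j. m x + j) ^^ n x) 0)"
  proof (rule fp_iterate[where h = "\<lambda>x. 2 * (sz (m x) * sz (n x)) + 1"])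
    fix x k
    assume "k \<le> n x"
    then have "k * m x \<le> sz (m x) * sz (n x)" unfolding mult.commute[of k] by (intro mult_mono) auto
    then show "sz (((\<lambda>j. m x + j) ^^ k) 0) \<le> 2 * (sz (m x) * sz (n x)) + 1" unfolding pow by (simp only: sz_nat)
  qed (intro fp_intros pb_intros assms fp_comp[OF assms(1)])+
  then show ?thesis unfolding pow by (simp only: mult.commute)
qed

lemma fp_power [fp_intros]:
  fixes n :: "'a::codable \<Rightarrow> nat"
  assumes "fp n"
  shows "fp (\<lambda>x. n x ^ k)"
  by (induction k) (auto intro!: fp_intros assms)

lemma fp_upt [fp_intros]:
  fixes n :: "'a::codable \<Rightarrow> nat"
  assumes "fp n"
  shows "fp (\<lambda>x. [0..<n x])"
proof -
  have pow: "((\<lambda>l. length l # l) ^^ k) [] = rev [0..<k]" for k by (induction k) auto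
  have "fp (\<lambda>x. ((\<lambda>l. length l # l) ^^ n x) [])"
  proof (rule fp_iterate[where h = "\<lambda>x. 1 + sz (n x) * (sz (n x) + 1)"])
    fix x k
    assume k: "k \<le> n x"
    then have "sz (rev [0..<k]) \<le> 1 + length (rev [0..<k]) * (sz (n x) + 1)"
      by (intro sz_list_le) auto
    also have "\<dots> \<le> 1 + sz (n x) * (sz (n x) + 1)"
      using k by (intro add_mono mult_mono) auto
    finally show "sz (((\<lambda>l. length l # l) ^^ k) []) \<le> 1 + sz (n x) * (sz (n x) + 1)" unfolding pow .
  qed (intro fp_intros pb_intros assms)+
  then have "fp (\<lambda>x. rev (rev [0..<n x]))" unfolding pow by (rule fp_rev)
  then show ?thesis by simp
qed

lemma fp_replicate [fp_intros]:
  assumes "fp n" "fp f"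
  shows "fp (\<lambda>x. replicate (n x) (f x))"
proof -
  have "fp (\<lambda>x. map (\<lambda>_. f x) [0..<n x])"
    by (intro fp_intros assms fp_comp[OF assms(2)])
  then show ?thesis by (rule fp_cong) (simp add: map_replicate_const)
qed

lemma fp_drop [fp_intros]:
  assumes "fp n" "fp l"
  shows "fp (\<lambda>x. drop (n x) (l x))"
proof -
  have pow: "(tl ^^ k) xs = drop k xs" for k and xs :: "'z list" by (induction k) (auto simp: tl_drop drop_Suc)
  have "fp (\<lambda>x. (tl ^^ n x) (l x))"
    by (rule fp_iterate[where h = "\<lambda>x. sz (l x)"])
      (auto intro!: fp_intros pb_intros assms sz_drop_le simp: pow)
  then show ?thesis by (simp add: pow)
qed

lemma fp_take [fp_intros]:
  assumes "fp n" "fp l"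
  shows "fp (\<lambda>x. take (n x) (l x))"
proof -
  have "fp (\<lambda>x. rev (drop (length (l x) - n x) (rev (l x))))"
    by (intro fp_intros assms)
  moreover have "take k xs = rev (drop (length xs - k) (rev xs))" for k and xs :: "'z list"
    by (cases "k \<le> length xs") (auto simp: rev_drop)
  ultimately show ?thesis by (rule fp_cong)
qed

lemma fp_zip [fp_intros]:
  assumes "fp l" "fp m"
  shows "fp (\<lambda>x. zip (l x) (m x))"
proof -
  have "fp (\<lambda>x. map (\<lambda>i. (hd (drop i (l x)), hd (drop i (m x)))) [0..<min (length (l x)) (length (m x))])"
    by (intro fp_intros assms fp_comp[OF assms(1)] fp_comp[OF assms(2)])
  then show ?thesis
    by (rule fp_cong) (auto intro!: nth_equalityI simp: hd_drop_conv_nth)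
qed

text \<open>Half and parity are found together by counting up: each step toggles the parity, and the
  half grows when the parity was odd.\<close>

lemma fp_half_odd: "fp (\<lambda>n::nat. (n div 2, odd n))"
proof -
  define s where "s p = (if snd p then Suc (fst p) else fst p, \<not> snd p)" for p :: "nat \<times> bool"
  have pow: "(s ^^ k) (0, False) = (k div 2, odd k)" for k
    by (induction k) (auto simp: s_def)
  have "fp (\<lambda>n::nat. (s ^^ n) (0, False))"
  proof (rule fp_iterate[where h = "\<lambda>n. 1 + sz n + 3"])
    show "sz ((s ^^ k) (0, False)) \<le> 1 + sz n + 3" if "k \<le> n" for n k
      using that sz_bool[of "odd k"] unfolding pow by simp
  qed (auto intro!: fp_intros pb_intros poly_bounded_nat[OF fp_id] simp: s_def)
  then show ?thesis unfolding pow .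
qed

lemma fp_half [fp_intros]: "fp n \<Longrightarrow> fp (\<lambda>x. n x div (2::nat))"
  using fp_fst[OF fp_comp[OF fp_half_odd]] by simp

lemma fp_odd [fp_intros]: "fp n \<Longrightarrow> fp (\<lambda>x. odd (n x :: nat))"
  using fp_snd[OF fp_comp[OF fp_half_odd]] by simp

lemma length_binary_le: "length (binary n) \<le> n"
proof (induction n rule: less_induct)
  case (less n)
  show ?case
  proof (cases "n = 0")
    case False
    then show ?thesis using less[of "n div 2"] binary.simps[of n] by simp
  qed (simp add: binary.simps)
qed

text \<open>\<open>n\<close> rounds are enough because the bit length is at most \<open>n\<close>,
  and the state is frozen once the number has become 0. The bits accumulate in reverse
  order.\<close>

lemma fp_binary [fp_intros]:
  assumes "fp n"
  shows "fp (\<lambda>x. binary (n x))"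
proof -
  define s where "s p = (if fst p = 0 then p else (fst p div 2, odd (fst p) # snd p))" for p :: "nat \<times> bool list"
  have pow: "\<exists>m'\<le>m. (s ^^ k) (m, acc) = (m', rev (take k (binary m)) @ acc) \<and> (m \<le> k \<longrightarrow> m' = 0)" for k m acc
  proof (induction k arbitrary: m acc)
    case (Suc k)
    show ?case
    proof (cases "m = 0")
      case True
      then have "s (m, acc) = (m, acc)" by (simp add: s_def)
      then have "(s ^^ Suc k) (m, acc) = (s ^^ k) (m, acc)" by (simp only: funpow_Suc_right o_apply)
      then show ?thesis using Suc.IH[of 0 acc] True by (simp add: binary.simps)
    next
      case False
      then obtain m' where "m' \<le> m div 2"
        "(s ^^ k) (m div 2, odd m # acc) = (m', rev (take k (binary (m div 2))) @ odd m # acc)"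
        "m div 2 \<le> k \<longrightarrow> m' = 0"
        using Suc.IH[of "m div 2" "odd m # acc"] by blast
      moreover have "(s ^^ Suc k) (m, acc) = (s ^^ k) (m div 2, odd m # acc)"
        using False by (simp add: funpow_Suc_right s_def del: funpow.simps)
      ultimately show ?thesis
        using False by (intro exI[of _ m']) (simp add: binary.simps[of m] del: funpow.simps)
    qed
  qed simp
  have full: "snd ((s ^^ n) (n, [])) = rev (binary n)" for n
    using pow[of n n "[]"] length_binary_le[of n] by auto
  have "fp (\<lambda>n::nat. (s ^^ n) (n, []))"
  proof (rule fp_iterate[where h = "\<lambda>n. 1 + sz n + (1 + sz n * 4)"])
    fix n k :: nat
    assume k: "k \<le> n"
    obtain m' where m': "m' \<le> n" "(s ^^ k) (n, []) = (m', rev (take k (binary n)))"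
      using pow[of n k "[]"] by auto
    have "sz (take k (binary n)) \<le> 1 + length (take k (binary n)) * (3 + 1)"
      by (intro sz_list_le) (auto intro: sz_bool)
    also have "\<dots> \<le> 1 + sz n * 4" using k by simp
    finally show "sz ((s ^^ k) (n, [])) \<le> 1 + sz n + (1 + sz n * 4)"
      unfolding m'(2) using m'(1) by simp
  qed (auto intro!: fp_intros pb_intros poly_bounded_nat[OF fp_id] simp: s_def)
  from fp_rev[OF fp_snd[OF this]] have "fp binary" unfolding full by simp
  then show ?thesis using assms by (rule fp_comp)
qed

lemma fp_halving:
  assumes "fp n" "fp m"
  shows "fp (\<lambda>x. ((\<lambda>j. j div 2) ^^ n x) (m x :: nat))"
proof -
  have le: "((\<lambda>j. j div 2) ^^ k) j \<le> j" for j k :: nat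
    by (induction k) (auto intro: le_trans[OF div_le_dividend])
  show ?thesis
    by (rule fp_iterate[where h = "\<lambda>x. sz (m x)"])
      (auto intro!: fp_intros pb_intros assms poly_bounded_nat[OF assms(2)] simp: le)
qed

subsection \<open>Finite tables\<close>

primrec left :: "tree \<Rightarrow> tree" where
  "left Lf = Lf" | "left (Nd l r) = l"

primrec right :: "tree \<Rightarrow> tree" where
  "right Lf = Lf" | "right (Nd l r) = r"

lemma fp_left: "fp left"
proof (rule fpI[of PFst])
  show "peval PFst (code v) = code (left v)" for v by (cases v) (auto simp: code_tree_def)
qed (simp add: poly_bounded_tsize)

lemma fp_right: "fp right"
proof (rule fpI[of PSnd])
  show "peval PSnd (code v) = code (right v)" for v by (cases v) (auto simp: code_tree_def)
qed (simp add: poly_bounded_tsize)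

lemma fp_eq_Lf: "fp (\<lambda>v. v = Lf)"
proof -
  have "fp (\<lambda>v::tree. v \<noteq> Lf)"
  proof (rule fpI[of "PIf PId (PPair PLf PLf) PLf"])
    show "poly_bounded (\<lambda>v::tree. cost (PIf PId (PPair PLf PLf) PLf) (code v))"
      by (rule poly_bounded_mono[of "\<lambda>v. 10 * tsize (code v) + 10"]) (intro pb_intros, simp)
  qed (auto simp: code_tree_def code_bool_def)
  from fp_not[OF this] show ?thesis by simp
qed

lemma fp_eq_tree: "fp (\<lambda>v. v = (t::tree))"
proof (induction t)
  case (Nd l r)
  have "fp (\<lambda>v. v \<noteq> Lf \<and> left v = l \<and> right v = r)"
    by (intro fp_intros fp_eq_Lf fp_comp[OF Nd.IH(1) fp_left] fp_comp[OF Nd.IH(2) fp_right])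
  then show ?case
  proof (rule fp_cong)
    show "(v = Nd l r) = (v \<noteq> Lf \<and> left v = l \<and> right v = r)" for v by (cases v) auto
  qed
qed (rule fp_eq_Lf)

lemma fp_eq_const [fp_intros]:
  assumes "fp f"
  shows "fp (\<lambda>x. f x = c)"
  using fp_comp[OF fp_eq_tree fp_code[OF assms], of "code c"] by simp

text \<open>On a finite set any function is a nested case distinction. This covers both the
  transition function of a machine and the optima of bounded instances.\<close>

lemma fp_finite_table:
  fixes f :: "'a::codable \<Rightarrow> 'b::codable"
  assumes "finite A"
  shows "\<exists>g. fp g \<and> (\<forall>x\<in>A. g x = f x)"
  using assms
proof (induction A rule: finite_induct)
  case empty
  show ?case using fp_const by blast
next
  case (insert a A)
  then obtain g where g: "fp g" "\<forall>x\<in>A. g x = f x" by blast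
  have "fp (\<lambda>x. if x = a then f a else g x)" by (intro fp_intros g)
  then show ?case using g by (intro exI[of _ "\<lambda>x. if x = a then f a else g x"]) auto
qed

section \<open>Simulation of Turing machines\<close>

text \<open>A tape is represented by the log of all writes, latest first, and the head position; cell
  \<open>i\<close> is stored under the key \<open>i + t\<close>, where \<open>t\<close> is the number of steps to simulate.\<close>

type_synonym log_tape = "(nat \<times> nat) list \<times> nat"

definition look :: "(nat \<times> nat) list \<Rightarrow> nat \<Rightarrow> nat" where
  "look lg i = foldr (\<lambda>e r. if fst e = i then snd e else r) lg 0"

lemma look_simps [simp]: "look [] i = 0" "look (e # lg) i = (if fst e = i then snd e else look lg i)"
  by (auto simp: look_def)

lemma look_eq: "(i, a) \<in> set lg \<Longrightarrow> (\<And>b. (i, b) \<in> set lg \<Longrightarrow> b = a) \<Longrightarrow> look lg i = a"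
  by (induction lg) fastforce+

lemma look_eq_0: "(\<And>b. (i, b) \<notin> set lg) \<Longrightarrow> look lg i = 0"
  by (induction lg) fastforce+

lemma fp_look [fp_intros]:
  assumes "fp l" "fp n"
  shows "fp (\<lambda>x. look (l x) (n x))"
  unfolding look_def
  by (rule fp_foldr[where h = "\<lambda>p. sz (snd p)"])
    (auto intro!: fp_intros pb_intros assms fp_comp[OF assms(2)] intro: trans_le_add2)

definition log_scan :: "log_tape \<Rightarrow> nat" where
  "log_scan tp = look (fst tp) (snd tp)"

text \<open>A move is stored as 0, 1 or 2 to make it a natural number; the \<open>- 1\<close> undoes
  the shift.\<close>

definition log_act :: "log_tape \<times> nat \<times> nat \<Rightarrow> log_tape" where
  "log_act p = ((snd (fst p), fst (snd p)) # fst (fst p), snd (fst p) + snd (snd p) - 1)"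

definition log_step :: "(nat \<times> nat list \<Rightarrow> nat \<times> (nat \<times> nat) list) \<Rightarrow> nat \<times> log_tape list \<Rightarrow> nat \<times> log_tape list" where
  "log_step g c = (if fst c = 1 then c
     else (fst (g (fst c, map (\<lambda>tp. log_scan tp) (snd c))),
       map (\<lambda>p. log_act p) (zip (snd c) (snd (g (fst c, map (\<lambda>tp. log_scan tp) (snd c)))))))"

definition log_init :: "nat \<Rightarrow> bool list \<times> nat \<Rightarrow> nat \<times> log_tape list" where
  "log_init k p = (0, (map (\<lambda>e. (snd p + fst e, if snd e then 2 else 1)) (zip [0..<length (fst p)] (fst p)), snd p) #
     replicate (k - 1) ([], snd p))"

text \<open>Within \<open>t\<close> steps no cell beyond \<open>n + t\<close> carries a nonblank
  symbol, so the output lies among the cells read here.\<close>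

definition log_output :: "nat \<Rightarrow> nat \<Rightarrow> log_tape \<Rightarrow> bool list" where
  "log_output n t tp = map (\<lambda>a. a = 2) (takeWhile (\<lambda>a. a \<noteq> 0)
     (map (\<lambda>i. look (fst tp) (t + i)) [0..<n + t + 1]))"

definition represents :: "nat \<Rightarrow> log_tape \<Rightarrow> tape \<Rightarrow> bool" where
  "represents t l tp \<longleftrightarrow> snd tp = int (snd l) - int t \<and> (\<forall>i. fst tp (int i - int t) = look (fst l) i)"

text \<open>Beyond correctness, it bounds the head position, the length of the log and its entries.
  These bounds keep the simulated configurations polynomial in \<open>n\<close> and
  \<open>t\<close>, as iteration requires.\<close>

definition tape_inv :: "nat \<Rightarrow> nat \<Rightarrow> nat \<Rightarrow> nat \<Rightarrow> log_tape \<Rightarrow> tape \<Rightarrow> bool" where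
  "tape_inv S n t k l tp \<longleftrightarrow> represents t l tp \<and> (\<forall>i. fst tp i < S) \<and>
     t \<le> snd l + k \<and> snd l \<le> t + k \<and> length (fst l) \<le> n + k \<and>
     (\<forall>e\<in>set (fst l). fst e \<le> 2 * t + n \<and> snd e < S)"

definition conf_inv :: "tm \<Rightarrow> nat \<Rightarrow> nat \<Rightarrow> nat \<Rightarrow> nat \<times> log_tape list \<Rightarrow> tm_config \<Rightarrow> bool" where
  "conf_inv M n t k c d \<longleftrightarrow> fst c = fst d \<and> fst c < states M \<and> length (snd d) = tapes M \<and>
     list_all2 (tape_inv (symbols M) n t k) (snd c) (snd d)"

lemma scan_represents: "represents t l tp \<Longrightarrow> scan tp = log_scan l"
  by (simp add: represents_def scan_def log_scan_def)

text \<open>\<open>k < t\<close> guarantees \<open>1 \<le> snd l\<close>, so the truncated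
  subtraction in \<open>log_act\<close> is exact even for a move to the left.\<close>

lemma tape_inv_act:
  assumes "tape_inv S n t k l tp" "k < t" "a < S" "d \<in> {-1, 0, 1}"
  shows "tape_inv S n t (Suc k) (log_act (l, a, nat (d + 1))) (act tp (a, d))"
proof -
  have r: "represents t l tp" and l: "t \<le> snd l + k" "snd l \<le> t + k"
    using assms by (auto simp: tape_inv_def)
  have "represents t (log_act (l, a, nat (d + 1))) (act tp (a, d))"
    using r l assms(2,4) by (auto simp: represents_def log_act_def act_def)
  then show ?thesis
    using assms by (auto simp: tape_inv_def log_act_def act_def)
qed

lemma tape_inv_mono: "tape_inv S n t k l tp \<Longrightarrow> tape_inv S n t (Suc k) l tp"
  by (auto simp: tape_inv_def)

lemma conf_inv_init:
  assumes "turing_machine M"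
  shows "conf_inv M (length x) t 0 (log_init (tapes M) (x, t)) (tm_init M x)"
proof -
  let ?lg = "map (\<lambda>e. (t + fst e, if snd e then 2 else 1)) (zip [0..<length x] x) :: (nat \<times> nat) list"
  have set: "set ?lg = {(t + i, bit_symbol (x ! i)) | i. i < length x}"
    by (force simp: set_zip bit_symbol_def)
  have S: "symbols M \<ge> 3" "tapes M \<ge> 2" "states M \<ge> 2" using assms by (auto simp: turing_machine_def)
  have "fst (input_tape x) (int i - int t) = look ?lg i" for i
  proof (cases "t \<le> i \<and> i < t + length x")
    case True
    then have "look ?lg i = bit_symbol (x ! (i - t))"
      by (intro look_eq; unfold set) (auto intro!: exI[of _ "i - t"])
    moreover have "nat (int i - int t) = i - t" by simp
    ultimately show ?thesis using True by (auto simp: input_tape_def)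
  next
    case False
    then have "look ?lg i = 0" by (intro look_eq_0; unfold set) auto
    then show ?thesis using False by (auto simp: input_tape_def)
  qed
  then have "tape_inv (symbols M) (length x) t 0 (?lg, t) (input_tape x)"
    using S unfolding tape_inv_def represents_def fst_conv snd_conv set
    by (auto simp: input_tape_def bit_symbol_def)
  moreover have "tape_inv (symbols M) (length x) t 0 ([], t) (\<lambda>_. 0, 0)"
    using S by (auto simp: tape_inv_def represents_def)
  ultimately show ?thesis
    using S by (auto simp: conf_inv_def log_init_def tm_init_def list_all2_conv_all_nth nth_Cons split: nat.splits)
qed

lemma conf_inv_step:
  assumes M: "turing_machine M" and inv: "conf_inv M n t k c d" and k: "k < t"
    and g: "\<And>q ss. q < states M \<Longrightarrow> length ss = tapes M \<Longrightarrow> set ss \<subseteq> {..<symbols M} \<Longrightarrow>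
      g (q, ss) = (fst (delta M q ss), map (\<lambda>a. (fst a, nat (snd a + 1))) (snd (delta M q ss)))"
  shows "conf_inv M n t (Suc k) (log_step g c) (tm_step M d)"
proof (cases "fst c = 1")
  case True
  then show ?thesis
    using inv tape_inv_mono by (cases d) (auto simp: conf_inv_def log_step_def tm_step_def elim: list_all2_mono)
next
  case False
  obtain q ts where d: "d = (q, ts)" by (cases d)
  obtain ls where c: "c = (q, ls)" using inv d by (cases c) (auto simp: conf_inv_def)
  have lt: "length ts = tapes M" "length ls = tapes M" "q < states M"
    and la: "\<And>j. j < tapes M \<Longrightarrow> tape_inv (symbols M) n t k (ls ! j) (ts ! j)"
    using inv by (auto simp: conf_inv_def c d list_all2_conv_all_nth)
  have "scan (ts ! j) = log_scan (ls ! j)" if "j < tapes M" for j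
    using la[OF that] scan_represents unfolding tape_inv_def by blast
  then have sc: "map scan ts = map (\<lambda>tp. log_scan tp) ls"
    using lt by (intro nth_equalityI) auto
  have ss: "set (map scan ts) \<subseteq> {..<symbols M}" "length (map scan ts) = tapes M"
  proof -
    have "scan (ts ! j) < symbols M" if "j < tapes M" for j
      using la[OF that] by (simp add: tape_inv_def scan_def)
    then show "set (map scan ts) \<subseteq> {..<symbols M}" "length (map scan ts) = tapes M"
      using lt unfolding set_map in_set_conv_nth image_subset_iff by (metis in_set_conv_nth lessThan_iff, simp)
  qed
  obtain q' as where D: "delta M q (map scan ts) = (q', as)" by (cases "delta M q (map scan ts)")
  have D': "q' < states M" "length as = tapes M" "set as \<subseteq> {..<symbols M} \<times> {-1, 0, 1}"
  proof -
    have "case delta M q (map scan ts) of (q', as) \<Rightarrow> q' < states M \<and> length as = tapes M \<and>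
        set as \<subseteq> {..<symbols M} \<times> {-1, 0, 1}"
      by (rule M[unfolded turing_machine_def, THEN conjunct2, THEN conjunct2, THEN conjunct2,
            rule_format, OF lt(3) ss(2,1)])
    then show "q' < states M" "length as = tapes M" "set as \<subseteq> {..<symbols M} \<times> {-1, 0, 1}"
      by (simp_all add: D)
  qed
  have gv: "g (q, map (\<lambda>tp. log_scan tp) ls) = (q', map (\<lambda>a. (fst a, nat (snd a + 1))) as)"
    using g[OF lt(3) ss(2,1)] D unfolding sc by simp
  have "tape_inv (symbols M) n t (Suc k) (log_act (ls ! j, fst (as ! j), nat (snd (as ! j) + 1))) (act (ts ! j) (as ! j))"
    if "j < tapes M" for j
  proof -
    have "as ! j \<in> {..<symbols M} \<times> {-1, 0, 1}" using D'(2,3) that nth_mem[of j as] by (metis subsetD)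
    then show ?thesis
      using tape_inv_act[OF la[OF that] k, of "fst (as ! j)" "snd (as ! j)"] by (auto simp: mem_Times_iff)
  qed
  then show ?thesis
    using False lt D' by (simp add: c d conf_inv_def log_step_def tm_step_def D gv list_all2_conv_all_nth)
qed

lemma log_output_correct:
  assumes "tape_inv S n t t l tp" "tape_output tp y"
  shows "log_output n t l = y"
proof -
  let ?xs = "map (\<lambda>i. look (fst l) (t + i)) [0..<n + t + 1]"
  have cell: "look (fst l) (t + i) = fst tp (int i)" for i
    using assms(1) unfolding tape_inv_def represents_def by (metis add_diff_cancel_left' of_nat_add)
  have y: "fst tp (int i) = bit_symbol (y ! i)" if "i < length y" for i
    using assms(2) that by (auto simp: tape_output_def)
  have "length y \<le> n + t + 1"
  proof (rule ccontr)
    assume "\<not> length y \<le> n + t + 1"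
    then have "look (fst l) (t + (n + t + 1)) \<noteq> 0"
      using y[of "n + t + 1"] cell[of "n + t + 1"] by (simp add: bit_symbol_def)
    then obtain b where "(t + (n + t + 1), b) \<in> set (fst l)"
      using look_eq_0[of "t + (n + t + 1)" "fst l"] by auto
    then show False using assms(1) by (fastforce simp: tape_inv_def)
  qed
  moreover have "takeWhile (\<lambda>a. a \<noteq> 0) ?xs = take (length y) ?xs"
  proof (rule takeWhile_eq_take_P_nth)
    show "?xs ! i \<noteq> 0" if "i < length y" "i < length ?xs" for i
      using that cell[of i] y[of i] by (simp add: bit_symbol_def del: upt_Suc)
    show "\<not> ?xs ! length y \<noteq> 0" if "length y < length ?xs"
      using that cell[of "length y"] assms(2) by (simp add: tape_output_def del: upt_Suc)
  qed
  ultimately show ?thesis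
    unfolding log_output_def
    by (intro nth_equalityI) (auto simp: cell y bit_symbol_def simp del: upt_Suc)
qed

lemma fp_log_step:
  assumes "fp g"
  shows "fp (log_step g)"
  unfolding log_step_def[abs_def] log_scan_def log_act_def
  by (intro fp_intros fp_comp[OF assms])

lemma fp_log_init: "fp (log_init k)"
  unfolding log_init_def[abs_def] by (intro fp_intros)

lemma fp_log_output: "fp (\<lambda>x. log_output (fst x) (fst (snd x)) (snd (snd x)))"
  unfolding log_output_def[abs_def] by (intro fp_intros)

lemma sz_conf_le:
  assumes "conf_inv M n t k c d" "k \<le> t"
  shows "sz c \<le> 1 + (2 * states M + 1) + (1 + tapes M * (1 + (1 + (n + t) * (1 + (2 * (2 * t + n) + 1) + (2 * symbols M + 1) + 1)) + (2 * (t + t) + 1) + 1))"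
    (is "_ \<le> _ + (1 + tapes M * (?b + 1))")
proof -
  have "sz l \<le> ?b" if l: "tape_inv (symbols M) n t k l tp" for l tp
  proof -
    have "sz (fst l) \<le> 1 + length (fst l) * (1 + (2 * (2 * t + n) + 1) + (2 * symbols M + 1) + 1)"
      using l by (intro sz_list_le) (fastforce simp: tape_inv_def split: prod.splits)
    also have "\<dots> \<le> 1 + (n + t) * (1 + (2 * (2 * t + n) + 1) + (2 * symbols M + 1) + 1)"
      using l assms(2) by (intro add_mono mult_mono) (auto simp: tape_inv_def)
    finally show ?thesis
      using l assms(2) by (cases l) (auto simp: tape_inv_def)
  qed
  moreover have "\<exists>tp. tape_inv (symbols M) n t k l tp" if "l \<in> set (snd c)" for l
    using assms(1) that unfolding conf_inv_def list_all2_conv_all_nth in_set_conv_nth by metis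
  ultimately have "\<forall>l\<in>set (snd c). sz l \<le> ?b" by blast
  from sz_list_le[OF this] have "sz (snd c) \<le> 1 + tapes M * (?b + 1)"
    using assms(1) by (auto simp: conf_inv_def dest: list_all2_lengthD)
  then show ?thesis using assms(1) by (cases c) (auto simp: conf_inv_def)
qed

text \<open>The number of steps is an argument of the simulator, given in unary. A machine with any
  computable time bound can so be absorbed, including the reduction and the approximation
  algorithm.\<close>

theorem turing_machine_fp:
  assumes "turing_machine M"
  shows "\<exists>R. fp R \<and> (\<forall>x y t. computes_in M x y t \<longrightarrow> R (x, t) = y)"
proof -
  let ?A = "{..<states M} \<times> {ss. set ss \<subseteq> {..<symbols M} \<and> length ss = tapes M}"
  have "finite ?A" by (simp add: finite_lists_length_eq)
  \<comment> \<open>\<open>delta\<close> is an arbitrary HOL function, but a run consults it only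
    for states and symbols of the machine, which are finite in number.\<close>
  from fp_finite_table[OF this, of "\<lambda>p. (fst (delta M (fst p) (snd p)), map (\<lambda>a. (fst a, nat (snd a + 1))) (snd (delta M (fst p) (snd p))))"]
  obtain g where g: "fp g" "\<And>q ss. q < states M \<Longrightarrow> length ss = tapes M \<Longrightarrow> set ss \<subseteq> {..<symbols M} \<Longrightarrow>
      g (q, ss) = (fst (delta M q ss), map (\<lambda>a. (fst a, nat (snd a + 1))) (snd (delta M q ss)))"
    by auto
  have inv: "conf_inv M (length x) t k ((log_step g ^^ k) (log_init (tapes M) (x, t))) ((tm_step M ^^ k) (tm_init M x))"
    if "k \<le> t" for x t k
    using that
  proof (induction k)
    case 0
    then show ?case using conf_inv_init[OF assms] by simp
  next
    case (Suc k)
    then show ?case using conf_inv_step[OF assms Suc.IH _ g(2)] by simp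
  qed
  define B where "B p = 1 + (2 * states M + 1) + (1 + tapes M * (1 + (1 + (length (fst p) + snd p) * (1 + (2 * (2 * snd p + length (fst p)) + 1) + (2 * symbols M + 1) + 1)) + (2 * (snd p + snd p) + 1) + 1))"
    for p :: "bool list \<times> nat"
  have "fp B" unfolding B_def by (intro fp_intros)
  then have "poly_bounded B" by (rule poly_bounded_nat)
  then have run: "fp (\<lambda>p. (log_step g ^^ snd p) (log_init (tapes M) p))"
  proof (rule fp_iterate[rotated 3])
    show "fp (\<lambda>p. log_step g (snd p))" by (intro fp_comp[OF fp_log_step[OF g(1)]] fp_intros)
    show "fp (log_init (tapes M))" by (rule fp_log_init)
    show "fp (\<lambda>p :: bool list \<times> nat. snd p)" by (intro fp_intros)
    show "sz ((log_step g ^^ k) (log_init (tapes M) p)) \<le> B p" if "k \<le> snd p" for p k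
      using sz_conf_le[OF inv[OF that] that, of "fst p"] by (simp add: B_def)
  qed
  define R where "R p = log_output (length (fst p)) (snd p) (hd (rev (snd ((log_step g ^^ snd p) (log_init (tapes M) p)))))" for p
  have "fp R"
    unfolding R_def
    by (rule fp_comp[OF fp_log_output, of "\<lambda>p. (length (fst p), snd p, hd (rev (snd ((log_step g ^^ snd p) (log_init (tapes M) p)))))", simplified])
      (intro fp_intros run)
  moreover have "R (x, t) = y" if "computes_in M x y t" for x y t
  proof -
    obtain c where c: "c = (log_step g ^^ t) (log_init (tapes M) (x, t))" by simp
    obtain d where d: "d = (tm_step M ^^ t) (tm_init M x)" by simp
    have i: "conf_inv M (length x) t t c d" using inv[of t t x] c d by simp
    then have ne: "snd c \<noteq> []" "snd d \<noteq> []"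
      using assms by (auto simp: conf_inv_def turing_machine_def dest: list_all2_lengthD)
    have "list_all2 (tape_inv (symbols M) (length x) t t) (snd c) (snd d)" using i by (simp add: conf_inv_def)
    then have "tape_inv (symbols M) (length x) t t (last (snd c)) (last (snd d))"
      using ne by (metis last_conv_nth list_all2_lengthD list_all2_nthD diff_less length_greater_0_conv zero_less_one)
    moreover have "tape_output (last (snd d)) y"
      using that unfolding computes_in_def d by (auto split: prod.splits)
    ultimately have "log_output (length x) t (last (snd c)) = y" by (rule log_output_correct)
    then show ?thesis using ne by (simp add: R_def c hd_rev)
  qed
  ultimately show ?thesis by blast
qed

section \<open>Deciding languages in quasi-polynomial time\<close>

text \<open>List codes nest to the right, so the bits are pushed from last to first, starting from
  the leaf for the empty list. Each bit is topped by the 2 that marks its list node.\<close>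

definition read_input :: cmd where
  "read_input = Seq (While 0 (\<lambda>a. a \<noteq> 0) (Act 0 (\<lambda>a. a) 1)) (Seq (Act 0 (\<lambda>a. a) (-1)) (Seq (push 1 1)
     (While 0 (\<lambda>a. a \<noteq> 0) (Seq
        (Cond 0 (\<lambda>a. a = 2) (Seq (push 1 1) (Seq (push 1 1) (push 1 2))) (push 1 1))
        (Seq (push 1 2) (Act 0 (\<lambda>a. a) (-1)))))))"

definition write_output :: cmd where
  "write_output = Cond 1 (\<lambda>a. a = 2) (Act 5 (\<lambda>_. 2) 0) (Act 5 (\<lambda>_. 1) 0)"

abbreviation input_at :: "bool list \<Rightarrow> int \<Rightarrow> tape" where
  "input_at x i \<equiv> (fst (input_tape x), i)"

lemma scan_input_at:
  "scan (input_at x i) = (if 0 \<le> i \<and> i < int (length x) then bit_symbol (x ! nat i) else 0)"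
  by (simp add: scan_def input_tape_def)

lemma exec_move_input:
  "exec (Act 0 (\<lambda>a. a) d) (stack_conf (input_at x i) s) 1 (stack_conf (input_at x (i + d)) s)"
  using exec_Act[of 0 "stack_conf (input_at x i) s" "\<lambda>a. a" d]
  by (cases s) (simp add: act_def scan_def)

lemma exec_scan_right:
  "j \<le> length x \<Longrightarrow> exec (While 0 (\<lambda>a. a \<noteq> 0) (Act 0 (\<lambda>a. a) 1)) (stack_conf (input_at x (int (length x) - int j)) s)
     (2 * j + 1) (stack_conf (input_at x (int (length x))) s)"
proof (induction j)
  case 0
  show ?case by (cases s) (auto intro!: exec_mono[OF exec_While_False] simp: scan_input_at)
next
  case (Suc j)
  have "exec (While 0 (\<lambda>a. a \<noteq> 0) (Act 0 (\<lambda>a. a) 1)) (stack_conf (input_at x (int (length x) - int (Suc j))) s)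
     (Suc (1 + (2 * j + 1))) (stack_conf (input_at x (int (length x))) s)"
  proof (rule exec_While_True)
    show "exec (Act 0 (\<lambda>a. a) 1) (stack_conf (input_at x (int (length x) - int (Suc j))) s) 1
        (stack_conf (input_at x (int (length x) - int j)) s)"
      using exec_move_input[of 1 x "int (length x) - int (Suc j)" s] by simp
    show "scan (stack_conf (input_at x (int (length x) - int (Suc j))) s ! 0) \<noteq> 0"
      using Suc.prems by (cases s) (auto simp: scan_input_at bit_symbol_def)
  qed (use Suc in auto)
  then show ?case by simp
qed

lemma runs_push_bit:
  "runs (Seq (push 1 1) (Seq (push 1 1) (push 1 2))) (main a) 11 (main (word (code True) @ a))"
  "runs (push 1 1) (main a) 11 (main (word (code False) @ a))"
proof -
  have "runs (Seq (push 1 1) (push 1 2)) (main (1 # a)) (3 + 4) (main (2 # 1 # 1 # a))"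
    using runs_Seq_push[of 1 "push 1 2" 1 "main (1 # a)" 3] runs_push[of 1 2 "main (1 # 1 # a)"] by simp
  then have "runs (Seq (push 1 1) (Seq (push 1 1) (push 1 2))) (main a) (3 + 4 + 4) (main (2 # 1 # 1 # a))"
    using runs_Seq_push[of 1 "Seq (push 1 1) (push 1 2)" 1 "main a" "3 + 4"] by simp
  then show "runs (Seq (push 1 1) (Seq (push 1 1) (push 1 2))) (main a) 11 (main (word (code True) @ a))"
    by (simp add: code_bool_def)
  show "runs (push 1 1) (main a) 11 (main (word (code False) @ a))"
    using runs_mono[OF runs_push[of 1 1 "main a"]] by (simp add: code_bool_def)
qed

lemma exec_scan_left:
  assumes "j \<le> length x"
  shows "exec (While 0 (\<lambda>a. a \<noteq> 0) (Seq
        (Cond 0 (\<lambda>a. a = 2) (Seq (push 1 1) (Seq (push 1 1) (push 1 2))) (push 1 1))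
        (Seq (push 1 2) (Act 0 (\<lambda>a. a) (-1)))))
     (stack_conf (input_at x (int j - 1)) (main (word (code (drop j x))))) (30 * j + 1)
     (stack_conf (input_at x (-1)) (main (word (code x))))"
  (is "exec (While 0 ?b ?c) _ _ _")
  using assms
proof (induction j)
  case 0
  show ?case by (auto intro!: exec_mono[OF exec_While_False] simp: scan_input_at)
next
  case (Suc j)
  let ?tp = "input_at x (int j)" and ?a = "word (code (drop (Suc j) x))"
  have sc: "scan ?tp = bit_symbol (x ! j)" using Suc.prems by (simp add: scan_input_at)
  have d: "drop j x = x ! j # drop (Suc j) x" using Suc.prems by (simp add: Cons_nth_drop_Suc)
  have 1: "exec (Cond 0 (\<lambda>a. a = 2) (Seq (push 1 1) (Seq (push 1 1) (push 1 2))) (push 1 1))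
      (stack_conf ?tp (main ?a)) (Suc 11) (stack_conf ?tp (main (word (code (x ! j)) @ ?a)))"
    by (rule exec_Cond; cases "x ! j")
      (use sc runs_exec[OF runs_push_bit(1)] runs_exec[OF runs_push_bit(2)] in \<open>auto simp: bit_symbol_def simp del: stack_conf.simps\<close>, auto)
  have "runs (push 1 2) (main (word (code (x ! j)) @ ?a)) 3 (main (word (code (drop j x))))"
    using runs_push[of 1 2 "main (word (code (x ! j)) @ ?a)"] by (simp add: d)
  from exec_Seq[OF runs_exec[OF this] exec_move_input[of "-1"], of x "int j"]
  have 2: "exec (Seq (push 1 2) (Act 0 (\<lambda>a. a) (-1))) (stack_conf ?tp (main (word (code (x ! j)) @ ?a)))
      (Suc (3 + 1)) (stack_conf (input_at x (int j - 1)) (main (word (code (drop j x)))))"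
    by simp
  have "exec (While 0 ?b ?c) (stack_conf ?tp (main ?a)) (Suc (Suc (Suc 11 + Suc (3 + 1)) + (30 * j + 1)))
     (stack_conf (input_at x (-1)) (main (word (code x))))"
    by (rule exec_While_True[OF _ _ exec_Seq[OF 1 2]])
      (use Suc sc in \<open>auto simp: bit_symbol_def\<close>)
  then show ?case by (simp del: stack_conf.simps) (erule exec_mono, simp)
qed

lemma exec_read_input:
  "exec read_input (stack_conf (input_tape x) (main [])) (40 * length x + 40)
     (stack_conf (input_at x (-1)) (main (word (code x))))"
proof -
  have "input_at x (int (length x) - int (length x)) = input_tape x" by (simp add: input_tape_def)
  then have 1: "exec (While 0 (\<lambda>a. a \<noteq> 0) (Act 0 (\<lambda>a. a) 1)) (stack_conf (input_tape x) (main []))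
      (2 * length x + 1) (stack_conf (input_at x (int (length x))) (main []))"
    using exec_scan_right[of "length x" x "main []"] by (simp del: stack_conf.simps)
  have "runs (push 1 1) (main []) 3 (main (word (code ([]::bool list))))"
    using runs_push[of 1 1 "main []"] by simp
  note 3 = runs_exec[OF this]
  have 4: "exec (While 0 (\<lambda>a. a \<noteq> 0) (Seq
        (Cond 0 (\<lambda>a. a = 2) (Seq (push 1 1) (Seq (push 1 1) (push 1 2))) (push 1 1))
        (Seq (push 1 2) (Act 0 (\<lambda>a. a) (-1)))))
     (stack_conf (input_at x (int (length x) + -1)) (main (word (code ([]::bool list))))) (30 * length x + 1)
     (stack_conf (input_at x (-1)) (main (word (code x))))"
    using exec_scan_left[of "length x" x] by (simp del: stack_conf.simps code_list.simps)
  show ?thesis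
    unfolding read_input_def
    by (rule exec_mono[OF exec_Seq[OF 1 exec_Seq[OF exec_move_input exec_Seq[OF 3 4]]]]) simp
qed

lemma tm_step_halted: "(tm_step M ^^ t) c = (1, ts) \<Longrightarrow> t \<le> n \<Longrightarrow> (tm_step M ^^ n) c = (1, ts)"
proof -
  assume a: "(tm_step M ^^ t) c = (1, ts)" "t \<le> n"
  have "(tm_step M ^^ k) (1, ts) = (1, ts)" for k by (induction k) (auto simp: tm_step_def)
  then have "(tm_step M ^^ (n - t + t)) c = (1, ts)" using a(1) by (simp only: funpow_add o_apply)
  then show ?thesis using a(2) by simp
qed

text \<open>The answer stands for every \<open>n\<close> above the actual running time, as required
  for a time bound that depends on the input length alone.\<close>

theorem decision_machine:
  "\<exists>M k. turing_machine M \<and> (\<forall>x b n. peval p (code (x::bool list)) = code b \<longrightarrow>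
     k * (length x + cost p (code x)) \<le> n \<longrightarrow> computes_in M x [b] n)"
proof -
  let ?c = "Seq read_input (Seq (compile p) write_output)"
  have "well_formed 6 3 ?c"
    using well_formed_compile[of p] by (simp add: read_input_def write_output_def push_def)
  from cmd_turing_machine[OF this] obtain M where M: "turing_machine M" "tapes M = 6"
    "\<And>ts t ts'. length ts = 6 \<Longrightarrow> (cmd_step ^^ t) ([?c], ts) = ([], ts') \<Longrightarrow> (tm_step M ^^ t) (0, ts) = (1, ts')"
    by auto
  obtain k where k: "implements p k" using implements_exists by blast
  have "computes_in M x [b] n" if e: "peval p (code x) = code b" and n: "(k + 100) * (length x + cost p (code x)) \<le> n"
    for x :: "bool list" and b :: bool and n
  proof -
    let ?tp = "input_at x (-1)"
    let ?out = "act (stack_tape []) (bit_symbol b, 0)"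
    let ?a = "word (code b)"
    have "exec write_output (stack_conf ?tp (main ?a)) (Suc 1) ((stack_conf ?tp (main ?a))[5 := ?out])"
      unfolding write_output_def
      by (rule exec_Cond)
        (use exec_Act[of 5 "stack_conf ?tp (main ?a)" "\<lambda>_. 2" 0] exec_Act[of 5 "stack_conf ?tp (main ?a)" "\<lambda>_. 1" 0]
         in \<open>auto simp: bit_symbol_def code_bool_def numeral_eq_Suc\<close>)
    moreover have "exec (compile p) (stack_conf ?tp (main (word (code x)))) (k * cost p (code x)) (stack_conf ?tp (main ?a))"
      using runs_exec[OF implementsD[OF k, of "code x" "[]"]] e by (simp del: stack_conf.simps)
    ultimately have "exec ?c (stack_conf (input_tape x) (main []))
        (Suc (40 * length x + 40 + Suc (k * cost p (code x) + Suc 1))) ((stack_conf ?tp (main ?a))[5 := ?out])"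
      by (intro exec_Seq[OF exec_read_input] exec_Seq)
    then obtain t where t: "t \<le> Suc (40 * length x + 40 + Suc (k * cost p (code x) + Suc 1))"
      "(cmd_step ^^ t) ([?c], stack_conf (input_tape x) (main [])) = ([], (stack_conf ?tp (main ?a))[5 := ?out])"
      unfolding exec_def by blast
    have "Suc (40 * length x + 40 + Suc (k * cost p (code x) + Suc 1)) \<le> (k + 100) * (length x + cost p (code x))"
      using cost_pos[of p "code x"] by (simp add: algebra_simps)
    then have le: "t \<le> n" using t(1) n by linarith
    have init: "tm_init M x = (0, stack_conf (input_tape x) (main []))"
      by (simp add: tm_init_def M stack_tape_Nil numeral_eq_Suc)
    have "(tm_step M ^^ t) (tm_init M x) = (1, (stack_conf ?tp (main ?a))[5 := ?out])"
      unfolding init by (rule M(3)[OF _ t(2)]) simp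
    from tm_step_halted[OF this le]
    have "(tm_step M ^^ n) (tm_init M x) = (1, (stack_conf ?tp (main ?a))[5 := ?out])" .
    moreover have "tape_output ?out [b]"
      by (auto simp: tape_output_def stack_tape_Nil act_def)
    ultimately show ?thesis by (simp add: computes_in_def numeral_eq_Suc)
  qed
  then show ?thesis using M(1) by blast
qed

lemma poly_time_computable_fp:
  assumes "poly_time_computable f"
  shows "fp f"
proof -
  obtain M k where M: "turing_machine M" "\<And>x. computes_in M x (f x) (length x ^ k + k)"
    using assms unfolding poly_time_computable_def by blast
  obtain R where R: "fp R" "\<And>x y t. computes_in M x y t \<Longrightarrow> R (x, t) = y"
    using turing_machine_fp[OF M(1)] by blast
  have "fp (\<lambda>x. R (x, length x ^ k + k))"
    by (intro fp_comp[OF R(1)] fp_intros)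
  then show ?thesis by (rule fp_cong) (use R(2)[OF M(2)] in simp)
qed

text \<open>With \<open>L = log 2 n\<close>, the base of the power is at most
  \<open>2 powr ((6 + B) * L ^ (a + 1))\<close>. Constants and the exponent \<open>K\<close> are
  absorbed by one more factor \<open>L\<close>, and \<open>2 powr (L * L ^ (a + 1))\<close> is
  \<open>n powr (L ^ (a + 1))\<close>.\<close>

lemma quasi_poly_bound:
  fixes a k K :: nat
  shows "(\<lambda>n. real (k * (n + (4 * n + 2 * 2 ^ nat \<lfloor>real a * log 2 (real n + 2) ^ a\<rfloor> + 8) ^ K)))
    \<in> O(\<lambda>n. real n powr (log 2 (real n) ^ (a + 1)))"
proof (rule bigoI)
  define B where "B = real a * 2 ^ a"
  \<comment> \<open>Chosen so that \<open>L\<close> exceeds \<open>(K + 1) * (6 + B)\<close> from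
    \<open>N\<close> on.\<close>
  define N where "N = nat \<lceil>2 powr (real (K + 1) * (6 + B))\<rceil> + 4"
  show "\<forall>\<^sub>F n in sequentially. norm (real (k * (n + (4 * n + 2 * 2 ^ nat \<lfloor>real a * log 2 (real n + 2) ^ a\<rfloor> + 8) ^ K)))
      \<le> (2 * real k) * norm (real n powr (log 2 (real n) ^ (a + 1)))"
    unfolding eventually_sequentially
  proof (intro exI[of _ N] allI impI)
    fix n
    assume n: "n \<ge> N"
    define L where "L = log 2 (real n)"
    define z where "z = (2::nat) ^ nat \<lfloor>real a * log 2 (real n + 2) ^ a\<rfloor>"
    define S where "S = 4 * n + 2 * z + 8"
    have n4: "n \<ge> 4" using n by (simp add: N_def)
    have nL: "real n = 2 powr L" using n4 by (simp add: L_def)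
    have "2 powr (real (K + 1) * (6 + B)) \<le> real n"
      using n unfolding N_def by linarith
    then have big: "real (K + 1) * (6 + B) \<le> L" by (simp add: nL)
    have L2: "L \<ge> 2" using n4 unfolding L_def by (simp add: le_log_iff)
    have "log 2 (real n + 2) \<le> log 2 (2 * real n)" using n4 by simp
    also have "\<dots> = 1 + L" using n4 by (simp add: log_mult L_def)
    also have "\<dots> \<le> 2 * L" using L2 by simp
    finally have l: "log 2 (real n + 2) \<le> 2 * L" .
    have l0: "0 \<le> log 2 (real n + 2)" using n4 by simp
    have "real (nat \<lfloor>real a * log 2 (real n + 2) ^ a\<rfloor>) \<le> real a * log 2 (real n + 2) ^ a"
      using l0 by (simp add: of_nat_nat)
    also have "\<dots> \<le> real a * (2 * L) ^ a"
      using l l0 by (intro mult_left_mono power_mono) auto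
    also have "\<dots> = B * L ^ a" by (simp add: B_def power_mult_distrib)
    finally have "real z \<le> 2 powr (B * L ^ a)"
      by (simp add: z_def powr_realpow[symmetric])
    have z1: "z \<ge> 1" by (simp add: z_def)
    have "z \<le> n * z" "n \<le> n * z" "2 \<le> n * z" using n4 z1 mult_le_mono[of 2 n 1 z] by auto
    then have "S \<le> 16 * (n * z)" unfolding S_def by linarith
    then have "real S \<le> 16 * (real n * real z)" by (metis of_nat_le_iff of_nat_mult of_nat_numeral)
    also have "\<dots> \<le> 2 powr 4 * (2 powr L * 2 powr (B * L ^ a))"
      using \<open>real z \<le> _\<close> by (simp add: nL mult_left_mono)
    also have "\<dots> = 2 powr (4 + L + B * L ^ a)" by (simp add: powr_add)
    also have "\<dots> \<le> 2 powr ((6 + B) * L ^ (a + 1))"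
    proof -
      have "1 \<le> L ^ a" using L2 by simp
      then have "L \<le> L ^ (a + 1)" "L ^ a \<le> L ^ (a + 1)" "2 \<le> L ^ (a + 1)"
        using L2 mult_mono[of 1 "L ^ a" L L] mult_mono[of 1 L "L ^ a" "L ^ a"] mult_mono[of 2 L 1 "L ^ a"] by auto
      moreover have "0 \<le> B" by (simp add: B_def)
      ultimately have "4 + L + B * L ^ a \<le> 2 * L ^ (a + 1) + L ^ (a + 1) + B * L ^ (a + 1)"
        by (intro add_mono mult_left_mono) auto
      also have "\<dots> \<le> (6 + B) * L ^ (a + 1)" using \<open>2 \<le> L ^ (a + 1)\<close> by (simp add: algebra_simps)
      finally show ?thesis by simp
    qed
    finally have "real S \<le> 2 powr ((6 + B) * L ^ (a + 1))" .
    then have "real S ^ (K + 1) \<le> (2 powr ((6 + B) * L ^ (a + 1))) ^ (K + 1)" by (intro power_mono) auto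
    also have "\<dots> = 2 powr (real (K + 1) * (6 + B) * L ^ (a + 1))"
    proof -
      have "(2 powr y) ^ m = 2 powr (real m * y)" for y :: real and m
        by (induction m) (auto simp: powr_add algebra_simps)
      then show ?thesis by (simp only: mult.assoc)
    qed
    also have "\<dots> \<le> 2 powr (L * L ^ (a + 1))"
      using big L2 by (intro powr_mono mult_right_mono) auto
    also have "\<dots> = real n powr (L ^ (a + 1))" by (simp add: nL powr_powr)
    finally have S: "real S ^ (K + 1) \<le> real n powr (L ^ (a + 1))" .
    have "n \<le> S" "1 \<le> S" by (auto simp: S_def)
    then have "S \<le> S ^ (K + 1)" "S ^ K \<le> S ^ (K + 1)" by auto
    with \<open>n \<le> S\<close> have "n + S ^ K \<le> 2 * S ^ (K + 1)" by linarith
    then have "k * (n + S ^ K) \<le> k * (2 * S ^ (K + 1))" by (rule mult_le_mono2)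
    then have "real (k * (n + S ^ K)) \<le> real (k * (2 * S ^ (K + 1)))" by (simp only: of_nat_le_iff)
    also have "\<dots> = 2 * real k * real S ^ (K + 1)" by simp
    also have "\<dots> \<le> 2 * real k * (real n powr (L ^ (a + 1)))" using S by (intro mult_left_mono) auto
    finally show "norm (real (k * (n + (4 * n + 2 * 2 ^ nat \<lfloor>real a * log 2 (real n + 2) ^ a\<rfloor> + 8) ^ K)))
      \<le> (2 * real k) * norm (real n powr (log 2 (real n) ^ (a + 1)))"
      unfolding S_def z_def L_def by simp
  qed
qed

text \<open>The only superpolynomial step is the computation of the tally \<open>2 ^ F x\<close> by repeated doubling;
  everything else is polynomial in its size.\<close>

theorem quasi_poly_time_tally:
  fixes F :: "bool list \<Rightarrow> nat" and G :: "bool list \<times> nat \<Rightarrow> bool"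
  assumes F: "fp F" and G: "fp G"
    and bound: "\<And>x. real (F x) \<le> real a * log 2 (real (length x) + 2) ^ a"
  shows "{x. G (x, 2 ^ F x)} \<in> quasi_poly_time"
proof -
  obtain pF where pF: "\<And>x. peval pF (code x) = code (F x)" "poly_bounded (\<lambda>x::bool list. cost pF (code x))"
    using F by (rule fpE) blast
  obtain pG where pG: "\<And>x. peval pG (code x) = code (G x)" "poly_bounded (\<lambda>x::bool list \<times> nat. cost pG (code x))"
    using G by (rule fpE) blast
  obtain p1 where p1: "\<And>x::bool list. peval p1 (code x) = code (1::nat)" "poly_bounded (\<lambda>x::bool list. cost p1 (code x))"
    using fp_const by (rule fpE) blast
  obtain pd where pd: "\<And>n::nat. peval pd (code n) = code (n + n)" "poly_bounded (\<lambda>n::nat. cost pd (code n))"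
    using fp_add[OF fp_id fp_id] by (rule fpE) blast
  obtain k1 k2 k3 k4 where
    k1: "\<And>x::bool list. cost pF (code x) \<le> (sz x + 2) ^ k1" and
    k2: "\<And>x::bool list \<times> nat. cost pG (code x) \<le> (sz x + 2) ^ k2" and
    k3: "\<And>x::bool list. cost p1 (code x) \<le> (sz x + 2) ^ k3" and
    k4: "\<And>n::nat. cost pd (code n) \<le> (sz n + 2) ^ k4"
    using pF(2) pG(2) p1(2) pd(2) unfolding poly_bounded_def by blast
  \<comment> \<open>The iterated doubling violates the size bound that \<open>fp\<close> asks for,
    so this program is assembled by hand and its cost estimated in terms of the size of the pair
    \<open>(x, 2 ^ F x)\<close>.\<close>
  define p where "p = PComp pG (PPair PId (PComp (PIter pd) (PPair pF p1)))"
  have pow: "((\<lambda>n. n + n) ^^ k) (1::nat) = 2 ^ k" for k by (induction k) auto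
  have it: "iter_eval (peval pd) (code (F x)) (code (1::nat)) = code (2 ^ F x :: nat)" for x
  proof -
    have "iter_eval (peval pd) (code (F x)) (code (1::nat)) = code (((\<lambda>n. n + n) ^^ spine (code (F x))) (1::nat))"
      by (rule iter_eval_spine) (rule pd(1))
    then show ?thesis by (simp only: pow spine_code_nat)
  qed
  have ev: "peval p (code x) = code (G (x, 2 ^ F x))" for x
    unfolding p_def using pG(1)[of "(x, 2 ^ F x)"] by (simp add: pF p1 it[simplified] code_prod_def)
  define Q where "Q X = 20 * sz X + 20 + (sz X + 2) ^ k1 + (sz X + 2) ^ k3 + (sz X + 2) ^ k2 +
      (1 + sz X * (sz X + 2 * sz X + (sz X + 2) ^ k4))" for X :: "bool list \<times> nat"
  have "poly_bounded Q" unfolding Q_def by (intro pb_intros)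
  then obtain K where K: "\<And>X. Q X \<le> (sz X + 2) ^ K" unfolding poly_bounded_def by blast
  have costp: "cost p (code x) \<le> (4 * length x + 2 * 2 ^ F x + 8) ^ K" for x
  proof -
    let ?X = "(x, 2 ^ F x :: nat)"
    have szX: "sz ?X = 2 + sz x + 2 * 2 ^ F x" by simp
    have Fle: "F x \<le> 2 ^ F x" by (simp add: less_imp_le)
    have "sz x \<le> 1 + length x * (3 + 1)" by (intro sz_list_le) (auto intro: sz_bool)
    then have le: "sz ?X + 2 \<le> 4 * length x + 2 * 2 ^ F x + 8" unfolding szX by simp
    have "iter_cost (peval pd) (cost pd) (code (F x)) (code (1::nat)) \<le>
        1 + spine (code (F x)) * (sz ?X + 2 * sz ?X + (sz ?X + 2) ^ k4)"
    proof (rule iter_cost_le[where s = "\<lambda>n. n + n"])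
      fix k
      assume "k \<le> spine (code (F x))"
      then have "(2::nat) ^ k \<le> 2 ^ F x" by simp
      then have le: "sz (((\<lambda>n. n + n) ^^ k) (1::nat)) \<le> sz ?X" unfolding pow szX by (simp only: sz_nat)
      then show "sz (((\<lambda>n. n + n) ^^ k) (1::nat)) \<le> sz ?X" .
      show "cost pd (code (((\<lambda>n. n + n) ^^ k) (1::nat))) \<le> (sz ?X + 2) ^ k4"
        by (rule order_trans[OF k4 power_mono]) (use le in linarith)+
    next
      show "tsize (code (F x)) \<le> sz ?X" unfolding szX sz_def[symmetric] sz_nat using Fle by linarith
    qed (rule pd(1))
    also have "\<dots> \<le> 1 + sz ?X * (sz ?X + 2 * sz ?X + (sz ?X + 2) ^ k4)"
    proof -
      have "F x \<le> sz ?X" unfolding szX using Fle by linarith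
      then show ?thesis unfolding spine_code_nat by (intro add_mono mult_mono) auto
    qed
    finally have ic: "iter_cost (peval pd) (cost pd) (code (F x)) (code (1::nat)) \<le>
      1 + sz ?X * (sz ?X + 2 * sz ?X + (sz ?X + 2) ^ k4)" .
    have c1: "cost pF (code x) \<le> (sz ?X + 2) ^ k1"
      by (rule order_trans[OF k1 power_mono]) (auto simp: szX)
    have c3: "cost p1 (code x) \<le> (sz ?X + 2) ^ k3"
      by (rule order_trans[OF k3 power_mono]) (auto simp: szX)
    have "cost p (code x) = tsize (code x) + 1 + (tsize (code x) + cost pF (code x) + cost p1 (code x) + tsize (code (F x)) + tsize (code (1::nat)) +
        (1 + tsize (code (F x)) + tsize (code (1::nat)) + iter_cost (peval pd) (cost pd) (code (F x)) (code (1::nat)))) +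
        tsize (code x) + tsize (code (2 ^ F x :: nat)) + cost pG (code ?X)"
      unfolding p_def by (simp add: pF(1) p1(1) it del: One_nat_def) (simp add: code_prod_def)
    also have "\<dots> \<le> Q ?X"
    proof -
      have "sz x \<le> sz ?X" "sz (F x) \<le> sz ?X" "sz (2 ^ F x :: nat) \<le> sz ?X" "sz (1::nat) = 3"
        unfolding szX sz_nat using Fle by linarith+
      then show ?thesis unfolding sz_def[symmetric] Q_def using ic c1 c3 k2[of ?X] by linarith
    qed
    also have "\<dots> \<le> (sz ?X + 2) ^ K" by (rule K)
    also have "\<dots> \<le> (4 * length x + 2 * 2 ^ F x + 8) ^ K" by (rule power_mono[OF le]) simp
    finally show ?thesis .
  qed
  obtain M k where M: "turing_machine M" "\<And>x b n. peval p (code (x::bool list)) = code b \<Longrightarrow>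
     k * (length x + cost p (code x)) \<le> n \<Longrightarrow> computes_in M x [b] n"
    using decision_machine[of p] by blast
  define t where "t n = k * (n + (4 * n + 2 * 2 ^ nat \<lfloor>real a * log 2 (real n + 2) ^ a\<rfloor> + 8) ^ K)" for n
  have "computes_in M x [x \<in> {x. G (x, 2 ^ F x)}] (t (length x))" for x
  proof -
    have "F x \<le> nat \<lfloor>real a * log 2 (real (length x) + 2) ^ a\<rfloor>"
      using bound[of x] by (simp add: le_nat_floor)
    then have "(2::nat) ^ F x \<le> 2 ^ nat \<lfloor>real a * log 2 (real (length x) + 2) ^ a\<rfloor>" by simp
    then have "(4 * length x + 2 * 2 ^ F x + 8) ^ K
        \<le> (4 * length x + 2 * 2 ^ nat \<lfloor>real a * log 2 (real (length x) + 2) ^ a\<rfloor> + 8) ^ K"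
      by (intro power_mono) auto
    then have "k * (length x + cost p (code x)) \<le> t (length x)"
      unfolding t_def using costp[of x] by (intro mult_le_mono2 add_mono) auto
    then show ?thesis using M(2)[OF ev] by simp
  qed
  moreover have "(\<lambda>n. real (t n)) \<in> O(\<lambda>n. real n powr (log 2 (real n) ^ (a + 1)))"
    unfolding t_def by (rule quasi_poly_bound)
  ultimately have "{x. G (x, 2 ^ F x)} \<in> DTIME (\<lambda>n. real n powr (log 2 (real n) ^ (a + 1)))"
    unfolding DTIME_def using M(1) by blast
  then show ?thesis unfolding quasi_poly_time_def by blast
qed

section \<open>From UMPS to related machines\<close>

text \<open>Hall's condition for intervals suffices: schedule earliest deadline first.\<close>

lemma interval_scheduling:
  fixes r d :: "'a \<Rightarrow> nat"
  assumes "finite A" "\<And>a b. card {j\<in>A. a \<le> r j \<and> d j \<le> b} \<le> b - a"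
  shows "\<exists>\<sigma>. inj_on \<sigma> A \<and> (\<forall>j\<in>A. r j \<le> \<sigma> j \<and> \<sigma> j < d j)"
  using assms
proof (induction "card A" arbitrary: A r)
  case 0
  then show ?case by auto
next
  case (Suc n)
  then have fin: "finite A" and ne: "A \<noteq> {}" by auto
  define \<rho> where "\<rho> = Min (r ` A)"
  have \<rho>: "\<rho> \<le> r j" if "j \<in> A" for j using fin that by (simp add: \<rho>_def)
  define E where "E = {j\<in>A. r j = \<rho>}"
  have "\<rho> \<in> r ` A" unfolding \<rho>_def using fin ne by (intro Min_in) auto
  then have "E \<noteq> {}" "finite E" using fin by (auto simp: E_def)
  then obtain j0 where j0: "j0 \<in> E" "\<And>j. j \<in> E \<Longrightarrow> d j0 \<le> d j"
    using ex_min_if_finite[of "d ` E"] by (metis (no_types, lifting) arg_min_if_finite(1) arg_min_least)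
  have j0A: "j0 \<in> A" "r j0 = \<rho>" using j0 by (auto simp: E_def)
  \<comment> \<open>The first usable slot \<open>\<rho>\<close> goes to the job \<open>j0\<close>
    with the least deadline among those released at \<open>\<rho>\<close>; all others wait for the
    next slot.\<close>
  define r' where "r' j = max (r j) (\<rho> + 1)" for j
  let ?A = "A - {j0}"
  have le: "card {j\<in>?A. a \<le> r' j \<and> d j \<le> b} \<le> b - a" for a b
  proof (cases "a \<le> \<rho> + 1")
    case True
    then have "a \<le> r' j" for j by (simp add: r'_def le_max_iff_disj)
    then have "card {j\<in>?A. a \<le> r' j \<and> d j \<le> b} = card {j\<in>?A. d j \<le> b}" by simp
    \<comment> \<open>If \<open>j0\<close> is counted for \<open>b\<close>, its removal makes up for
      the lost slot. Otherwise \<open>b < d j0\<close>, and by minimality of \<open>d j0\<close>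
      every job that counts is released after \<open>\<rho>\<close>.\<close>
    also have "\<dots> \<le> b - (\<rho> + 1)"
    proof (cases "d j0 \<le> b")
      case True
      then have "{j\<in>A. \<rho> \<le> r j \<and> d j \<le> b} = insert j0 {j\<in>?A. d j \<le> b}" using \<rho> j0A by auto
      then have "card {j\<in>A. \<rho> \<le> r j \<and> d j \<le> b} = Suc (card {j\<in>?A. d j \<le> b})" using fin by simp
      then show ?thesis using Suc.prems(2)[of \<rho> b] by linarith
    next
      case False
      then have "{j\<in>?A. d j \<le> b} = {j\<in>A. \<rho> + 1 \<le> r j \<and> d j \<le> b}"
        using \<rho> j0 by (force simp: E_def Suc_le_eq le_less)
      then show ?thesis using Suc.prems(2)[of "\<rho> + 1" b] by simp
    qed
    also have "\<dots> \<le> b - a" using True by simp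
    finally show ?thesis .
  next
    case False
    then have "{j\<in>?A. a \<le> r' j \<and> d j \<le> b} \<subseteq> {j\<in>A. a \<le> r j \<and> d j \<le> b}" by (auto simp: r'_def)
    then have "card {j\<in>?A. a \<le> r' j \<and> d j \<le> b} \<le> card {j\<in>A. a \<le> r j \<and> d j \<le> b}"
      using fin by (intro card_mono) auto
    then show ?thesis using Suc.prems(2)[of a b] by linarith
  qed
  have "n = card ?A" using Suc.hyps(2) fin j0A by simp
  from Suc.hyps(1)[OF this _ le] obtain \<sigma> where
    \<sigma>: "inj_on \<sigma> ?A" "\<And>j. j \<in> ?A \<Longrightarrow> r' j \<le> \<sigma> j \<and> \<sigma> j < d j" using fin by auto
  have "\<rho> < d j0"
  proof (rule ccontr)
    assume "\<not> \<rho> < d j0"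
    then have "j0 \<in> {j\<in>A. \<rho> \<le> r j \<and> d j \<le> \<rho>}" using j0A by simp
    then have "card {j\<in>A. \<rho> \<le> r j \<and> d j \<le> \<rho>} > 0" using fin by (auto simp: card_gt_0_iff)
    then show False using Suc.prems(2)[of \<rho> \<rho>] by simp
  qed
  have gt: "\<rho> < \<sigma> j" "r j \<le> \<sigma> j" if "j \<in> ?A" for j using \<sigma>(2)[OF that] by (auto simp: r'_def)
  have "inj_on (\<sigma>(j0 := \<rho>)) A"
  proof (rule inj_onI)
    fix x y
    assume "x \<in> A" "y \<in> A" "(\<sigma>(j0 := \<rho>)) x = (\<sigma>(j0 := \<rho>)) y"
    then show "x = y"
      using gt(1)[of x] gt(1)[of y] inj_onD[OF \<sigma>(1), of x y] by (cases "x = j0"; cases "y = j0") auto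
  qed
  moreover have "r j \<le> (\<sigma>(j0 := \<rho>)) j \<and> (\<sigma>(j0 := \<rho>)) j < d j" if "j \<in> A" for j
    using \<open>\<rho> < d j0\<close> gt(2)[of j] \<sigma>(2)[of j] j0A that by auto
  ultimately show ?case by blast
qed

text \<open>Induction on the number of jobs: the one that starts last is removed, and all others end
  before it starts.\<close>

lemma card_disjoint_jobs:
  fixes start :: "'a \<Rightarrow> real"
  assumes "finite A" "l > 0" "a \<le> b" "\<And>u. u \<in> A \<Longrightarrow> a \<le> start u \<and> start u + l \<le> b"
    "\<And>u v. u \<in> A \<Longrightarrow> v \<in> A \<Longrightarrow> u \<noteq> v \<Longrightarrow> start u + l \<le> start v \<or> start v + l \<le> start u"
  shows "real (card A) * l \<le> b - a"
  using assms
proof (induction "card A" arbitrary: A b)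
  case 0
  then show ?case by simp
next
  case (Suc n)
  then have "A \<noteq> {}" by auto
  then have "Max (start ` A) \<in> start ` A" using Suc.prems(1) by (intro Max_in) auto
  then obtain u where u: "u \<in> A" "start u = Max (start ` A)" by auto
  then have max: "start v \<le> start u" if "v \<in> A" for v using Suc.prems(1) that by simp
  have "real (card (A - {u})) * l \<le> start u - a"
  proof (rule Suc.hyps(1))
    show "n = card (A - {u})" using Suc.hyps(2) Suc.prems(1) u(1) by simp
    show "a \<le> start v \<and> start v + l \<le> start u" if "v \<in> A - {u}" for v
      using Suc.prems(4)[of v] Suc.prems(5)[of u v] u(1) max[of v] that Suc.prems(2) by force
  qed (use Suc.prems(1,2,5) Suc.prems(4)[OF u(1)] in auto)
  moreover have "real (card A) = real (card (A - {u})) + 1"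
    using card.remove[OF Suc.prems(1) u(1)] by simp
  ultimately show ?case using Suc.prems(4)[OF u(1)] by (simp add: algebra_simps)
qed

text \<open>The strict bound is the point: all jobs end before \<open>b + 1\<close>, so the integer
  \<open>card A\<close> is less than \<open>b + 1 - a\<close>. This is why end times may later be
  rounded down.\<close>

lemma card_disjoint_unit_jobs:
  fixes start :: "'a \<Rightarrow> real" and a b :: nat
  assumes "finite A" "\<And>u. u \<in> A \<Longrightarrow> real a \<le> start u \<and> start u + 1 < real b + 1"
    "\<And>u v. u \<in> A \<Longrightarrow> v \<in> A \<Longrightarrow> u \<noteq> v \<Longrightarrow> start u + 1 \<le> start v \<or> start v + 1 \<le> start u"
  shows "card A \<le> b - a"
proof (cases "A = {}")
  case False
  define e where "e = Max ((\<lambda>u. start u + 1) ` A)"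
  have "e \<in> (\<lambda>u. start u + 1) ` A" unfolding e_def using False assms(1) by (intro Max_in) auto
  then have e: "e < real b + 1" "real a \<le> e" using assms(2) by force+
  have "real (card A) * 1 \<le> e - real a"
  proof (rule card_disjoint_jobs[OF assms(1)])
    show "real a \<le> start u \<and> start u + 1 \<le> e" if "u \<in> A" for u
      using assms(1) assms(2)[OF that] that by (simp add: e_def)
  qed (use assms(3) e in auto)
  then have "real (card A) < real b + 1 - real a" using e by linarith
  then show ?thesis by linarith
qed simp

section \<open>Machine groups, job bundles and the instance built from them\<close>

lemma card_nth_eq_replicate:
  "card {u. u < length (concat (map (\<lambda>i. replicate (c i) i) [0..<n])) \<and>
      concat (map (\<lambda>i. replicate (c i) i) [0..<n]) ! u = j} = (if j < n then c j else 0)"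
proof -
  have "length (filter (\<lambda>z. z = j) (concat (map (\<lambda>i. replicate (c i) i) [0..<n]))) = (if j < n then c j else 0)"
    by (induction n) (auto simp: less_Suc_eq)
  then show ?thesis by (simp add: length_filter_conv_card)
qed

lemma bdd_below_makespan: "bdd_below {makespan n dur start | start. P start}"
proof (rule bdd_belowI[of _ 0])
  fix x
  assume "x \<in> {makespan n dur start | start. P start}"
  then obtain start where "x = makespan n dur start" by blast
  then show "0 \<le> x" by (simp add: makespan_def)
qed

lemma makespan_le: "0 \<le> b \<Longrightarrow> (\<And>j. j < n \<Longrightarrow> start j + dur j \<le> b) \<Longrightarrow> makespan n dur start \<le> b"
  by (auto simp: makespan_def)

lemma le_makespan: "j < n \<Longrightarrow> start j + dur j \<le> makespan n dur start"
  by (simp add: makespan_def)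

text \<open>Entry \<open>r\<close> is the speed group of machine \<open>r\<close>. Likewise, entry
  \<open>u\<close> of \<open>owner_list\<close> is the UMPS job whose bundle contains job
  \<open>u\<close>.\<close>

definition group_list :: "nat \<Rightarrow> nat \<Rightarrow> nat list" where
  "group_list K m = concat (map (\<lambda>i. replicate (K ^ (2 * (m - i))) i) [0..<m])"

definition owner_list :: "nat \<Rightarrow> nat \<Rightarrow> nat list \<Rightarrow> nat list" where
  "owner_list K m ms = concat (map (\<lambda>j. replicate (K ^ (2 * (m - ms ! j))) j) [0..<length ms])"

definition q_of_umps :: "nat \<Rightarrow> nat \<Rightarrow> nat list \<Rightarrow> (nat \<times> nat) list \<Rightarrow> qprec" where
  "q_of_umps K m ms prec =
    \<lparr>q_speeds = map (\<lambda>i. K ^ i) (group_list K m),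
     q_procs = map (\<lambda>j. K ^ (ms ! j)) (owner_list K m ms),
     q_prec = filter (\<lambda>p. (owner_list K m ms ! fst p, owner_list K m ms ! snd p) \<in> set prec)
       (List.product [0..<length (owner_list K m ms)] [0..<length (owner_list K m ms)])\<rparr>"

text \<open>\<open>K\<close> is constrained only through the inequality of the counting argument.
  This permits a trivial choice where only facts on \<open>umps_opt\<close> are wanted, and a power
  of two for the reduction.\<close>

locale umps_to_q =
  fixes I :: umps and K :: nat
  assumes inst: "umps_instance I" and unit: "umps_unit I" and jobs: "0 < umps_jobs I"
    and K: "umps_machines I * umps_jobs I * umps_jobs I \<le> K"
begin

abbreviation "n \<equiv> umps_jobs I"
abbreviation "m \<equiv> umps_machines I"
abbreviation "mac j \<equiv> umps_machine_of I ! j"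
abbreviation "R \<equiv> set (umps_prec I)"
abbreviation "G \<equiv> group_list K m"
abbreviation "J \<equiv> owner_list K m (umps_machine_of I)"
abbreviation "Q \<equiv> q_of_umps K m (umps_machine_of I) (umps_prec I)"

definition "bundle j = {u. u < length J \<and> J ! u = j}"
definition "mgroup i = {r. r < length G \<and> G ! r = i}"

lemma mac_less: "j < n \<Longrightarrow> mac j < m"
  using inst by (auto simp: umps_instance_def umps_jobs_def)

lemma dur_unit: "j < n \<Longrightarrow> umps_dur I j = 1"
  using inst unit by (auto simp: umps_instance_def umps_unit_def umps_dur_def)

lemma order: "R \<subseteq> {..<n} \<times> {..<n}" "irrefl R" "trans R"
  using inst by (auto simp: umps_instance_def strict_order_on_def)

lemma m_pos: "0 < m" using mac_less[OF jobs] by simp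

lemma n_le_K: "n \<le> K" and K_pos: "0 < K"
proof -
  have "1 * 1 * n \<le> m * n * n" using jobs m_pos by (intro mult_mono) (auto simp: Suc_leI)
  then show "n \<le> K" using K by linarith
  then show "0 < K" using jobs by linarith
qed

lemma card_bundle: "j < n \<Longrightarrow> card (bundle j) = K ^ (2 * (m - mac j))"
  unfolding bundle_def owner_list_def card_nth_eq_replicate by (simp add: umps_jobs_def)

lemma card_group: "i < m \<Longrightarrow> card (mgroup i) = K ^ (2 * (m - i))"
  unfolding mgroup_def group_list_def card_nth_eq_replicate by simp

lemma finite_bundle: "finite (bundle j)" and finite_group: "finite (mgroup i)"
  by (simp_all add: bundle_def mgroup_def)

lemma bundle_nonempty: "j < n \<Longrightarrow> bundle j \<noteq> {}"
  using card_bundle[of j] K_pos by auto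

lemma J_less: "u < length J \<Longrightarrow> J ! u < n"
  using nth_mem[of u J] by (auto simp: owner_list_def umps_jobs_def simp del: nth_mem)

lemma G_less: "r < length G \<Longrightarrow> G ! r < m"
  using nth_mem[of r G] by (auto simp: group_list_def simp del: nth_mem)

lemma q_jobs_Q [simp]: "q_jobs Q = length J" and q_machines_Q [simp]: "q_machines Q = length G"
  by (simp_all add: q_jobs_def q_machines_def q_of_umps_def)

lemma q_prec_Q: "set (q_prec Q) = {(u, v). u < length J \<and> v < length J \<and> (J ! u, J ! v) \<in> R}"
  by (auto simp: q_of_umps_def)

lemma q_dur_Q: "u < length J \<Longrightarrow> mach u < length G \<Longrightarrow>
    q_dur Q mach u = real K ^ mac (J ! u) / real K ^ (G ! mach u)"
  by (simp add: q_dur_def q_of_umps_def)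

lemma length_G: "length G = (\<Sum>i<m. K ^ (2 * (m - i)))"
  by (simp add: group_list_def length_concat comp_def sum_list_sum_nth atLeast0LessThan)

lemma q_instance_Q: "q_instance Q"
proof -
  have "K ^ (2 * (m - 0)) \<le> length G"
    unfolding length_G using m_pos by (intro member_le_sum) auto
  moreover have "0 < K ^ (2 * (m - 0))" using K_pos by simp
  ultimately have "0 < length G" by linarith
  moreover have "strict_order_on (length J) (set (q_prec Q))"
    unfolding strict_order_on_def q_prec_Q using order(2,3) by (auto simp: irrefl_def trans_def)
  moreover have "\<forall>s\<in>set (q_speeds Q). 0 < s" "\<forall>p\<in>set (q_procs Q). 0 < p"
    using K_pos by (auto simp: q_of_umps_def)
  ultimately show ?thesis by (simp add: q_instance_def)
qed

text \<open>Ordering the jobs by the number of their predecessors, with ties broken by the index, is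
  a linear extension by transitivity. Running them one at a time in this order takes time
  \<open>n\<close>.\<close>

lemma umps_schedule_exists:
  "\<exists>start. feasible n R mac (umps_dur I) start \<and> makespan n (umps_dur I) start \<le> real n"
proof -
  define pre where "pre j = {i. (i, j) \<in> R}" for j
  have fin: "finite (pre j)" for j
    by (rule finite_subset[of _ "{..<n}"]) (use order(1) in \<open>auto simp: pre_def\<close>)
  have sub: "pre i \<subset> pre j" if "(i, j) \<in> R" for i j
    using that order(2,3) by (auto simp: pre_def irrefl_def trans_def)
  define key where "key j = card (pre j) * n + j" for j
  have key_less: "key i < key j" if "(i, j) \<in> R" for i j
  proof -
    have "i < n" using that order(1) by auto
    have "Suc (card (pre i)) \<le> card (pre j)" using psubset_card_mono[OF fin sub[OF that]] by simp
    then have "Suc (card (pre i)) * n \<le> card (pre j) * n" by (rule mult_le_mono1)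
    then show ?thesis using \<open>i < n\<close> by (simp add: key_def)
  qed
  have key_inj: "i = j" if "key i = key j" "i < n" "j < n" for i j
    using that by (metis add.commute key_def mod_less mod_mult_self1)
  define pos where "pos j = card {i. i < n \<and> key i < key j}" for j
  have pos_less: "pos i < pos j" if "key i < key j" "i < n" for i j
    unfolding pos_def by (rule psubset_card_mono) (use that in auto)
  have pos_bound: "pos j < n" if "j < n" for j
  proof -
    have "pos j < card {i. i < n}" unfolding pos_def by (rule psubset_card_mono) (use that in auto)
    then show ?thesis by simp
  qed
  have "feasible n R mac (umps_dur I) (\<lambda>j. real (pos j))"
    unfolding feasible_def
  proof (intro conjI allI impI ballI)
    fix p
    assume "p \<in> R"
    moreover obtain i j where "p = (i, j)" by (cases p)
    ultimately show "case p of (i, j) \<Rightarrow> real (pos i) + umps_dur I i \<le> real (pos j)"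
      using pos_less[OF key_less, of i j] order(1) by (auto simp: dur_unit)
  next
    fix i j
    assume "i < n" "j < n" "i \<noteq> j \<and> mac i = mac j"
    then have "pos i < pos j \<or> pos j < pos i"
      using key_inj[of i j] pos_less[of i j] pos_less[of j i] by (meson linorder_neqE_nat)
    then show "real (pos i) + umps_dur I i \<le> real (pos j) \<or> real (pos j) + umps_dur I j \<le> real (pos i)"
      using \<open>i < n\<close> \<open>j < n\<close> by (auto simp: dur_unit)
  qed simp
  moreover have "makespan n (umps_dur I) (\<lambda>j. real (pos j)) \<le> real n"
    by (rule makespan_le) (use pos_bound in \<open>force simp: dur_unit\<close>)+
  ultimately show ?thesis by blast
qed

lemma umps_opt_le: "feasible n R mac (umps_dur I) start \<Longrightarrow> umps_opt I \<le> makespan n (umps_dur I) start"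
  unfolding umps_opt_def by (rule cInf_lower[OF _ bdd_below_makespan]) blast

lemma umps_opt_le_jobs: "umps_opt I \<le> real n"
  using umps_schedule_exists umps_opt_le by force

lemma umps_opt_ge_1: "1 \<le> umps_opt I"
  unfolding umps_opt_def
proof (rule cInf_greatest)
  show "{makespan n (umps_dur I) start | start. feasible n R mac (umps_dur I) start} \<noteq> {}"
    using umps_schedule_exists by blast
  fix x
  assume "x \<in> {makespan n (umps_dur I) start | start. feasible n R mac (umps_dur I) start}"
  then obtain start where s: "x = makespan n (umps_dur I) start" "feasible n R mac (umps_dur I) start" by blast
  have "0 \<le> start 0" using s(2) jobs by (auto simp: feasible_def)
  then show "1 \<le> x" using le_makespan[OF jobs, of start "umps_dur I"] jobs s(1) by (simp add: dur_unit)
qed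

text \<open>A bundle and its own group have the same size, so the whole bundle starts at the time of
  its owner, one job per machine, and each job lasts exactly 1.\<close>

lemma q_schedule_of_umps:
  assumes "feasible n R mac (umps_dur I) start"
  shows "\<exists>mach start'. q_feasible Q mach start' \<and> q_makespan Q mach start' \<le> makespan n (umps_dur I) start"
proof -
  have "\<exists>f. bij_betw f (bundle j) (mgroup (mac j))" if "j < n" for j
    using that mac_less[OF that] by (intro finite_same_card_bij finite_bundle finite_group) (simp add: card_bundle card_group)
  then obtain f where f: "\<And>j. j < n \<Longrightarrow> bij_betw (f j) (bundle j) (mgroup (mac j))" by metis
  define mach where "mach u = f (J ! u) u" for u
  have mach: "mach u < length G" "G ! mach u = mac (J ! u)" if "u < length J" for u
  proof -
    have "u \<in> bundle (J ! u)" using that by (simp add: bundle_def)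
    then have "mach u \<in> mgroup (mac (J ! u))"
      using f[OF J_less[OF that]] unfolding mach_def by (meson bij_betwE)
    then show "mach u < length G" "G ! mach u = mac (J ! u)" by (auto simp: mgroup_def)
  qed
  have dur: "q_dur Q mach u = 1" if "u < length J" for u
    using mach[OF that] that K_pos by (simp add: q_dur_Q)
  have "feasible (length J) (set (q_prec Q)) mach (q_dur Q mach) (\<lambda>u. start (J ! u))"
    unfolding feasible_def
  proof (intro conjI allI impI ballI)
    fix u assume "u < length J"
    then show "0 \<le> start (J ! u)" using assms J_less by (auto simp: feasible_def)
  next
    fix p
    assume p: "p \<in> set (q_prec Q)"
    obtain u v where uv: "p = (u, v)" by (cases p)
    then have "u < length J" "(J ! u, J ! v) \<in> R" using p by (auto simp: q_prec_Q)
    then show "case p of (u, v) \<Rightarrow> start (J ! u) + q_dur Q mach u \<le> start (J ! v)"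
      using assms J_less uv by (auto simp: feasible_def dur dur_unit)
  next
    fix u v
    assume uv: "u < length J" "v < length J" "u \<noteq> v \<and> mach u = mach v"
    then have same: "mac (J ! u) = mac (J ! v)" using mach by metis
    have "J ! u \<noteq> J ! v"
    proof
      assume "J ! u = J ! v"
      then have "u \<in> bundle (J ! u)" "v \<in> bundle (J ! u)" "f (J ! u) u = f (J ! u) v"
        using uv by (auto simp: bundle_def mach_def)
      then show False using f[OF J_less[OF uv(1)]] uv(3) by (auto simp: bij_betw_def inj_on_def)
    qed
    then show "start (J ! u) + q_dur Q mach u \<le> start (J ! v) \<or> start (J ! v) + q_dur Q mach v \<le> start (J ! u)"
      using assms J_less[OF uv(1)] J_less[OF uv(2)] same uv by (auto simp: feasible_def dur dur_unit)
  qed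
  then have "q_feasible Q mach (\<lambda>u. start (J ! u))" using mach by (simp add: q_feasible_def)
  moreover have "q_makespan Q mach (\<lambda>u. start (J ! u)) \<le> makespan n (umps_dur I) start"
    unfolding q_makespan_def
  proof (rule makespan_le)
    show "0 \<le> makespan n (umps_dur I) start" by (simp add: makespan_def)
    show "start (J ! u) + q_dur Q mach u \<le> makespan n (umps_dur I) start" if "u < q_jobs Q" for u
      using that le_makespan[OF J_less, of u start "umps_dur I"] J_less[of u] by (simp add: dur dur_unit)
  qed
  ultimately show ?thesis by blast
qed

lemma q_opt_nonneg: "0 \<le> q_opt Q"
  unfolding q_opt_def
proof (rule cInf_greatest)
  show "{q_makespan Q mach start | mach start. q_feasible Q mach start} \<noteq> {}"
    using umps_schedule_exists q_schedule_of_umps by blast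
  fix x
  assume "x \<in> {q_makespan Q mach start | mach start. q_feasible Q mach start}"
  then obtain mach start where "x = q_makespan Q mach start" by blast
  then show "0 \<le> x" by (simp add: q_makespan_def makespan_def)
qed

lemma q_opt_le_umps_opt: "q_opt Q \<le> umps_opt I"
  unfolding umps_opt_def
proof (rule cInf_greatest)
  show "{makespan n (umps_dur I) start | start. feasible n R mac (umps_dur I) start} \<noteq> {}"
    using umps_schedule_exists by blast
  fix x
  assume "x \<in> {makespan n (umps_dur I) start | start. feasible n R mac (umps_dur I) start}"
  then obtain start where s: "x = makespan n (umps_dur I) start" "feasible n R mac (umps_dur I) start" by blast
  obtain mach start' where q: "q_feasible Q mach start'" "q_makespan Q mach start' \<le> x"
    using q_schedule_of_umps[OF s(2)] s(1) by blast
  have "q_opt Q \<le> q_makespan Q mach start'"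
    unfolding q_opt_def
  proof (rule cInf_lower)
    show "bdd_below {q_makespan Q mach start | mach start. q_feasible Q mach start}"
    proof (rule bdd_belowI[of _ 0])
      fix x
      assume "x \<in> {q_makespan Q mach start | mach start. q_feasible Q mach start}"
      then obtain mach start where "x = q_makespan Q mach start" by blast
      then show "0 \<le> x" by (simp add: q_makespan_def makespan_def)
    qed
  qed (use q(1) in blast)
  then show "q_opt Q \<le> x" using q(2) by linarith
qed

text \<open>If the makespan is below \<open>n\<close>, less than a fraction \<open>1 / n\<close> of each bundle runs outside its own group.
  Counting the unit slots of that group, at most \<open>b - a\<close> bundles of the group live inside \<open>[a, b + 1)\<close>,
  which is Hall's condition for the time windows of the bundles, rounded down to integers.\<close>

lemma umps_opt_le_q_makespan:
  assumes feas: "q_feasible Q mach start"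
  shows "umps_opt I \<le> q_makespan Q mach start"
proof (cases "real n \<le> q_makespan Q mach start")
  case True
  then show ?thesis using umps_opt_le_jobs by linarith
next
  case False
  define D where "D = q_makespan Q mach start"
  have D: "D < real n" using False by (simp add: D_def)
  define dur where "dur = q_dur Q mach"
  have mach: "mach u < length G" if "u < length J" for u
    using feas that by (auto simp: q_feasible_def)
  have start0: "0 \<le> start u" if "u < length J" for u
    using feas that by (auto simp: q_feasible_def feasible_def)
  have finish: "start u + dur u \<le> D" if "u < length J" for u
    using that le_makespan[of u "length J" start dur] by (simp add: D_def q_makespan_def dur_def)
  have prec: "start u + dur u \<le> start v" if "u < length J" "v < length J" "(J ! u, J ! v) \<in> R" for u v
    using feas that unfolding q_feasible_def feasible_def q_prec_Q dur_def by auto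
  have disj: "start u + dur u \<le> start v \<or> start v + dur v \<le> start u"
    if "u < length J" "v < length J" "u \<noteq> v" "mach u = mach v" for u v
    using feas that unfolding q_feasible_def feasible_def dur_def by auto
  have dur_eq: "dur u = real K ^ mac (J ! u) / real K ^ (G ! mach u)" if "u < length J" for u
    using q_dur_Q[OF that, of mach] mach[OF that] by (simp add: dur_def)
  have D0: "0 \<le> D" by (simp add: D_def q_makespan_def makespan_def)
  have K1: "1 \<le> real K" using K_pos by simp

  have not_slower: "mac (J ! u) \<le> G ! mach u" if u: "u < length J" for u
  proof (rule ccontr)
    assume "\<not> ?thesis"
    then have "real K ^ (G ! mach u) * real K \<le> real K ^ mac (J ! u)"
      using K1 power_increasing[of "Suc (G ! mach u)" "mac (J ! u)" "real K"] by (simp add: mult.commute)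
    then have "real K \<le> dur u" unfolding dur_eq[OF u] using K_pos by (simp add: pos_le_divide_eq mult.commute)
    then show False using finish[OF u] start0[OF u] D n_le_K by linarith
  qed

  define fast where "fast j = {u\<in>bundle j. mac j < G ! mach u}" for j
  define own where "own j = {u\<in>bundle j. G ! mach u = mac j}" for j
  have fin: "finite (fast j)" "finite (own j)" for j by (auto simp: fast_def own_def finite_bundle)
  have split: "card (bundle j) = card (own j) + card (fast j)" if "j < n" for j
  proof -
    have "bundle j = own j \<union> fast j"
      by (auto simp: own_def fast_def bundle_def dest: not_slower)
    moreover have "own j \<inter> fast j = {}" by (auto simp: own_def fast_def)
    ultimately show ?thesis using card_Un_disjoint[OF fin(2) fin(1)] by metis
  qed
  have few: "n * card (fast j) < K ^ (2 * (m - mac j))" if j: "j < n" for j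
  proof -
    let ?i = "mac j" and ?B = "K ^ (2 * (m - mac j))"
    \<comment> \<open>A job of the bundle takes time \<open>1 / K ^ (G ! r - ?i)\<close> on machine
      \<open>r\<close>, and all of them run within \<open>[0, D]\<close>.\<close>
    have on_machine: "real (card {u\<in>fast j. mach u = r}) \<le> D * real K ^ (G ! r - ?i)"
      if r: "r < length G" "?i < G ! r" for r
    proof -
      let ?l = "real K ^ ?i / real K ^ (G ! r)"
      have "real (card {u\<in>fast j. mach u = r}) * ?l \<le> D - 0"
      proof (rule card_disjoint_jobs)
        fix u
        assume "u \<in> {u\<in>fast j. mach u = r}"
        then have u: "u < length J" "dur u = ?l" using dur_eq by (auto simp: fast_def bundle_def)
        then show "0 \<le> start u \<and> start u + ?l \<le> D" using start0 finish[OF u(1)] by simp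
      next
        fix u v
        assume "u \<in> {u\<in>fast j. mach u = r}" "v \<in> {u\<in>fast j. mach u = r}" "u \<noteq> v"
        then show "start u + ?l \<le> start v \<or> start v + ?l \<le> start u"
          using disj[of u v] dur_eq by (auto simp: fast_def bundle_def)
      qed (use K_pos D0 fin in auto)
      moreover have "?l = 1 / real K ^ (G ! r - ?i)"
        using r(2) K_pos by (simp add: power_diff field_simps)
      ultimately show ?thesis using K_pos by (simp add: field_simps)
    qed
    \<comment> \<open>The exponents add up to \<open>2 * (m - g) + (g - ?i)\<close>, which is below
      \<open>2 * (m - ?i)\<close> because \<open>?i < g\<close>: a factor \<open>K\<close> is gained
      on every faster group.\<close>
    have on_group: "real (card {u\<in>fast j. G ! mach u = g}) * real K \<le> D * real ?B"
      if g: "g < m" "?i < g" for g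
    proof -
      have "{u\<in>fast j. G ! mach u = g} = (\<Union>r\<in>mgroup g. {u\<in>fast j. mach u = r})"
        using mach by (auto simp: mgroup_def fast_def bundle_def)
      then have "card {u\<in>fast j. G ! mach u = g} \<le> (\<Sum>r\<in>mgroup g. card {u\<in>fast j. mach u = r})"
        using card_UN_le[OF finite_group] by simp
      then have "real (card {u\<in>fast j. G ! mach u = g}) \<le> real (\<Sum>r\<in>mgroup g. card {u\<in>fast j. mach u = r})"
        by (simp only: of_nat_le_iff)
      also have "\<dots> = (\<Sum>r\<in>mgroup g. real (card {u\<in>fast j. mach u = r}))" by (rule of_nat_sum)
      also have "\<dots> \<le> (\<Sum>r\<in>mgroup g. D * real K ^ (g - ?i))"
        using on_machine g(2) by (intro sum_mono) (auto simp: mgroup_def)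
      also have "\<dots> = D * (real K ^ (2 * (m - g)) * real K ^ (g - ?i))"
        using card_group[OF g(1)] by simp
      also have "\<dots> = D * real K ^ (2 * (m - g) + (g - ?i))" by (simp add: power_add)
      finally have "real (card {u\<in>fast j. G ! mach u = g}) * real K \<le> D * real K ^ (2 * (m - g) + (g - ?i)) * real K"
        using K_pos by (intro mult_right_mono) auto
      also have "\<dots> = D * real K ^ Suc (2 * (m - g) + (g - ?i))" by simp
      also have "\<dots> \<le> D * real K ^ (2 * (m - ?i))"
        using g K1 D0 by (intro mult_left_mono power_increasing) auto
      finally show ?thesis by simp
    qed
    have "fast j = (\<Union>g\<in>{?i<..<m}. {u\<in>fast j. G ! mach u = g})"
      using mach G_less by (auto simp: fast_def bundle_def)
    then have "card (fast j) \<le> (\<Sum>g\<in>{?i<..<m}. card {u\<in>fast j. G ! mach u = g})"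
      using card_UN_le[of "{?i<..<m}" "\<lambda>g. {u\<in>fast j. G ! mach u = g}"] by simp
    then have "real (card (fast j)) \<le> real (\<Sum>g\<in>{?i<..<m}. card {u\<in>fast j. G ! mach u = g})"
      by (simp only: of_nat_le_iff)
    then have "real (card (fast j)) * real K \<le> (\<Sum>g\<in>{?i<..<m}. real (card {u\<in>fast j. G ! mach u = g})) * real K"
      unfolding of_nat_sum by (intro mult_right_mono) auto
    also have "\<dots> = (\<Sum>g\<in>{?i<..<m}. real (card {u\<in>fast j. G ! mach u = g}) * real K)" by (rule sum_distrib_right)
    also have "\<dots> \<le> (\<Sum>g\<in>{?i<..<m}. D * real ?B)" using on_group by (intro sum_mono) auto
    also have "\<dots> = real (card {?i<..<m}) * (D * real ?B)" by simp
    also have "\<dots> \<le> real m * (D * real ?B)"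
      using D0 by (intro mult_right_mono) auto
    finally have "real n * (real (card (fast j)) * real K) \<le> real n * (real m * (D * real ?B))"
      by (intro mult_left_mono) auto
    \<comment> \<open>One factor \<open>n\<close> comes from \<open>D < n\<close>, the other from
      the claim, and \<open>m\<close> from the number of groups. This product is the origin of the
      bound required of \<open>K\<close>.\<close>
    also have "\<dots> < real n * (real m * (real n * real ?B))"
      using jobs m_pos K_pos D by (intro mult_strict_left_mono mult_strict_right_mono) auto
    also have "\<dots> = real (m * n * n) * real ?B" by simp
    also have "\<dots> \<le> real K * real ?B" using K by (intro mult_right_mono) (simp_all only: of_nat_le_iff of_nat_0_le_iff)
    finally have "real (n * card (fast j)) * real K < real ?B * real K" by (simp add: mult_ac)
    then have "real (n * card (fast j)) < real ?B" using K_pos by simp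
    then show ?thesis by (simp only: of_nat_less_iff)
  qed

  define S where "S j = Min (start ` bundle j)" for j
  define E where "E j = Max ((\<lambda>u. start u + dur u) ` bundle j)" for j
  have S_le: "S j \<le> start u" and E_ge: "start u + dur u \<le> E j" if "u \<in> bundle j" for u j
    using that finite_bundle by (auto simp: S_def E_def)
  have S_in: "\<exists>u\<in>bundle j. S j = start u" and E_in: "\<exists>u\<in>bundle j. E j = start u + dur u" if "j < n" for j
  proof -
    have "S j \<in> start ` bundle j" unfolding S_def using bundle_nonempty[OF that] finite_bundle by (intro Min_in) auto
    then show "\<exists>u\<in>bundle j. S j = start u" by auto
    have "E j \<in> (\<lambda>u. start u + dur u) ` bundle j" unfolding E_def using bundle_nonempty[OF that] finite_bundle by (intro Max_in) auto
    then show "\<exists>u\<in>bundle j. E j = start u + dur u" by auto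
  qed
  have S0: "0 \<le> S j" if "j < n" for j using S_in[OF that] start0 by (auto simp: bundle_def)
  have E_le: "E j \<le> D" if "j < n" for j using E_in[OF that] finish by (auto simp: bundle_def)
  \<comment> \<open>Rounding down is monotone, so \<open>E i \<le> S j\<close> still gives
    \<open>d i \<le> r j\<close> and precedences survive. A unit slot that starts before
    \<open>d j\<close> at an integer time ends by \<open>E j\<close>, so the makespan does not
    grow.\<close>
  define r where "r j = nat \<lfloor>S j\<rfloor>" for j
  define d where "d j = nat \<lfloor>E j\<rfloor>" for j
  have own_unit: "dur u = 1" if "u \<in> own j" for u j
    using that dur_eq K_pos by (auto simp: own_def bundle_def)

  have hall: "card {j\<in>{j. j < n \<and> mac j = i}. a \<le> r j \<and> d j \<le> b} \<le> b - a" if i: "i < m" for i a b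
  proof -
    define X where "X = {j\<in>{j. j < n \<and> mac j = i}. a \<le> r j \<and> d j \<le> b}"
    let ?B = "K ^ (2 * (m - i))"
    have X: "j < n" "mac j = i" "a \<le> r j" "d j \<le> b" if "j \<in> X" for j using that by (auto simp: X_def)
    have finX: "finite X" by (simp add: X_def)
    have cX: "card X \<le> n" using card_mono[of "{..<n}" X] by (auto simp: X_def)
    \<comment> \<open>Jobs run on their own group have length 1 and lie in
      \<open>[a, b + 1)\<close>, so each of the \<open>?B\<close> machines of the group holds at
      most \<open>b - a\<close> of them.\<close>
    define W where "W = (\<Union>j\<in>X. own j)"
    have "W = (\<Union>q\<in>mgroup i. {u\<in>W. mach u = q})"
      using mach X(2) by (auto simp: W_def own_def bundle_def mgroup_def)
    then have "card W \<le> (\<Sum>q\<in>mgroup i. card {u\<in>W. mach u = q})"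
      using card_UN_le[OF finite_group[of i], of "\<lambda>q. {u\<in>W. mach u = q}"] by simp
    also have "\<dots> \<le> (\<Sum>q\<in>mgroup i. b - a)"
    proof (rule sum_mono)
      fix q
      show "card {u\<in>W. mach u = q} \<le> b - a"
      proof (rule card_disjoint_unit_jobs[where start = start])
        show "finite {u\<in>W. mach u = q}" using finX fin by (auto simp: W_def)
        fix u
        assume "u \<in> {u\<in>W. mach u = q}"
        then obtain j where j: "j \<in> X" "u \<in> own j" by (auto simp: W_def)
        then have u: "u \<in> bundle j" by (auto simp: own_def)
        have "real a \<le> real (r j)" using X(3)[OF j(1)] by simp
        also have "\<dots> \<le> S j" using S0[OF X(1)[OF j(1)]] by (simp add: r_def)
        also have "\<dots> \<le> start u" by (rule S_le[OF u])
        finally have 1: "real a \<le> start u" .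
        have "start u + 1 \<le> E j" using E_ge[OF u] own_unit[OF j(2)] by simp
        moreover have "E j < real (d j) + 1" unfolding d_def by linarith
        moreover have "real (d j) \<le> real b" using X(4)[OF j(1)] by simp
        ultimately show "real a \<le> start u \<and> start u + 1 < real b + 1" using 1 by linarith
      next
        fix u v
        assume uv: "u \<in> {u\<in>W. mach u = q}" "v \<in> {u\<in>W. mach u = q}" "u \<noteq> v"
        then have "dur u = 1" "dur v = 1" "u < length J" "v < length J"
          using own_unit by (auto simp: W_def own_def bundle_def)
        then show "start u + 1 \<le> start v \<or> start v + 1 \<le> start u" using disj[of u v] uv by simp
      qed
    qed
    also have "\<dots> = ?B * (b - a)" using card_group[OF i] by simp
    finally have upper: "card W \<le> ?B * (b - a)" .
    have "card W = (\<Sum>j\<in>X. card (own j))"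
      unfolding W_def by (rule card_UN_disjoint) (auto simp: finX fin own_def bundle_def)
    then have "card W + (\<Sum>j\<in>X. card (fast j)) = (\<Sum>j\<in>X. card (bundle j))"
      using split X(1) by (simp add: sum.distrib[symmetric])
    also have "\<dots> = card X * ?B" using X card_bundle by simp
    finally have total: "card X * ?B = card W + (\<Sum>j\<in>X. card (fast j))" by simp
    have "card X \<le> b - a"
    proof (cases "X = {}")
      case True
      then show ?thesis by simp
    next
      case False
      have "n * (\<Sum>j\<in>X. card (fast j)) = (\<Sum>j\<in>X. n * card (fast j))" by (rule sum_distrib_left)
      also have "\<dots> < (\<Sum>j\<in>X. ?B)"
        by (rule sum_strict_mono[OF finX False]) (use few X in auto)
      also have "\<dots> \<le> n * ?B" using cX by simp
      \<comment> \<open>All bundles of \<open>X\<close> together lose less than one bundle to faster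
        groups, so \<open>card X\<close> is less than \<open>b - a + 1\<close>.\<close>
      finally have "(\<Sum>j\<in>X. card (fast j)) < ?B" by simp
      then have "card X * ?B < ?B * (b - a) + ?B" using total upper by linarith
      also have "\<dots> = (b - a + 1) * ?B" by (simp add: algebra_simps)
      finally have "card X < b - a + 1" by (simp only: mult_less_cancel2)
      then show ?thesis by simp
    qed
    then show ?thesis unfolding X_def .
  qed
  have "\<exists>\<sigma>. inj_on \<sigma> {j. j < n \<and> mac j = i} \<and> (\<forall>j\<in>{j. j < n \<and> mac j = i}. r j \<le> \<sigma> j \<and> \<sigma> j < d j)" if "i < m" for i
    by (rule interval_scheduling) (use hall[OF that] in auto)
  then have "\<forall>i. \<exists>\<sigma>. i < m \<longrightarrow> inj_on \<sigma> {j. j < n \<and> mac j = i} \<and>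
      (\<forall>j\<in>{j. j < n \<and> mac j = i}. r j \<le> \<sigma> j \<and> \<sigma> j < d j)" by blast
  from choice[OF this] obtain \<sigma> where \<sigma>: "\<And>i. i < m \<Longrightarrow> inj_on (\<sigma> i) {j. j < n \<and> mac j = i}"
    "\<And>i j. i < m \<Longrightarrow> j < n \<Longrightarrow> mac j = i \<Longrightarrow> r j \<le> \<sigma> i j \<and> \<sigma> i j < d j" by auto
  define pos where "pos j = \<sigma> (mac j) j" for j
  have pos: "r j \<le> pos j" "pos j < d j" if "j < n" for j
    using \<sigma>(2)[OF mac_less[OF that] that] by (auto simp: pos_def)
  have "feasible n R mac (umps_dur I) (\<lambda>j. real (pos j))"
    unfolding feasible_def
  proof (intro conjI allI impI ballI)
    fix p
    assume "p \<in> R"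
    moreover obtain i j where p: "p = (i, j)" by (cases p)
    ultimately have ij: "(i, j) \<in> R" "i < n" "j < n" using order(1) by auto
    obtain u v where u: "u \<in> bundle i" "E i = start u + dur u" and v: "v \<in> bundle j" "S j = start v"
      using E_in[OF ij(2)] S_in[OF ij(3)] by blast
    have "E i \<le> S j" using prec[of u v] u v ij(1) by (auto simp: bundle_def)
    then have "d i \<le> r j" unfolding d_def r_def by (intro nat_mono floor_mono)
    then have "pos i < pos j" using pos[OF ij(2)] pos[OF ij(3)] by linarith
    then show "case p of (i, j) \<Rightarrow> real (pos i) + umps_dur I i \<le> real (pos j)"
      using p ij by (simp add: dur_unit)
  next
    fix i j
    assume ij: "i < n" "j < n" "i \<noteq> j \<and> mac i = mac j"
    then have "pos i \<noteq> pos j"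
      using inj_onD[OF \<sigma>(1)[OF mac_less[OF ij(1)]], of i j] by (auto simp: pos_def)
    then show "real (pos i) + umps_dur I i \<le> real (pos j) \<or> real (pos j) + umps_dur I j \<le> real (pos i)"
      using ij by (auto simp: dur_unit neq_iff)
  qed simp
  then have "umps_opt I \<le> makespan n (umps_dur I) (\<lambda>j. real (pos j))" by (rule umps_opt_le)
  also have "\<dots> \<le> D"
  proof (rule makespan_le[OF D0])
    fix j
    assume j: "j < n"
    have "real (pos j) + 1 \<le> real (d j)" using pos(2)[OF j] by linarith
    also have "\<dots> \<le> E j"
    proof -
      have "d j > 0" using pos(2)[OF j] by linarith
      then show ?thesis by (simp add: d_def)
    qed
    also have "\<dots> \<le> D" by (rule E_le[OF j])
    finally show "real (pos j) + umps_dur I j \<le> D" using j by (simp add: dur_unit)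
  qed
  finally show ?thesis by (simp add: D_def)
qed

end

section \<open>Encodings in polynomial time\<close>

text \<open>\<open>enc_bits\<close> announces each bit by \<open>True\<close> and ends a word by
  \<open>False\<close>. The flag records that the next symbol is a data bit; the current word and
  the list of finished words are kept in reverse.\<close>

fun token_step :: "bool \<Rightarrow> bool \<times> bool list \<times> bool list list \<Rightarrow> bool \<times> bool list \<times> bool list list" where
  "token_step b (fl, cur, toks) =
    (if fl then (False, b # cur, toks)
     else if b then (True, cur, toks) else (False, [], rev cur # toks))"

definition tokens :: "bool list \<Rightarrow> bool list list" where
  "tokens y = rev (snd (snd (fold token_step y (False, [], []))))"

lemma fold_token_step_bits:
  "fold token_step (concat (map (\<lambda>b. [True, b]) bs)) (False, cur, toks) = (False, rev bs @ cur, toks)"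
  by (induction bs arbitrary: cur) auto

lemma tokens_concat: "tokens (concat (map enc_bits ws)) = ws"
proof -
  have "fold token_step (concat (map enc_bits ws)) (False, [], toks) = (False, [], rev ws @ toks)" for toks
    by (induction ws arbitrary: toks) (auto simp: enc_bits_def fold_token_step_bits)
  then show ?thesis by (simp add: tokens_def)
qed

lemma fp_tokens [fp_intros]:
  assumes "fp f"
  shows "fp (\<lambda>x. tokens (f x))"
proof -
  have step: "token_step b st = (if fst st then (False, b # fst (snd st), snd (snd st))
      else if b then (True, fst (snd st), snd (snd st)) else (False, [], rev (fst (snd st)) # snd (snd st)))" for b st
    by (cases st) auto
  have "fp (\<lambda>x. fold (\<lambda>b st. token_step b st) (f x) (False, [], []))"
  proof (rule fp_fold[where h = "\<lambda>p. 10 + sz (snd p)"])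
    show "sz (token_step b st) \<le> sz st + (10 + sz (snd (x, b)))" for x b st
      using sz_bool[of True] sz_bool[of False] sz_ge_1[of "fst st"]
      by (cases st) auto
  qed (unfold step, (intro fp_intros pb_intros assms)+)
  then have "fp (\<lambda>x. rev (snd (snd (fold (\<lambda>b st. token_step b st) (f x) (False, [], [])))))"
    by (intro fp_intros)
  then show ?thesis by (rule fp_cong) (simp add: tokens_def)
qed

text \<open>Binary numbers may be exponentially large, so they are read only up to a unary bound.\<close>

definition capped_value :: "nat \<Rightarrow> bool list \<Rightarrow> nat" where
  "capped_value U w = foldr (\<lambda>b v. min U (2 * v + (if b then 1 else 0))) w 0"

lemma capped_value_binary: "capped_value U (binary n) = min U n"
proof (induction n rule: less_induct)
  case (less n)
  show ?case
  proof (cases "n = 0")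
    case True
    then show ?thesis by (simp add: capped_value_def binary.simps)
  next
    case False
    then have "capped_value U (binary n) = min U (2 * capped_value U (binary (n div 2)) + (if odd n then 1 else 0))"
      by (simp add: capped_value_def binary.simps[of n])
    also have "\<dots> = min U (2 * min U (n div 2) + (if odd n then 1 else 0))"
      using less[of "n div 2"] False by simp
    also have "\<dots> = min U n"
      by (cases "odd n"; cases "U \<le> n div 2") (auto simp: min_def elim!: evenE oddE)
    finally show ?thesis .
  qed
qed

lemma fp_capped_value [fp_intros]:
  assumes "fp u" "fp w"
  shows "fp (\<lambda>x. capped_value (u x) (w x))"
  unfolding capped_value_def
  by (rule fp_foldr_capped[where h = "\<lambda>x. sz (u x)"])
    (auto intro!: fp_intros pb_intros assms fp_comp[OF assms(1)] poly_bounded_nat[OF assms(1)])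

lemma fp_enc_bits [fp_intros]: "fp f \<Longrightarrow> fp (\<lambda>x. enc_bits (f x))"
  unfolding enc_bits_def by (intro fp_intros)

lemma fp_enc_nat [fp_intros]: "fp f \<Longrightarrow> fp (\<lambda>x. enc_nat (f x))"
  unfolding enc_nat_def by (intro fp_intros)

lemma fp_enc_nats [fp_intros]: "fp f \<Longrightarrow> fp (\<lambda>x. enc_nats (f x))"
proof -
  assume "fp f"
  then have "fp (\<lambda>x. enc_nat (length (f x)) @ concat (map (\<lambda>n. enc_nat n) (f x)))" by (intro fp_intros)
  then show ?thesis by (simp add: enc_nats_def)
qed

lemma fp_enc_pairs [fp_intros]: "fp f \<Longrightarrow> fp (\<lambda>x. enc_pairs (f x))"
  unfolding enc_pairs_def case_prod_beta by (intro fp_intros)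

lemma length_concat_enc_bits: "length ws \<le> length (concat (map enc_bits ws))"
  by (induction ws) (auto simp: enc_bits_def)

text \<open>The bit length stands in for the logarithm wherever a machine has to compute one; the
  price is a factor 2.\<close>

lemma binary_bounds:
  shows less_two_power_binary: "n < 2 ^ length (binary n)"
    and two_power_binary_le: "0 < n \<Longrightarrow> 2 ^ length (binary n) \<le> 2 * n"
proof -
  have "n < 2 ^ length (binary n) \<and> (0 < n \<longrightarrow> 2 ^ length (binary n) \<le> 2 * n)"
  proof (induction n rule: less_induct)
    case (less n)
    show ?case
    proof (cases "n = 0")
      case True
      then show ?thesis by (simp add: binary.simps)
    next
      case False
      then have IH: "n div 2 < 2 ^ length (binary (n div 2))" "0 < n div 2 \<longrightarrow> 2 ^ length (binary (n div 2)) \<le> 2 * (n div 2)"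
        using less[of "n div 2"] by auto
      have "(2::nat) ^ length (binary n) = 2 * 2 ^ length (binary (n div 2))"
        using False by (simp add: binary.simps[of n])
      moreover have "n < 2 * 2 ^ length (binary (n div 2))" using IH(1) by linarith
      moreover have "2 * 2 ^ length (binary (n div 2)) \<le> 2 * n"
      proof (cases "n div 2 = 0")
        case True
        then show ?thesis using False by (simp add: binary.simps)
      next
        case False
        then have "2 ^ length (binary (n div 2)) \<le> 2 * (n div 2)" using IH(2) by simp
        also have "\<dots> \<le> n" by simp
        finally show ?thesis by simp
      qed
      ultimately show ?thesis by simp
    qed
  qed
  then show "n < 2 ^ length (binary n)" "0 < n \<Longrightarrow> 2 ^ length (binary n) \<le> 2 * n" by auto
qed

lemma length_binary_le_iff: "length (binary n) \<le> k \<longleftrightarrow> n < 2 ^ k"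
proof
  assume "length (binary n) \<le> k"
  then have "(2::nat) ^ length (binary n) \<le> 2 ^ k" by simp
  then show "n < 2 ^ k" using less_two_power_binary[of n] by linarith
next
  assume a: "n < 2 ^ k"
  show "length (binary n) \<le> k"
  proof (cases "n = 0")
    case False
    then have "(2::nat) ^ length (binary n) < 2 ^ Suc k" using two_power_binary_le[of n] a by simp
    then have "length (binary n) < Suc k" by (rule power_less_imp_less_exp[rotated]) simp
    then show ?thesis by simp
  qed (simp add: binary.simps)
qed

section \<open>The reduction in polynomial time, given a tally\<close>

text \<open>The encoding of an instance is a flat sequence of self-delimiting numbers, list lengths
  included, so decoding reduces to picking positions in one list of tokens.\<close>

definition numbers :: "umps \<Rightarrow> nat \<Rightarrow> nat list" where
  "numbers I T = umps_machines I # umps_jobs I # umps_machine_of I @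
     length (umps_length I) # umps_length I @
     2 * length (umps_prec I) # concat (map (\<lambda>(i, j). [i, j]) (umps_prec I)) @ [T]"

lemma length_concat_pairs: "length (concat (map (\<lambda>(i, j). [i, j]) ps)) = 2 * length ps"
  by (induction ps) auto

lemma enc_umps_threshold_numbers:
  "enc_umps_threshold I T = concat (map enc_bits (map binary (numbers I T)))"
  by (simp add: enc_umps_threshold_def numbers_def enc_pairs_def enc_nats_def length_concat_pairs
      umps_jobs_def enc_nat_def[abs_def] comp_def)

lemma enc_schedule_binary:
  "enc_schedule S = concat (map enc_bits (binary (3 * length S) # map binary (concat (map (\<lambda>(i, a, b). [i, a, b]) S))))"
proof -
  have "length (concat (map (\<lambda>(i, a, b). [i, a, b]) S)) = 3 * length S" by (induction S) auto
  then show ?thesis by (simp add: enc_schedule_def enc_nats_def enc_nat_def[abs_def] comp_def)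
qed

lemma nth_concat_triples:
  "u < length S \<Longrightarrow> drop (3 * u) (concat (map (\<lambda>(i, a, b). [i, a, b]) S)) =
    fst (S ! u) # fst (snd (S ! u)) # snd (snd (S ! u)) # drop (3 * Suc u) (concat (map (\<lambda>(i, a, b). [i, a, b]) S))"
proof (induction S arbitrary: u)
  case (Cons s S)
  show ?case
  proof (cases u)
    case 0
    then show ?thesis by (cases s) (simp add: numeral_3_eq_3)
  next
    case (Suc v)
    then show ?thesis using Cons by (cases s) (simp add: numeral_3_eq_3)
  qed
qed simp

lemma nth_concat_pairs:
  "k < length ps \<Longrightarrow> drop (2 * k) (concat (map (\<lambda>(i, j). [i, j]) ps) @ zs) =
    fst (ps ! k) # snd (ps ! k) # drop (2 * Suc k) (concat (map (\<lambda>(i, j). [i, j]) ps) @ zs)"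
proof (induction ps arbitrary: k)
  case (Cons p ps)
  show ?case
  proof (cases k)
    case 0
    then show ?thesis by (cases p) (simp add: numeral_2_eq_2)
  next
    case (Suc v)
    then show ?thesis using Cons by (cases p) (simp add: numeral_2_eq_2)
  qed
qed simp

text \<open>Numbers are read up to the length of the word plus \<open>slack\<close>. The slack
  accommodates the number of machines, which is written in binary and may exceed the length of the
  word when there are few jobs.\<close>

locale umps_decoding =
  fixes slack :: nat
begin

definition dec :: "bool list \<Rightarrow> nat list" where
  "dec y = map (\<lambda>w. capped_value (length y + slack) w) (tokens y)"

definition "dec_m y = hd (dec y)"
definition "dec_n y = hd (tl (dec y))"
definition "dec_ms y = take (dec_n y) (drop 2 (dec y))"
text \<open>In front of the flattened pairs stand \<open>2 * n + 4\<close> numbers: two lists of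
  length \<open>n\<close>, their two lengths, the number of machines and the length of the pair
  list. The threshold comes last.\<close>

definition "dec_rest y = drop (2 * dec_n y + 4) (dec y)"
definition "dec_T y = hd (rev (dec_rest y))"
definition "dec_prec y = map (\<lambda>k. (hd (drop (2 * k) (dec_rest y)), hd (drop (2 * k + 1) (dec_rest y)))) [0..<length (dec_rest y) div 2]"

lemma fp_dec [fp_intros]: "fp f \<Longrightarrow> fp (\<lambda>x. dec (f x))"
  by (rule fp_comp[of dec]) (unfold dec_def[abs_def], intro fp_intros)
lemma fp_dec_m [fp_intros]: "fp f \<Longrightarrow> fp (\<lambda>x. dec_m (f x))"
  unfolding dec_m_def by (intro fp_intros)
lemma fp_dec_n [fp_intros]: "fp f \<Longrightarrow> fp (\<lambda>x. dec_n (f x))"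
  unfolding dec_n_def by (intro fp_intros)
lemma fp_dec_ms [fp_intros]: "fp f \<Longrightarrow> fp (\<lambda>x. dec_ms (f x))"
  unfolding dec_ms_def by (intro fp_intros)
lemma fp_dec_rest [fp_intros]: "fp f \<Longrightarrow> fp (\<lambda>x. dec_rest (f x))"
  unfolding dec_rest_def by (intro fp_intros)
lemma fp_dec_T [fp_intros]: "fp f \<Longrightarrow> fp (\<lambda>x. dec_T (f x))"
  unfolding dec_T_def by (intro fp_intros)
lemma fp_dec_prec [fp_intros]: "fp f \<Longrightarrow> fp (\<lambda>x. dec_prec (f x))"
  by (rule fp_comp[of dec_prec]) (unfold dec_prec_def[abs_def], intro fp_intros)

text \<open>All numbers but the threshold lie below the cap and are read exactly. The threshold may
  be cut off, but only at a value of at least \<open>n\<close>, where every instance is a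
  yes-instance.\<close>

lemma dec_correct:
  assumes inst: "umps_instance I" and unit: "umps_unit I" and y: "y = enc_umps_threshold I T"
    and m: "umps_machines I \<le> length y + slack"
  shows "dec_m y = umps_machines I" "dec_n y = umps_jobs I" "dec_ms y = umps_machine_of I"
    "dec_prec y = umps_prec I" "dec_T y = min (length y + slack) T" "umps_jobs I \<le> length y"
proof -
  let ?U = "length y + slack" and ?fl = "concat (map (\<lambda>(i, j). [i, j]) (umps_prec I))"
  let ?xs = "umps_machines I # umps_jobs I # umps_machine_of I @ length (umps_length I) # umps_length I @
     2 * length (umps_prec I) # ?fl"
  have "length (numbers I T) \<le> length y"
    unfolding y enc_umps_threshold_numbers using length_concat_enc_bits[of "map binary (numbers I T)"] by simp
  then have len: "4 + 2 * umps_jobs I + 2 * length (umps_prec I) < length y" "umps_jobs I = length (umps_length I)"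
    using inst length_concat_pairs[of "umps_prec I"] by (auto simp: numbers_def umps_jobs_def umps_instance_def)
  then show n: "umps_jobs I \<le> length y" by linarith
  have "set (umps_prec I) \<subseteq> {..<umps_jobs I} \<times> {..<umps_jobs I}"
    using inst by (auto simp: umps_instance_def strict_order_on_def)
  then have "\<forall>v\<in>set ?fl. v < umps_jobs I" by fastforce
  then have fl: "\<forall>v\<in>set ?fl. v \<le> ?U" using n by (meson less_imp_le order_trans trans_le_add1)
  have ms: "\<forall>v\<in>set (umps_machine_of I). v \<le> ?U"
    using inst m unfolding umps_instance_def by (meson less_imp_le order_trans)
  have ls: "\<forall>v\<in>set (umps_length I). v \<le> ?U" using unit len by (auto simp: umps_unit_def)
  have "\<forall>v\<in>set ?xs. v \<le> ?U"
    unfolding list.set set_append ball_Un ball_simps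
    using m n len fl ms ls by (intro conjI) (assumption | linarith)+
  then have "\<forall>v\<in>set ?xs. min ?U v = v" using min_absorb2 by blast
  then have "map (min ?U) ?xs = ?xs" by (intro map_idI) blast
  moreover have "dec y = map (min ?U) (numbers I T)"
    unfolding dec_def y enc_umps_threshold_numbers tokens_concat by (simp add: capped_value_binary)
  moreover have "numbers I T = ?xs @ [T]" by (simp add: numbers_def)
  ultimately have dec: "dec y = ?xs @ [min ?U T]" by (simp only: map_append list.map)
  show "dec_m y = umps_machines I" by (simp add: dec_m_def dec)
  show dn: "dec_n y = umps_jobs I" by (simp add: dec_n_def dec)
  show "dec_ms y = umps_machine_of I" by (simp add: dec_ms_def dn dec umps_jobs_def)
  have rest: "dec_rest y = ?fl @ [min ?U T]"
    using len(2) by (simp add: dec_rest_def dn dec) (simp add: umps_jobs_def numeral_eq_Suc)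
  show "dec_T y = min (length y + slack) T" by (simp add: dec_T_def rest)
  have "length (dec_rest y) div 2 = length (umps_prec I)"
    unfolding rest by (simp add: length_concat_pairs)
  moreover have "hd (drop (2 * k) (dec_rest y)) = fst (umps_prec I ! k)"
    "hd (drop (2 * k + 1) (dec_rest y)) = snd (umps_prec I ! k)" if "k < length (umps_prec I)" for k
  proof -
    note d = nth_concat_pairs[OF that, of "[min ?U T]"]
    show "hd (drop (2 * k) (dec_rest y)) = fst (umps_prec I ! k)" unfolding rest d by simp
    have "drop (2 * k + 1) (dec_rest y) = tl (drop (2 * k) (dec_rest y))" by (simp add: drop_Suc tl_drop)
    then show "hd (drop (2 * k + 1) (dec_rest y)) = snd (umps_prec I ! k)" unfolding rest d by simp
  qed
  ultimately show "dec_prec y = umps_prec I"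
    unfolding dec_prec_def by (intro nth_equalityI) auto
qed

text \<open>Exponentiation is not polynomial-time on unary numbers, so the powers of \<open>K = 2 ^ kap y\<close> are
  obtained by halving the tally \<open>2 ^ tally_exponent y\<close>.\<close>

definition "kap y = 3 * length (binary (dec_n y))"
text \<open>The exponent of \<open>K ^ (2 * m)\<close>, the largest power that occurs; it is the
  size of the slowest group.\<close>

definition "tally_exponent y = 2 * (kap y * dec_m y)"
definition "pw p j = ((\<lambda>z. z div 2) ^^ (tally_exponent (fst p) - j)) (snd p)" for p :: "bool list \<times> nat"
definition "groups p = concat (map (\<lambda>i. replicate (pw p (kap (fst p) * (2 * (dec_m (fst p) - i)))) i) [0..<dec_m (fst p)])"
definition "owners p = concat (map (\<lambda>j. replicate (pw p (kap (fst p) * (2 * (dec_m (fst p) - hd (drop j (dec_ms (fst p))))))) j) [0..<dec_n (fst p)])"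
definition "speeds p = map (\<lambda>i. pw p (kap (fst p) * i)) (groups p)"
definition "procs p = map (\<lambda>j. pw p (kap (fst p) * hd (drop j (dec_ms (fst p))))) (owners p)"
text \<open>The word produced has to agree literally with \<open>enc_q\<close>, on which alone the
  approximation algorithm is known to work; so the pairs are listed in the order of
  \<open>List.product\<close>.\<close>

definition "precs p = filter (\<lambda>e. list_ex (\<lambda>c. fst c = hd (drop (fst e) (owners p)) \<and> snd c = hd (drop (snd e) (owners p))) (dec_prec (fst p)))
   (concat (map (\<lambda>u. map (\<lambda>v. (u, v)) [0..<length (owners p)]) [0..<length (owners p)]))"
definition "encoded p = enc_nats (speeds p) @ enc_nats (procs p) @ enc_pairs (precs p)"

lemma fp_kap [fp_intros]: "fp f \<Longrightarrow> fp (\<lambda>x. kap (f x))"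
  unfolding kap_def by (intro fp_intros)
lemma fp_tally_exponent [fp_intros]: "fp f \<Longrightarrow> fp (\<lambda>x. tally_exponent (f x))"
  unfolding tally_exponent_def by (intro fp_intros)
lemma fp_pw [fp_intros]: "fp f \<Longrightarrow> fp g \<Longrightarrow> fp (\<lambda>x. pw (f x) (g x))"
  unfolding pw_def by (intro fp_halving fp_intros)
lemma fp_groups [fp_intros]: "fp f \<Longrightarrow> fp (\<lambda>x. groups (f x))"
  by (rule fp_comp[of groups]) (unfold groups_def[abs_def], intro fp_intros)
lemma fp_owners [fp_intros]: "fp f \<Longrightarrow> fp (\<lambda>x. owners (f x))"
  by (rule fp_comp[of owners]) (unfold owners_def[abs_def], intro fp_intros)
lemma fp_speeds [fp_intros]: "fp f \<Longrightarrow> fp (\<lambda>x. speeds (f x))"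
  by (rule fp_comp[of speeds]) (unfold speeds_def[abs_def], intro fp_intros)
lemma fp_procs [fp_intros]: "fp f \<Longrightarrow> fp (\<lambda>x. procs (f x))"
  by (rule fp_comp[of procs]) (unfold procs_def[abs_def], intro fp_intros)
lemma fp_precs [fp_intros]: "fp f \<Longrightarrow> fp (\<lambda>x. precs (f x))"
  by (rule fp_comp[of precs]) (unfold precs_def[abs_def], intro fp_intros)
lemma fp_encoded [fp_intros]: "fp f \<Longrightarrow> fp (\<lambda>x. encoded (f x))"
  unfolding encoded_def by (intro fp_intros)

lemma pw_eq:
  assumes "j \<le> tally_exponent y"
  shows "pw (y, 2 ^ tally_exponent y) j = 2 ^ j"
proof -
  have "((\<lambda>z::nat. z div 2) ^^ k) (2 ^ (k + j)) = 2 ^ j" for k j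
  proof (induction k)
    case (Suc k)
    have "((\<lambda>z::nat. z div 2) ^^ Suc k) (2 ^ (Suc k + j)) = ((\<lambda>z. z div 2) ^^ k) (2 ^ (Suc k + j) div 2)"
      by (simp only: funpow_Suc_right o_apply)
    then show ?case using Suc by simp
  qed simp
  from this[of "tally_exponent y - j" j] show ?thesis using assms by (simp add: pw_def)
qed

lemma encoded_correct:
  assumes ms: "length (dec_ms y) = dec_n y" "\<forall>i\<in>set (dec_ms y). i < dec_m y"
  defines "p \<equiv> (y, 2 ^ tally_exponent y)" and "Q \<equiv> q_of_umps (2 ^ kap y) (dec_m y) (dec_ms y) (dec_prec y)"
  shows "speeds p = q_speeds Q" "procs p = q_procs Q" "encoded p = enc_q Q"
    "owners p = owner_list (2 ^ kap y) (dec_m y) (dec_ms y)"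
proof -
  let ?m = "dec_m y" and ?K = "2 ^ kap y :: nat"
  have pw1: "pw p (kap y * (2 * (?m - i))) = ?K ^ (2 * (?m - i))" for i
  proof -
    have "kap y * (2 * (?m - i)) \<le> tally_exponent y"
      unfolding tally_exponent_def by (simp add: mult.left_commute)
    then show ?thesis unfolding p_def pw_eq by (simp add: pw_eq flip: power_mult)
  qed
  have pw2: "pw p (kap y * i) = ?K ^ i" if "i < ?m" for i
  proof -
    have "kap y * i \<le> tally_exponent y"
      unfolding tally_exponent_def using that by (simp add: mult.left_commute trans_le_add1)
    then show ?thesis unfolding p_def pw_eq by (simp add: pw_eq flip: power_mult)
  qed
  have nth: "hd (drop j (dec_ms y)) = dec_ms y ! j" "dec_ms y ! j < ?m" if "j < dec_n y" for j
    using that ms nth_mem[of j "dec_ms y"] by (auto simp: hd_drop_conv_nth)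
  have fst_p: "fst p = y" by (simp add: p_def)
  have g: "groups p = group_list ?K ?m"
    by (simp add: groups_def group_list_def fst_p pw1)
  show o: "owners p = owner_list ?K ?m (dec_ms y)"
    unfolding owners_def owner_list_def fst_p pw1 ms(1) using nth(1) by (intro arg_cong[of _ _ concat] map_cong) auto
  have gl: "i < ?m" if "i \<in> set (group_list ?K ?m)" for i using that by (auto simp: group_list_def)
  have ol: "j < dec_n y" if "j \<in> set (owner_list ?K ?m (dec_ms y))" for j
    using that ms(1) by (auto simp: owner_list_def)
  show s: "speeds p = q_speeds Q"
    unfolding speeds_def Q_def q_of_umps_def g fst_p using pw2 gl by (auto intro!: map_cong)
  show pr: "procs p = q_procs Q"
    unfolding procs_def Q_def q_of_umps_def o fst_p using pw2 ol nth by (auto intro!: map_cong)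
  have "List.product xs ys = concat (map (\<lambda>u. map (\<lambda>v. (u, v)) ys) xs)" for xs ys :: "nat list"
    by (induction xs) auto
  moreover have "filter (\<lambda>e. list_ex (\<lambda>c. fst c = hd (drop (fst e) (owners p)) \<and> snd c = hd (drop (snd e) (owners p))) (dec_prec y))
      (List.product [0..<length (owners p)] [0..<length (owners p)]) =
    filter (\<lambda>e. (owners p ! fst e, owners p ! snd e) \<in> set (dec_prec y)) (List.product [0..<length (owners p)] [0..<length (owners p)])"
    by (rule filter_cong[OF refl]) (force simp: list_ex_iff hd_drop_conv_nth)
  ultimately have "precs p = q_prec Q"
    unfolding precs_def Q_def q_of_umps_def fst_p o by simp
  with s pr show "encoded p = enc_q Q" by (simp add: encoded_def enc_q_def)
qed

end

text \<open>Start times are quotients of binary numbers of arbitrary size, too large for unary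
  arithmetic, but bit lengths can be compared. Nothing is lost in this direction; the converse below
  loses a factor 2.\<close>

lemma length_binary_le_of_quotient:
  assumes "0 < b" "real a / real b \<le> 2 ^ E"
  shows "length (binary a) \<le> length (binary b) + E"
proof -
  have "real a \<le> 2 ^ E * real b" using assms by (simp add: field_simps)
  then have "real a \<le> real (2 ^ E * b)" by simp
  then have "a \<le> 2 ^ E * b" by (simp only: of_nat_le_iff)
  also have "\<dots> < 2 ^ E * 2 ^ length (binary b)" using less_two_power_binary[of b] by simp
  finally show ?thesis by (simp add: length_binary_le_iff power_add mult.commute)
qed

lemma quotient_le_of_length_binary:
  assumes "0 < b" "length (binary a) \<le> length (binary b) + E"
  shows "real a / real b \<le> 2 ^ (E + 1)"
proof -
  have "a < 2 ^ (length (binary b) + E)" using assms(2) by (simp add: length_binary_le_iff)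
  also have "\<dots> = 2 ^ length (binary b) * 2 ^ E" by (simp add: power_add)
  also have "\<dots> \<le> 2 * b * 2 ^ E" using two_power_binary_le[OF assms(1)] by simp
  finally have "real a \<le> real (2 * b * 2 ^ E)" by (simp only: of_nat_le_iff less_imp_le)
  then show ?thesis using assms(1) by (simp add: field_simps)
qed

section \<open>Recognizing short schedules by bit lengths\<close>

context umps_to_q
begin

text \<open>The first condition says that the job lasts at most 1, the second bounds its start up to
  a factor 2. Both can be read off the encoding.\<close>

definition "short_schedule E S \<longleftrightarrow> (\<forall>u<length J.
   q_procs Q ! u \<le> q_speeds Q ! sched_mach S u \<and>
   length (binary (fst (snd (S ! u)))) \<le> length (binary (snd (snd (S ! u)))) + E)"

lemma schedule_denominator_pos: "q_schedule Q S \<Longrightarrow> u < length J \<Longrightarrow> 0 < snd (snd (S ! u))"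
proof -
  assume S: "q_schedule Q S" "u < length J"
  obtain i a b where e: "S ! u = (i, a, b)" by (cases "S ! u")
  have "S ! u \<in> set S" using S by (intro nth_mem) (simp add: q_schedule_def)
  then show ?thesis using S(1) unfolding q_schedule_def e by auto
qed

text \<open>On a slower group a job lasts at least \<open>K\<close>, which \<open>2 ^ E < K\<close>
  excludes; on its own or a faster group its size is at most the speed.\<close>

lemma short_schedule_if_makespan_le:
  assumes S: "q_schedule Q S" and le: "q_makespan Q (sched_mach S) (sched_start S) \<le> 2 ^ E" and E: "2 ^ E < real K"
  shows "short_schedule E S"
  unfolding short_schedule_def
proof (intro allI impI conjI)
  fix u
  assume u: "u < length J"
  have feas: "q_feasible Q (sched_mach S) (sched_start S)" using S by (simp add: q_schedule_def)
  then have mach: "sched_mach S u < length G" and s0: "0 \<le> sched_start S u"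
    using u by (auto simp: q_feasible_def feasible_def)
  have end_le: "sched_start S u + q_dur Q (sched_mach S) u \<le> 2 ^ E"
    using le_makespan[of u "q_jobs Q" "sched_start S" "q_dur Q (sched_mach S)"] u le by (simp add: q_makespan_def)
  have dur: "q_dur Q (sched_mach S) u = real K ^ mac (J ! u) / real K ^ (G ! sched_mach S u)"
    using q_dur_Q[OF u, of "sched_mach S"] mach by simp
  have dur0: "0 \<le> q_dur Q (sched_mach S) u" by (simp add: q_dur_def)
  have "mac (J ! u) \<le> G ! sched_mach S u"
  proof (rule ccontr)
    assume "\<not> ?thesis"
    then have "real K ^ (G ! sched_mach S u) * real K \<le> real K ^ mac (J ! u)"
      using K_pos power_increasing[of "Suc (G ! sched_mach S u)" "mac (J ! u)" "real K"] by (simp add: mult.commute)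
    then have "real K \<le> q_dur Q (sched_mach S) u" unfolding dur using K_pos by (simp add: pos_le_divide_eq mult.commute)
    then show False using end_le s0 E by linarith
  qed
  then have "K ^ mac (J ! u) \<le> K ^ (G ! sched_mach S u)" using K_pos by (intro power_increasing) auto
  then show "q_procs Q ! u \<le> q_speeds Q ! sched_mach S u" using u mach by (simp add: q_of_umps_def)
  have "sched_start S u \<le> 2 ^ E" using end_le dur0 by linarith
  then show "length (binary (fst (snd (S ! u)))) \<le> length (binary (snd (snd (S ! u)))) + E"
    by (intro length_binary_le_of_quotient schedule_denominator_pos[OF S u]) (simp add: sched_start_def)
qed

lemma makespan_le_if_short_schedule:
  assumes S: "q_schedule Q S" and short: "short_schedule E S"
  shows "q_makespan Q (sched_mach S) (sched_start S) \<le> 2 ^ (E + 1) + 1"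
  unfolding q_makespan_def
proof (rule makespan_le)
  fix u
  assume "u < q_jobs Q"
  then have u: "u < length J" by simp
  have "sched_start S u \<le> 2 ^ (E + 1)"
    unfolding sched_start_def
    by (intro quotient_le_of_length_binary schedule_denominator_pos[OF S u])
      (use short u in \<open>auto simp: short_schedule_def\<close>)
  moreover have "q_dur Q (sched_mach S) u \<le> 1"
    using short u by (auto simp: short_schedule_def q_dur_def divide_le_eq)
  ultimately show "sched_start S u + q_dur Q (sched_mach S) u \<le> 2 ^ (E + 1) + 1" by linarith
qed simp

end

context umps_decoding
begin

text \<open>The schedule is compared with \<open>T\<close> times \<open>2 ^ (\<dots> div 2)\<close>, which is of order \<open>sqrt (log n)\<close> and so lies
  between the approximation ratio and the gap. Bit lengths decide this up to a constant factor.\<close>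

definition "ratio_exponent y = length (binary (dec_T y)) + length (binary (length (binary (dec_n y)))) div 2"

text \<open>Token 0 is the length of the list, so the triple of job \<open>u\<close> occupies tokens
  \<open>3 * u + 1\<close> to \<open>3 * u + 3\<close>. Machine indices are below the number of
  machines and survive the cap.\<close>

definition "accepts p z = list_all (\<lambda>u.
    hd (drop u (procs p)) \<le> hd (drop (capped_value (length (speeds p)) (hd (drop (3 * u + 1) (tokens z)))) (speeds p)) \<and>
    length (hd (drop (3 * u + 2) (tokens z))) \<le> length (hd (drop (3 * u + 3) (tokens z))) + ratio_exponent (fst p))
  [0..<length (procs p)]"

lemma fp_ratio_exponent [fp_intros]: "fp f \<Longrightarrow> fp (\<lambda>x. ratio_exponent (f x))"
  unfolding ratio_exponent_def by (intro fp_intros)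

lemma fp_accepts: "fp (\<lambda>q. accepts (fst q) (snd q))"
  unfolding accepts_def by (intro fp_intros)

end

context umps_to_q
begin

lemma accepts_enc_schedule:
  fixes slack :: nat
  assumes S: "q_schedule Q S" and p: "umps_decoding.speeds slack p = q_speeds Q" "umps_decoding.procs slack p = q_procs Q"
  shows "umps_decoding.accepts slack p (enc_schedule S) \<longleftrightarrow> short_schedule (umps_decoding.ratio_exponent slack (fst p)) S"
proof -
  interpret D: umps_decoding slack .
  let ?fl = "concat (map (\<lambda>(i, a, b). [i, a, b]) S)"
  have "length S = length J" using S by (simp add: q_schedule_def)
  then have len: "length (q_procs Q) = length J" "length (q_speeds Q) = length G" "length S = length J"
    by (simp_all add: q_of_umps_def)
  have tok: "tokens (enc_schedule S) = binary (3 * length S) # map binary ?fl"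
    unfolding enc_schedule_binary tokens_concat ..
  have d: "hd (drop (3 * u + 1) (tokens (enc_schedule S))) = binary (fst (S ! u))"
    "hd (drop (3 * u + 2) (tokens (enc_schedule S))) = binary (fst (snd (S ! u)))"
    "hd (drop (3 * u + 3) (tokens (enc_schedule S))) = binary (snd (snd (S ! u)))" if "u < length J" for u
  proof -
    have "drop (3 * u + 1) (tokens (enc_schedule S)) = map binary (drop (3 * u) ?fl)"
      by (simp add: tok drop_map)
    also have "\<dots> = binary (fst (S ! u)) # binary (fst (snd (S ! u))) # binary (snd (snd (S ! u))) #
        map binary (drop (3 * Suc u) ?fl)"
      using that len by (subst nth_concat_triples) auto
    finally have e: "drop (3 * u + 1) (tokens (enc_schedule S)) = \<dots>" .
    have tl: "tl (drop i xs) = drop (Suc i) xs" for i and xs :: "bool list list" by (simp add: tl_drop drop_Suc)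
    have "drop (3 * u + 2) (tokens (enc_schedule S)) = tl (drop (3 * u + 1) (tokens (enc_schedule S)))"
      "drop (3 * u + 3) (tokens (enc_schedule S)) = tl (tl (drop (3 * u + 1) (tokens (enc_schedule S))))"
      unfolding tl by (simp_all add: numeral_2_eq_2 numeral_3_eq_3)
    then show "hd (drop (3 * u + 1) (tokens (enc_schedule S))) = binary (fst (S ! u))"
      "hd (drop (3 * u + 2) (tokens (enc_schedule S))) = binary (fst (snd (S ! u)))"
      "hd (drop (3 * u + 3) (tokens (enc_schedule S))) = binary (snd (snd (S ! u)))"
      by (simp_all only: e list.sel)
  qed
  have mach: "sched_mach S u < length G" if "u < length J" for u
    using S that by (auto simp: q_schedule_def q_feasible_def)
  have "capped_value (length (q_speeds Q)) (binary (fst (S ! u))) = sched_mach S u" if "u < length J" for u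
    using mach[OF that] by (simp add: capped_value_binary len sched_mach_def)
  then show ?thesis
    unfolding D.accepts_def p short_schedule_def list_all_iff
    using d mach by (auto simp: len hd_drop_conv_nth)
qed

end

text \<open>The second inequality makes \<open>m\<close> at most \<open>n\<close>. The other two
  compare the threshold factor, a power of two between the two square roots: it stays below the gap
  even when multiplied by 5, and it dominates the approximation ratio.\<close>

lemma eventually_large:
  assumes "(C::real) \<ge> 1"
  shows "\<forall>\<^sub>F n in sequentially. 1 \<le> log 2 (real n) \<and> log 2 (real n) powr C \<le> real n \<and>
     5 * sqrt (2 * (log 2 (real n) + 1)) \<le> log 2 (real n) powr (3/4) \<and>
     18 * log 2 (real n) powr (1/4) \<le> sqrt (log 2 (real n) / 2)"
proof (intro eventually_conj)
  show "\<forall>\<^sub>F n in sequentially. 1 \<le> log 2 (real n)" by real_asymp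
  show "\<forall>\<^sub>F n in sequentially. log 2 (real n) powr C \<le> real n" by real_asymp
  show "\<forall>\<^sub>F n in sequentially. 5 * sqrt (2 * (log 2 (real n) + 1)) \<le> log 2 (real n) powr (3/4)" by real_asymp
  show "\<forall>\<^sub>F n in sequentially. 18 * log 2 (real n) powr (1/4) \<le> sqrt (log 2 (real n) / 2)" by real_asymp
qed

lemma log_length_binary:
  assumes "0 < n"
  shows "log 2 (real n) < real (length (binary n))" "real (length (binary n)) \<le> log 2 (real n) + 1"
proof -
  have "real n < 2 ^ length (binary n)" using less_two_power_binary[of n] by (metis of_nat_less_iff of_nat_numeral of_nat_power)
  then show "log 2 (real n) < real (length (binary n))" using assms by (simp add: log_less_iff powr_realpow)
  have "real (2 ^ length (binary n)) \<le> real (2 * n)" using two_power_binary_le[OF assms] by (simp only: of_nat_le_iff)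
  then have "log 2 (real (2 ^ length (binary n))) \<le> log 2 (real (2 * n))" by (intro log_mono) auto
  then show "real (length (binary n)) \<le> log 2 (real n) + 1" using assms by (simp add: log_mult log_nat_power)
qed

text \<open>The bit length of the bit length of \<open>n\<close> is about \<open>log log n\<close>;
  two to half of it is about \<open>sqrt (log n)\<close>.\<close>

lemma sqrt_log_bounds:
  assumes "1 \<le> log 2 (real n)"
  defines "h \<equiv> length (binary (length (binary n))) div 2"
  shows "sqrt (log 2 (real n) / 2) \<le> 2 ^ h" "2 ^ h \<le> sqrt (2 * (log 2 (real n) + 1))"
proof -
  let ?k = "length (binary n)" and ?e = "length (binary (length (binary n)))"
  have n: "0 < n" using assms(1) by (cases "n = 0") (auto simp: log_def)
  note k = log_length_binary[OF n]
  have k0: "0 < ?k" using k(1) assms(1) by linarith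
  have "real ?k < real (2 ^ ?e)" using less_two_power_binary[of ?k] by (simp only: of_nat_less_iff)
  also have "real (2 ^ ?e) \<le> real (2 ^ (2 * h + 1))"
    unfolding of_nat_le_iff h_def by (intro power_increasing) auto
  finally have "log 2 (real n) / 2 \<le> (2 ^ h)\<^sup>2" using k(1) by (simp add: power_mult[symmetric] mult.commute)
  then show "sqrt (log 2 (real n) / 2) \<le> 2 ^ h" by (intro real_le_lsqrt) auto
  have "((2::nat) ^ h)\<^sup>2 \<le> 2 ^ ?e"
    unfolding h_def power_mult[symmetric] by (intro power_increasing) auto
  also have "\<dots> \<le> 2 * ?k" by (rule two_power_binary_le[OF k0])
  finally have "real (((2::nat) ^ h)\<^sup>2) \<le> real (2 * ?k)" by (simp only: of_nat_le_iff)
  then have "(2 ^ h)\<^sup>2 \<le> 2 * (log 2 (real n) + 1)" using k(2) by simp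
  then show "2 ^ h \<le> sqrt (2 * (log 2 (real n) + 1))" by (rule real_le_rsqrt)
qed

text \<open>\<open>length G\<close> is at most \<open>K ^ (2 * m + 1)\<close>, whose logarithm is at
  most 9 times the bit length of \<open>n\<close> times \<open>m\<close>. The bit length is at most
  \<open>2 * log 2 n\<close>, hence the constant 18, and the outer exponent turns
  \<open>C + 1\<close> into \<open>1/4\<close>.\<close>

lemma (in umps_to_q) log_machines_le:
  assumes K_eq: "K = 2 ^ (3 * length (binary n))" and C: "1 \<le> C"
    and l: "1 \<le> log 2 (real n)" and m: "real m \<le> log 2 (real n) powr C"
  shows "log 2 (real (length G)) powr (1 / (4 * (C + 1))) \<le> 18 * log 2 (real n) powr (1/4)" "n \<le> length G"
proof -
  let ?l = "log 2 (real n)" and ?e = "length (binary n)"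
  have K1: "1 \<le> K" using K_pos by simp
  have "K ^ (2 * (m - 0)) \<le> length G" unfolding length_G using m_pos by (intro member_le_sum) auto
  moreover have "K ^ 1 \<le> K ^ (2 * (m - 0))" using m_pos K1 by (intro power_increasing) auto
  ultimately have KG: "K \<le> length G" by simp
  then show "n \<le> length G" using n_le_K by linarith
  have "m \<le> m * n * n" using jobs by (simp add: Suc_leI)
  then have mK: "m \<le> K" using K by linarith
  have "length G \<le> (\<Sum>i<m. K ^ (2 * m))"
    unfolding length_G using K1 by (intro sum_mono power_increasing) auto
  also have "\<dots> \<le> K * K ^ (2 * m)" using mK by simp
  also have "\<dots> = 2 ^ (3 * ?e * (2 * m + 1))" unfolding K_eq by (simp add: power_mult[symmetric] power_add[symmetric] algebra_simps)
  finally have "real (length G) \<le> real (2 ^ (3 * ?e * (2 * m + 1)))" by (simp only: of_nat_le_iff)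
  then have "log 2 (real (length G)) \<le> log 2 (real (2 ^ (3 * ?e * (2 * m + 1))))"
    using KG K1 by (intro log_mono) auto
  also have "\<dots> = real (3 * ?e * (2 * m + 1))" by (simp add: log_nat_power del: of_nat_mult)
  also have "\<dots> \<le> real (9 * (?e * m))" using m_pos by (simp only: of_nat_le_iff) (simp add: algebra_simps Suc_leI)
  also have "\<dots> = 9 * (real ?e * real m)" by simp
  also have "\<dots> \<le> 9 * ((2 * ?l) * ?l powr C)"
    using log_length_binary(2)[OF jobs] l m by (intro mult_left_mono mult_mono) auto
  also have "\<dots> = 18 * ?l powr (C + 1)" using l by (simp add: powr_add)
  finally have le: "log 2 (real (length G)) \<le> 18 * ?l powr (C + 1)" .
  have "1 \<le> length G" using KG K1 by linarith
  then have "0 < real (length G)" "1 \<le> real (length G)" by linarith+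
  then have G0: "0 \<le> log 2 (real (length G))" by (simp only: zero_le_log_cancel_iff one_less_numeral_iff semiring_norm)
  have "log 2 (real (length G)) powr (1 / (4 * (C + 1))) \<le> (18 * ?l powr (C + 1)) powr (1 / (4 * (C + 1)))"
    using le G0 C by (intro powr_mono2) auto
  also have "\<dots> = 18 powr (1 / (4 * (C + 1))) * (?l powr (C + 1)) powr (1 / (4 * (C + 1)))"
    by (rule powr_mult)
  also have "\<dots> = 18 powr (1 / (4 * (C + 1))) * ?l powr (1/4)"
  proof -
    have "(C + 1) * (1 / (4 * (C + 1))) = 1 / 4" using C by (simp add: field_simps)
    then show ?thesis by (simp only: powr_powr)
  qed
  also have "\<dots> \<le> 18 powr 1 * ?l powr (1/4)"
    using C by (intro mult_right_mono powr_mono) auto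
  finally show "log 2 (real (length G)) powr (1 / (4 * (C + 1))) \<le> 18 * ?l powr (1/4)" by simp
qed

lemma cube_le_two_power_binary: "m \<le> n \<Longrightarrow> m * n * n \<le> 2 ^ (3 * length (binary n))"
proof -
  assume "m \<le> n"
  then have "m * n * n \<le> n * n * n" by simp
  also have "\<dots> = n ^ 3" by (simp add: power3_eq_cube)
  also have "\<dots> \<le> (2 ^ length (binary n)) ^ 3" using less_two_power_binary[of n] by (intro power_mono) auto
  also have "\<dots> = 2 ^ (3 * length (binary n))" by (simp add: power_mult[symmetric] mult.commute)
  finally show ?thesis .
qed

text \<open>A normal form of the precedence list. Repetitions make the list arbitrarily long even
  when the jobs are few; listing the relation in a fixed order leaves finitely many cases for a
  table.\<close>

definition prec_matrix :: "nat \<Rightarrow> (nat \<times> nat) list \<Rightarrow> (nat \<times> nat) list" where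
  "prec_matrix N ps = filter (\<lambda>e. list_ex (\<lambda>c. fst c = fst e \<and> snd c = snd e) ps)
     (concat (map (\<lambda>u. map (\<lambda>v. (u, v)) [0..<N]) [0..<N]))"

lemma fp_prec_matrix [fp_intros]: "fp f \<Longrightarrow> fp (\<lambda>x. prec_matrix N (f x))"
  by (rule fp_comp[of "prec_matrix N"]) (unfold prec_matrix_def[abs_def], intro fp_intros)

lemma set_prec_matrix: "set ps \<subseteq> {..<N} \<times> {..<N} \<Longrightarrow> set (prec_matrix N ps) = set ps"
  by (force simp: prec_matrix_def list_ex_iff)

lemma length_prec_matrix: "length (prec_matrix N ps) \<le> N * N"
proof -
  have "length (prec_matrix N ps) \<le> length (concat (map (\<lambda>u. map (\<lambda>v. (u, v)) [0..<N]) [0..<N]))"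
    unfolding prec_matrix_def by (rule length_filter_le)
  also have "\<dots> = N * N" by (simp add: length_concat comp_def sum_list_triv)
  finally show ?thesis .
qed

lemma small_instances_table:
  "\<exists>tbl. fp tbl \<and> (\<forall>I T. umps_instance I \<longrightarrow> umps_unit I \<longrightarrow> umps_jobs I \<le> N \<longrightarrow> umps_machines I \<le> m \<longrightarrow> T < N \<longrightarrow>
     tbl (umps_machine_of I, prec_matrix N (umps_prec I), T) = (umps_opt I \<le> real T))"
proof -
  define A where "A = {ms. set ms \<subseteq> {..<m} \<and> length ms \<le> N} \<times> {ps. set ps \<subseteq> {..<N} \<times> {..<N} \<and> length ps \<le> N * N} \<times> {..<N}"
  \<comment> \<open>\<open>umps_opt\<close> is determined by the machine list, the lengths and the
    precedences; the number 0 of machines is a filler value.\<close>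
  define inst where "inst ms ps = \<lparr>umps_machines = 0, umps_machine_of = ms, umps_length = replicate (length ms) 1, umps_prec = ps\<rparr>" for ms ps
  have "finite A" unfolding A_def by (intro finite_cartesian_product finite_lists_length_le) auto
  from fp_finite_table[OF this, of "\<lambda>q. umps_opt (inst (fst q) (fst (snd q))) \<le> real (snd (snd q))"]
  obtain tbl where tbl: "fp tbl" "\<And>q. q \<in> A \<Longrightarrow> tbl q = (umps_opt (inst (fst q) (fst (snd q))) \<le> real (snd (snd q)))" by blast
  have "tbl (umps_machine_of I, prec_matrix N (umps_prec I), T) = (umps_opt I \<le> real T)"
    if I: "umps_instance I" "umps_unit I" "umps_jobs I \<le> N" "umps_machines I \<le> m" "T < N" for I T
  proof -
    have prec: "set (umps_prec I) \<subseteq> {..<umps_jobs I} \<times> {..<umps_jobs I}"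
      using I(1) by (simp add: umps_instance_def strict_order_on_def)
    then have prec': "set (umps_prec I) \<subseteq> {..<N} \<times> {..<N}" using I(3) by force
    have "umps_length I = replicate (umps_jobs I) 1"
      using I(1,2) unfolding umps_instance_def umps_unit_def by (metis replicate_eqI)
    then have "umps_opt (inst (umps_machine_of I) (prec_matrix N (umps_prec I))) = umps_opt I"
      unfolding umps_opt_def using set_prec_matrix[OF prec']
      by (simp add: inst_def umps_jobs_def umps_dur_def[abs_def])
    moreover have "(umps_machine_of I, prec_matrix N (umps_prec I), T) \<in> A"
      using I prec' set_prec_matrix[OF prec'] length_prec_matrix[of N "umps_prec I"]
      by (auto simp: A_def umps_instance_def umps_jobs_def intro: less_le_trans)
    ultimately show ?thesis using tbl(2) by simp
  qed
  then show ?thesis using tbl(1) by blast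
qed

text \<open>A single number \<open>a\<close> has to serve as coefficient and as exponent, the form
  in which \<open>quasi_poly_time_tally\<close> takes its bound. It is large enough as an exponent
  because \<open>c + 1 < 2 ^ (c + 1)\<close>.\<close>

lemma polylog_product_bound:
  fixes k c :: nat and z :: real
  assumes z: "1 \<le> z" and a: "a = 6 * (4 * (k + 1)) ^ (c + 1)"
    and e: "real e \<le> 4 * real (k + 1) * z" and m: "real m \<le> (4 * real (k + 1) * z) ^ c"
  shows "real (2 * (3 * e * m)) \<le> real a * z ^ a"
proof -
  have "c + 1 < 2 ^ (c + 1)" by (rule less_exp)
  also have "\<dots> \<le> (4 * (k + 1)) ^ (c + 1)" by (intro power_mono) auto
  also have "\<dots> \<le> a" unfolding a by simp
  finally have ca: "c + 1 \<le> a" by simp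
  have "real (2 * (3 * e * m)) = 6 * (real e * real m)" by simp
  also have "\<dots> \<le> 6 * ((4 * real (k + 1) * z) * (4 * real (k + 1) * z) ^ c)"
    using e m z by (intro mult_left_mono mult_mono) auto
  also have "\<dots> = 6 * (4 * real (k + 1)) ^ (c + 1) * z ^ (c + 1)"
  proof -
    have "(X * z) * (X * z) ^ c = X ^ (c + 1) * z ^ (c + 1)" for X :: real
      by (simp add: power_mult_distrib mult_ac)
    from this[of "4 * real (k + 1)"] show ?thesis by (simp only: mult.assoc[of 6])
  qed
  also have "\<dots> = real a * z ^ (c + 1)" by (simp add: a)
  also have "\<dots> \<le> real a * z ^ a" using z ca by (intro mult_left_mono power_increasing) auto
  finally show ?thesis .
qed

section \<open>Closing the gap of UMPS in quasi-polynomial time\<close>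

theorem theorem2:
  assumes "\<exists>C::real. C \<ge> 1 \<and> (\<forall>\<epsilon>::real. \<epsilon> > 0 \<longrightarrow>
             umps_NP_hard_to_approximate
               (\<lambda>I. real (umps_machines I) \<le> log 2 (real (umps_jobs I)) powr C \<and> umps_unit I)
               (\<lambda>n. log 2 (real n) powr (1 - \<epsilon>)))"
    and "\<not> class_NP \<subseteq> quasi_poly_time"
  shows "\<exists>\<gamma>::real. \<gamma> > 0 \<and>
           (\<exists>c::real. c > 0 \<and>
              (\<forall>g. (\<forall>\<^sub>F m in sequentially. g m \<le> c * log 2 (real m) powr \<gamma>) \<longrightarrow>
                   \<not> q_poly_time_approximation g))"
proof -
  obtain C :: real where C: "C \<ge> 1" and hard: "\<And>\<epsilon>::real. \<epsilon> > 0 \<Longrightarrow> umps_NP_hard_to_approximate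
     (\<lambda>I. real (umps_machines I) \<le> log 2 (real (umps_jobs I)) powr C \<and> umps_unit I)
     (\<lambda>n. log 2 (real n) powr (1 - \<epsilon>))"
    using assms(1) by blast
  define \<gamma> where "\<gamma> = 1 / (4 * (C + 1))"
  have "\<gamma> > 0" using C by (simp add: \<gamma>_def)
  moreover have "\<not> q_poly_time_approximation g"
    if g: "\<forall>\<^sub>F m in sequentially. g m \<le> 1 * log 2 (real m) powr \<gamma>" for g
  proof
    assume "q_poly_time_approximation g"
    then obtain M k where M: "turing_machine M"
      "\<And>I. q_instance I \<Longrightarrow> \<exists>S. computes_in M (enc_q I) (enc_schedule S) (length (enc_q I) ^ k + k) \<and>
          q_schedule I S \<and> q_makespan I (sched_mach S) (sched_start S) \<le> g (q_machines I) * q_opt I"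
      unfolding q_poly_time_approximation_def by blast
    obtain R where R: "fp R" "\<And>x y t. computes_in M x y t \<Longrightarrow> R (x, t) = y"
      using turing_machine_fp[OF M(1)] by blast
    \<comment> \<open>\<open>g\<close> is controlled only for many machines. The reduction creates
      at least as many machines as there are jobs, so more than \<open>N0\<close> jobs
      suffice.\<close>
    obtain N0 where N0: "\<And>n. n \<ge> N0 \<Longrightarrow> g n \<le> log 2 (real n) powr \<gamma>"
      "\<And>n. n \<ge> N0 \<Longrightarrow> 1 \<le> log 2 (real n) \<and> log 2 (real n) powr C \<le> real n \<and>
         5 * sqrt (2 * (log 2 (real n) + 1)) \<le> log 2 (real n) powr (3/4) \<and>
         18 * log 2 (real n) powr (1/4) \<le> sqrt (log 2 (real n) / 2)"
      using eventually_conj[OF g eventually_large[OF C]] unfolding eventually_sequentially by auto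
    \<comment> \<open>Bounds the number of machines of every admissible instance with 2 to
      \<open>N0\<close> jobs.\<close>
    define s where "s = nat \<lceil>log 2 (real N0) powr C\<rceil>"
    interpret D: umps_decoding s .
    obtain tbl where tbl: "fp tbl" "\<And>I T. umps_instance I \<Longrightarrow> umps_unit I \<Longrightarrow> umps_jobs I \<le> N0 \<Longrightarrow>
        umps_machines I \<le> s \<Longrightarrow> T < N0 \<Longrightarrow>
        tbl (umps_machine_of I, prec_matrix N0 (umps_prec I), T) = (umps_opt I \<le> real T)"
      using small_instances_table[of N0 s] by blast
    define run where "run p = R (D.encoded p, length (D.encoded p) ^ k + k)" for p
    \<comment> \<open>\<open>n \<le> T\<close> is a yes because \<open>n\<close> jobs can be run one
      after another, and \<open>T = 0\<close> is a no because a job takes time 1.\<close>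
    define decide where "decide p \<longleftrightarrow> (if D.dec_n (fst p) \<le> D.dec_T (fst p) then True
        else if D.dec_n (fst p) \<le> N0 then tbl (D.dec_ms (fst p), prec_matrix N0 (D.dec_prec (fst p)), D.dec_T (fst p))
        else if D.dec_T (fst p) = 0 then False else D.accepts p (run p))" for p
    have fp_run: "fp run"
      unfolding run_def[abs_def] by (intro fp_comp[OF R(1)] fp_intros)
    have fp_decide: "fp decide"
    proof -
      have "fp (\<lambda>p. D.accepts p (run p))"
        using fp_comp[OF D.fp_accepts, of "\<lambda>p. (p, run p)"] by (simp add: fp_intros fp_run)
      then show ?thesis
        unfolding decide_def[abs_def] by (intro fp_intros fp_comp[OF tbl(1)])
    qed

    have correct: "(umps_opt I \<le> real T \<longrightarrow> decide (y, 2 ^ D.tally_exponent y)) \<and>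
        (umps_opt I > log 2 (real (umps_jobs I)) powr (3/4) * real T \<longrightarrow> \<not> decide (y, 2 ^ D.tally_exponent y)) \<and>
        umps_jobs I \<le> length y \<and>
        D.tally_exponent y = 2 * (3 * length (binary (umps_jobs I)) * umps_machines I)"
      if inst: "umps_instance I" and unit: "umps_unit I" and m: "real (umps_machines I) \<le> log 2 (real (umps_jobs I)) powr C"
        and y: "y = enc_umps_threshold I T" for I T y
    proof -
      let ?n = "umps_jobs I" and ?m = "umps_machines I"
      let ?l = "log 2 (real ?n)" and ?p = "(y, 2 ^ D.tally_exponent y) :: bool list \<times> nat"
      have m_small: "?m \<le> s" if "?n \<le> N0" "2 \<le> ?n"
      proof -
        have "?l powr C \<le> log 2 (real N0) powr C"
          using that C by (intro powr_mono2 log_mono) auto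
        then show ?thesis using m unfolding s_def by linarith
      qed
      \<comment> \<open>\<open>log 2 0\<close> is 0 in HOL, like \<open>log 2 1\<close>, and
        \<open>0 powr C = 0\<close>. So the bound on the machines leaves none, and in particular
        there cannot be exactly one job.\<close>
      have no_jobs: "?m = 0" if "?n < 2"
      proof -
        have "?n = 0 \<or> ?n = 1" using that by linarith
        then have "?l = 0" by (auto simp: log_def)
        then show ?thesis using m by simp
      qed
      have n1: "?n \<noteq> 1"
        using no_jobs inst by (auto simp: umps_instance_def umps_jobs_def length_Suc_conv)
      have n_len: "?n \<le> length y"
      proof -
        have "length (numbers I T) \<le> length y"
          unfolding y enc_umps_threshold_numbers using length_concat_enc_bits[of "map binary (numbers I T)"] by simp
        then show ?thesis by (simp add: numbers_def umps_jobs_def)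
      qed
      have "?m \<le> length y + s"
      proof (cases "?n \<le> N0")
        case True
        then show ?thesis using m_small no_jobs by fastforce
      next
        case False
        then have "?l powr C \<le> real ?n" using N0(2)[of ?n] by simp
        then show ?thesis using m n_len by linarith
      qed
      note dec = D.dec_correct[OF inst unit y this]
      have texp: "D.tally_exponent y = 2 * (3 * length (binary ?n) * ?m)"
        by (simp add: D.tally_exponent_def D.kap_def dec)
      have dT: "T = D.dec_T y" if "\<not> ?n \<le> D.dec_T y" using that n_len by (auto simp: dec(5))
      have "(umps_opt I \<le> real T \<longrightarrow> decide ?p) \<and> (umps_opt I > ?l powr (3/4) * real T \<longrightarrow> \<not> decide ?p)"
      proof (cases "?n = 0")
        case True
        then have "umps_opt I = 0"
          using cInf_eq_minimum[of 0 "{makespan ?n (umps_dur I) start | start. feasible ?n (set (umps_prec I)) (\<lambda>j. umps_machine_of I ! j) (umps_dur I) start}"]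
            inst by (auto simp: umps_opt_def makespan_def feasible_def umps_instance_def strict_order_on_def)
        then show ?thesis using True by (simp add: decide_def dec not_less)
      next
        case False
        then have n2: "2 \<le> ?n" using n1 by linarith
        then have l1: "1 \<le> ?l" by (simp add: le_log_iff)
        \<comment> \<open>A trivial \<open>K\<close>, taken just to obtain the bounds
          \<open>1 \<le> umps_opt I\<close> and \<open>umps_opt I \<le> n\<close>.\<close>
        interpret E: umps_to_q I "?m * ?n * ?n" using inst unit False by unfold_locales auto
        have gap1: "1 \<le> ?l powr (3/4)" using l1 by (simp add: ge_one_powr_ge_zero)
        show ?thesis
        proof (cases "?n \<le> D.dec_T y")
          case True
          then have "real ?n \<le> real T" by (simp add: dec(5))
          then have "umps_opt I \<le> 1 * real T" using E.umps_opt_le_jobs by linarith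
          also have "\<dots> \<le> ?l powr (3/4) * real T" using gap1 by (intro mult_right_mono) auto
          finally show ?thesis using True by (simp add: decide_def dec(2))
        next
          case less: False
          note dT = dT[OF less]
          show ?thesis
          proof (cases "?n \<le> N0")
            case True
            have "D.dec_T y < N0" using less True by linarith
            then have "decide ?p \<longleftrightarrow> umps_opt I \<le> real T"
              using less True tbl(2)[OF inst unit True m_small[OF True n2]] dT by (simp add: decide_def dec(2,3,4))
            moreover have "real T \<le> ?l powr (3/4) * real T" using gap1 mult_right_mono[of 1 "?l powr (3/4)" "real T"] by simp
            ultimately show ?thesis by linarith
          next
            case large: False
            then have big: "1 \<le> ?l" "?l powr C \<le> real ?n" "5 * sqrt (2 * (?l + 1)) \<le> ?l powr (3/4)"
              "18 * ?l powr (1/4) \<le> sqrt (?l / 2)" using N0(2)[of ?n] by auto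
            show ?thesis
            proof (cases "T = 0")
              case True
              then have "\<not> decide ?p" using less large dT by (simp add: decide_def dec(2))
              then show ?thesis using True E.umps_opt_ge_1 by simp
            next
              case T: False
              let ?K = "2 ^ (3 * length (binary ?n)) :: nat"
              have "?m \<le> ?n" using m big(2) by linarith
              then interpret Q: umps_to_q I ?K
                using inst unit False cube_le_two_power_binary by unfold_locales auto
              let ?Q = "q_of_umps ?K ?m (umps_machine_of I) (umps_prec I)"
              define h where "h = length (binary (length (binary ?n))) div 2"
              define e where "e = length (binary T) + h"
              have kap: "D.kap y = 3 * length (binary ?n)" by (simp add: D.kap_def dec)
              have ms: "length (D.dec_ms y) = D.dec_n y" "\<forall>i\<in>set (D.dec_ms y). i < D.dec_m y"
                using inst by (auto simp: dec umps_jobs_def umps_instance_def)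
              note enc = D.encoded_correct[OF ms, unfolded kap dec(1,3,4)]
              obtain S where S: "computes_in M (enc_q ?Q) (enc_schedule S) (length (enc_q ?Q) ^ k + k)"
                "q_schedule ?Q S" "q_makespan ?Q (sched_mach S) (sched_start S) \<le> g (q_machines ?Q) * q_opt ?Q"
                using M(2)[OF Q.q_instance_Q] by blast
              have "run ?p = enc_schedule S" unfolding run_def enc(3) by (rule R(2)[OF S(1)])
              moreover have "D.ratio_exponent y = e" by (simp add: D.ratio_exponent_def e_def h_def dec(2) dT[symmetric])
              ultimately have "D.accepts ?p (run ?p) \<longleftrightarrow> Q.short_schedule e S"
                using Q.accepts_enc_schedule[OF S(2) enc(1,2)] by simp
              then have dec_iff: "decide ?p \<longleftrightarrow> Q.short_schedule e S"
                using less large T dT by (simp add: decide_def dec(2))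
              have hb: "sqrt (?l / 2) \<le> 2 ^ h" "2 ^ h \<le> sqrt (2 * (?l + 1))"
                using sqrt_log_bounds[OF big(1)] by (simp_all add: h_def)
              have T_lt: "real T \<le> 2 ^ length (binary T)"
                using less_two_power_binary[of T] by (metis of_nat_le_iff of_nat_numeral of_nat_power less_imp_le)
              have T_gt: "2 ^ length (binary T) \<le> 2 * real T"
                using two_power_binary_le[of T] T by (metis of_nat_le_iff of_nat_numeral of_nat_power of_nat_mult gr0I)
              \<comment> \<open>The ratio of the algorithm is at most \<open>2 ^ h\<close> and
                \<open>T\<close> is at most \<open>2 ^ length (binary T)\<close>, so on a
                yes-instance the schedule found ends by \<open>2 ^ e\<close>.\<close>
              have "Q.short_schedule e S" if yes: "umps_opt I \<le> real T"
              proof (rule Q.short_schedule_if_makespan_le[OF S(2)])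
                note log_machines = Q.log_machines_le[OF refl C big(1) m]
                have "g (q_machines ?Q) \<le> log 2 (real (q_machines ?Q)) powr \<gamma>"
                  using log_machines(2) large by (intro N0(1)) simp
                also have "\<dots> \<le> 2 ^ h" using log_machines(1) big(4) hb(1) by (simp add: \<gamma>_def)
                finally have "g (q_machines ?Q) * q_opt ?Q \<le> 2 ^ h * q_opt ?Q"
                  using Q.q_opt_nonneg by (rule mult_right_mono)
                also have "\<dots> \<le> 2 ^ h * 2 ^ length (binary T)"
                proof (rule mult_left_mono)
                  show "q_opt ?Q \<le> 2 ^ length (binary T)" using Q.q_opt_le_umps_opt yes T_lt by linarith
                qed simp
                also have "\<dots> = 2 ^ e" by (simp add: e_def power_add)
                finally show "q_makespan ?Q (sched_mach S) (sched_start S) \<le> 2 ^ e" using S(3) by linarith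
                have "length (binary T) \<le> length (binary ?n)"
                  unfolding length_binary_le_iff using less_two_power_binary[of ?n] less dT by linarith
                moreover have "h \<le> length (binary ?n)"
                  unfolding h_def using length_binary_le[of "length (binary ?n)"] by linarith
                moreover have "0 < real (length (binary ?n))"
                  using log_length_binary(1)[OF Q.jobs] big(1) by linarith
                \<comment> \<open>\<open>length (binary T)\<close> and \<open>h\<close> are both at
                  most the bit length of \<open>n\<close>. The exponent 3, chosen for
                  \<open>m * n * n\<close>, thus also ensures \<open>2 ^ e < K\<close>.\<close>
                ultimately have "e < 3 * length (binary ?n)" unfolding e_def of_nat_0_less_iff by linarith
                then show "2 ^ e < real ?K" by simp
              qed
              moreover have "\<not> Q.short_schedule e S" if no: "umps_opt I > ?l powr (3/4) * real T"
              proof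
                assume "Q.short_schedule e S"
                then have "q_makespan ?Q (sched_mach S) (sched_start S) \<le> 2 ^ (e + 1) + 1"
                  by (rule Q.makespan_le_if_short_schedule[OF S(2)])
                moreover have "umps_opt I \<le> q_makespan ?Q (sched_mach S) (sched_start S)"
                  using S(2) by (intro Q.umps_opt_le_q_makespan) (simp add: q_schedule_def)
                \<comment> \<open>\<open>2 ^ (e + 1)\<close> is at most \<open>4 * 2 ^ h * T\<close>
                  and the extra 1 at most \<open>2 ^ h * T\<close>, whence the constant 5 in
                  \<open>eventually_large\<close>.\<close>
                moreover have "2 ^ (e + 1) + 1 \<le> ?l powr (3/4) * real T"
                proof -
                  have "(2::real) ^ (e + 1) = 2 * 2 ^ h * 2 ^ length (binary T)" by (simp add: e_def power_add)
                  also have "\<dots> \<le> 2 * 2 ^ h * (2 * real T)" using T_gt by (intro mult_left_mono) auto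
                  finally have "2 ^ (e + 1) \<le> 4 * 2 ^ h * real T" by simp
                  moreover have "1 * 1 \<le> 2 ^ h * real T" using T by (intro mult_mono) auto
                  ultimately have "2 ^ (e + 1) + 1 \<le> (5 * 2 ^ h) * real T" unfolding mult.assoc by linarith
                  also have "\<dots> \<le> ?l powr (3/4) * real T"
                    using hb(2) big(3) by (intro mult_right_mono) auto
                  finally show ?thesis .
                qed
                ultimately show False using no by linarith
              qed
              ultimately show ?thesis using dec_iff by blast
            qed
          qed
        qed
      qed
      then show ?thesis using n_len texp by blast
    qed

    have "class_NP \<subseteq> quasi_poly_time"
    proof
      fix L
      assume L: "L \<in> class_NP"
      let ?P = "\<lambda>I. real (umps_machines I) \<le> log 2 (real (umps_jobs I)) powr C \<and> umps_unit I"
      let ?Y = "{enc_umps_threshold I T | I T. umps_instance I \<and> ?P I \<and> umps_opt I \<le> real T}"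
      let ?N = "{enc_umps_threshold I T | I T. umps_instance I \<and> ?P I \<and>
            umps_opt I > log 2 (real (umps_jobs I)) powr (3/4) * real T}"
      have "NP_hard_promise ?Y ?N"
        \<comment> \<open>\<open>\<epsilon> = 1/4\<close> turns the gap into
          \<open>log 2 n powr (3/4)\<close>.\<close>
        using hard[of "1/4"] unfolding umps_NP_hard_to_approximate_def by simp
      from bspec[OF this[unfolded NP_hard_promise_def] L]
      obtain f where f: "poly_time_computable f" "\<forall>x. (x \<in> L \<longrightarrow> f x \<in> ?Y) \<and> (x \<notin> L \<longrightarrow> f x \<in> ?N)"
        by (elim exE conjE)
      have fpf: "fp f" by (rule poly_time_computable_fp[OF f(1)])
      obtain K where K: "\<And>x. sz (f x) \<le> (sz x + 2) ^ K"
        using poly_bounded_fp[OF fpf] unfolding poly_bounded_def by blast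
      define c where "c = nat \<lceil>C\<rceil>"
      define a where "a = 6 * (4 * (K + 1)) ^ (c + 1)"
      have key: "decide (f x, 2 ^ D.tally_exponent (f x)) = (x \<in> L) \<and>
          real (D.tally_exponent (f x)) \<le> real a * log 2 (real (length x) + 2) ^ a" for x
      proof -
        obtain I T where I: "f x = enc_umps_threshold I T" "umps_instance I" "?P I"
          "(x \<in> L \<and> umps_opt I \<le> real T) \<or> (x \<notin> L \<and> umps_opt I > log 2 (real (umps_jobs I)) powr (3/4) * real T)"
          using f(2)[rule_format, of x] by (cases "x \<in> L") auto
        note corr = correct[OF I(2) conjunct2[OF I(3)] conjunct1[OF I(3)] I(1)]
        let ?n = "umps_jobs I" and ?z = "log 2 (real (length x) + 2)"
        have z: "1 \<le> ?z" by (simp add: le_log_iff)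
        have "real (D.tally_exponent (f x)) \<le> real a * ?z ^ a"
        proof (cases "umps_machines I = 0")
          case True
          then show ?thesis using corr z by simp
        next
          case False
          have l0: "?n \<noteq> 0"
          proof
            assume "?n = 0"
            then have "log 2 (real ?n) powr C = 0" by (simp add: log_def)
            then show False using False I(3) by linarith
          qed
          have l1: "1 \<le> log 2 (real ?n)"
          proof -
            have "?n \<noteq> 1" using False I(3) by auto
            then show ?thesis using l0 by (simp add: le_log_iff)
          qed
          \<comment> \<open>A polynomial-time reduction creates polynomially many jobs only, so
            \<open>log 2 n\<close> is at most a constant times \<open>log 2 (length x + 2)\<close>,
            and the exponent of the tally is polylogarithmic in the length of
            \<open>x\<close>.\<close>
          have "?n \<le> length (f x)" using corr by blast
          also have "\<dots> \<le> sz (f x)" by (rule length_le_sz)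
          also have "\<dots> \<le> (sz x + 2) ^ K" by (rule K)
          also have "\<dots> \<le> (4 * (length x + 2)) ^ K"
          proof (rule power_mono)
            have "sz x \<le> 1 + length x * (3 + 1)" by (intro sz_list_le) (auto intro: sz_bool)
            then show "sz x + 2 \<le> 4 * (length x + 2)" by simp
          qed simp
          finally have "real ?n \<le> real ((4 * (length x + 2)) ^ K)" by (simp only: of_nat_le_iff)
          then have "log 2 (real ?n) \<le> log 2 (real ((4 * (length x + 2)) ^ K))"
            using l0 by (intro log_mono) auto
          also have "\<dots> = real K * log 2 (4 * (real (length x) + 2))"
            by (simp add: log_nat_power add.commute)
          also have "log 2 (4 * (real (length x) + 2)) = 2 + ?z"
          proof -
            have "log 2 (4::real) = 2" using log_nat_power[of 2 2 2] by simp
            moreover have "log 2 (4 * (real (length x) + 2)) = log 2 4 + ?z" by (subst log_mult) auto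
            ultimately show ?thesis by linarith
          qed
          also have "real K * (2 + ?z) \<le> real K * (3 * ?z)" using z by (intro mult_left_mono) auto
          finally have l: "log 2 (real ?n) \<le> 3 * (real K * ?z)" by simp
          have Kz: "0 \<le> real K * ?z" "4 * real (K + 1) * ?z = 4 * (real K * ?z) + 4 * ?z"
            using z by (simp_all add: algebra_simps)
          have lz: "log 2 (real ?n) \<le> 4 * real (K + 1) * ?z"
            unfolding Kz(2) using l z Kz(1) by linarith
          have "real (length (binary ?n)) \<le> 4 * real (K + 1) * ?z"
            unfolding Kz(2) using log_length_binary(2)[of ?n] l0 l z Kz(1) by linarith
          moreover have "real (umps_machines I) \<le> (4 * real (K + 1) * ?z) ^ c"
          proof -
            have "real (umps_machines I) \<le> log 2 (real ?n) powr C" using I(3) by blast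
            also have "\<dots> \<le> log 2 (real ?n) powr real c"
              using l1 C by (intro powr_mono) (auto simp: c_def of_nat_nat)
            also have "\<dots> = log 2 (real ?n) ^ c" using l1 by (simp add: powr_realpow)
            also have "\<dots> \<le> (4 * real (K + 1) * ?z) ^ c" using lz l1 by (intro power_mono) auto
            finally show ?thesis .
          qed
          ultimately have "real (2 * (3 * length (binary ?n) * umps_machines I)) \<le> real a * ?z ^ a"
            by (rule polylog_product_bound[OF z a_def])
          then show ?thesis using corr by simp
        qed
        moreover have "decide (f x, 2 ^ D.tally_exponent (f x)) = (x \<in> L)"
          using corr I(4) by blast
        ultimately show ?thesis by (rule conjI[rotated])
      qed
      have "fp (\<lambda>x. D.tally_exponent (f x))" "fp (\<lambda>p. decide (f (fst p), snd p))"
        by (intro fp_intros fpf fp_comp[OF fpf] fp_comp[OF fp_decide])+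
      from quasi_poly_time_tally[OF this conjunct2[OF key]]
      have "{x. decide (f x, 2 ^ D.tally_exponent (f x))} \<in> quasi_poly_time" by simp
      moreover have "{x. decide (f x, 2 ^ D.tally_exponent (f x))} = L" using key by simp
      ultimately show "L \<in> quasi_poly_time" by simp
    qed
    then show False using assms(2) by blast
  qed
  ultimately show ?thesis by (intro exI[of _ \<gamma>] conjI exI[of _ 1]) auto
qed

end
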